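(* Let $V$ be a closed connected manifold of dimension $q$, $W$ a manifold of dimension $q$, and $S\subset V$ a closed non-empty $(q-1)$-dimensional submanifold. Then the subspaces $\mathfrak{M}_{taut}(V,W,S)\subset\mathfrak{M}(V,W,S)$ and $\mathfrak{M}_{soft}(V,W,S)\subset\mathfrak{M}(V,W,S)$ are open and closed, i.e. they consist of whole connected components of $\mathfrak{M}(V,W,S)$.
   Context: All manifolds and maps are smooth; spaces of maps carry the $C^\infty$-topology. A point $p\in V$ is a fold point of $f:V\to W$ if near $p$ the map $f$ is equivalent (under local coordinate changes in source and target) to $(y,x)\mapsto (y,x^2)$, $y\in\mathbb{R}^{q-1}$, $x\in\mathbb{R}$. An $S$-immersion is a smooth map $f:V\to W$ whose singular set is exactly $S$ and consists of fold points; $\mathfrak{M}(V,W,S)$ is the space of $S$-immersions. $f\in\mathfrak{M}(V,W,S)$ is taut if there is a smooth involution $\alpha:V\to V$ with $\mathrm{Fix}\,\alpha=S$ and $f\circ\alpha=f$; otherwise $f$ is soft. $\mathfrak{M}_{taut}(V,W,S)$ and $\mathfrak{M}_{soft}(V,W,S)=\mathfrak{M}(V,W,S)\setminus\mathfrak{M}_{taut}(V,W,S)$ are the subspaces of taut and soft maps. *)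

theory Defs
  imports "HOL-Analysis.Analysis"
begin

text \<open>Iterated directional derivatives; the last vector of the list is applied first.\<close>

primrec iter_deriv ::
  "'v::real_normed_vector list \<Rightarrow> ('v \<Rightarrow> 'w::real_normed_vector) \<Rightarrow> 'v \<Rightarrow> 'w" where
  "iter_deriv [] f = f"
| "iter_deriv (v # vs) f = (\<lambda>x. frechet_derivative (iter_deriv vs f) (at x) v)"

text \<open>Only meant for open \<open>X\<close>: the derivatives are taken in the ambient space. Since every
  iterated derivative is required to be differentiable, all of them are continuous on \<open>X\<close>.\<close>

definition smooth_on ::
  "'v::real_normed_vector set \<Rightarrow> ('v \<Rightarrow> 'w::real_normed_vector) \<Rightarrow> bool" where
  "smooth_on X f \<longleftrightarrow> (\<forall>vs. \<forall>x\<in>X. iter_deriv vs f differentiable (at x))"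

text \<open>A manifold is a whole type of class \<open>t2_space\<close> and \<open>second_countable_topology\<close> together
  with an atlas of pairs \<open>(U, \<phi>)\<close>. The function \<open>\<phi>\<close> is total, but its values outside \<open>U\<close> are
  irrelevant. The dimension is \<open>CARD('n)\<close>, and there is no boundary, because chart images are
  open in \<open>real ^ 'n\<close>.\<close>

type_synonym ('a, 'n) atlas = "('a set \<times> ('a \<Rightarrow> real ^ 'n)) set"

definition top_chart :: "'a::topological_space set \<Rightarrow> ('a \<Rightarrow> real ^ 'n) \<Rightarrow> bool" where
  "top_chart U \<phi> \<longleftrightarrow> open U \<and> open (\<phi> ` U) \<and> homeomorphism U (\<phi> ` U) \<phi> (inv_into U \<phi>)"

text \<open>The maximal atlas determined by an atlas.\<close>

definition charts :: "('a::topological_space, 'n::finite) atlas \<Rightarrow> ('a, 'n) atlas" where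
  "charts A = {(U, \<phi>). top_chart U \<phi> \<and>
     (\<forall>(U', \<phi>')\<in>A. smooth_on (\<phi> ` (U \<inter> U')) (\<phi>' \<circ> inv_into U \<phi>) \<and>
                   smooth_on (\<phi>' ` (U \<inter> U')) (\<phi> \<circ> inv_into U' \<phi>'))}"

definition smooth_manifold ::
  "('a::{t2_space,second_countable_topology}, 'n::finite) atlas \<Rightarrow> bool" where
  "smooth_manifold A \<longleftrightarrow> A \<subseteq> charts A \<and> (\<Union>(U, \<phi>)\<in>A. U) = UNIV"

text \<open>The expression of a map in a chart \<open>(U, \<phi>)\<close> of the source and a chart with coordinate
  map \<open>\<psi>\<close> of the target.\<close>

definition local_expr ::
  "'a set \<Rightarrow> ('a \<Rightarrow> real ^ 'n) \<Rightarrow> ('b \<Rightarrow> real ^ 'm) \<Rightarrow> ('a \<Rightarrow> 'b) \<Rightarrow> real ^ 'n \<Rightarrow> real ^ 'm" where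
  "local_expr U \<phi> \<psi> f = \<psi> \<circ> f \<circ> inv_into U \<phi>"

definition smooth_map ::
  "('a::topological_space, 'n::finite) atlas \<Rightarrow> ('b::topological_space, 'm::finite) atlas
    \<Rightarrow> ('a \<Rightarrow> 'b) \<Rightarrow> bool" where
  "smooth_map V W f \<longleftrightarrow> continuous_on UNIV f \<and>
     (\<forall>(U, \<phi>)\<in>charts V. \<forall>(U', \<psi>)\<in>charts W.
        smooth_on (\<phi> ` (U \<inter> f -` U')) (local_expr U \<phi> \<psi> f))"

definition embedded_submanifold ::
  "('a::topological_space, 'n::finite) atlas \<Rightarrow> nat \<Rightarrow> 'a set \<Rightarrow> bool" where
  "embedded_submanifold V d S \<longleftrightarrow>
     (\<forall>p\<in>S. \<exists>(U, \<phi>)\<in>charts V. \<exists>E. p \<in> U \<and> subspace E \<and> dim E = d \<and>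
        \<phi> ` (U \<inter> S) = \<phi> ` U \<inter> E)"

text \<open>A basic neighbourhood of \<open>f\<close> in the \<open>C\<^sup>\<infinity>\<close>-topology: the maps that are \<open>\<epsilon>\<close>-close to \<open>f\<close>
  together with all partial derivatives of order at most \<open>r\<close>, on a compact set \<open>K\<close> and in given
  charts. This generates the weak topology, which for compact \<open>V\<close> is also the strong one.\<close>

definition Cinf_nbhd ::
  "('a::topological_space, 'n::finite) atlas \<Rightarrow> ('b::topological_space, 'm::finite) atlas
    \<Rightarrow> ('a \<Rightarrow> 'b) \<Rightarrow> nat \<Rightarrow> 'a set \<Rightarrow> ('a \<Rightarrow> real ^ 'n) \<Rightarrow> 'b set \<Rightarrow> ('b \<Rightarrow> real ^ 'm)
    \<Rightarrow> 'a set \<Rightarrow> real \<Rightarrow> ('a \<Rightarrow> 'b) set" where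
  "Cinf_nbhd V W f r U \<phi> U' \<psi> K \<epsilon> =
     {g. smooth_map V W g \<and> g ` K \<subseteq> U' \<and>
         (\<forall>x\<in>K. \<forall>vs. set vs \<subseteq> Basis \<and> length vs \<le> r \<longrightarrow>
            norm (iter_deriv vs (local_expr U \<phi> \<psi> g) (\<phi> x) -
                  iter_deriv vs (local_expr U \<phi> \<psi> f) (\<phi> x)) < \<epsilon>)}"

definition Cinf_topology ::
  "('a::topological_space, 'n::finite) atlas \<Rightarrow> ('b::topological_space, 'm::finite) atlas
    \<Rightarrow> ('a \<Rightarrow> 'b) topology" where
  "Cinf_topology V W = topology_generated_by
     {Cinf_nbhd V W f r U \<phi> U' \<psi> K \<epsilon> | f r U \<phi> U' \<psi> K \<epsilon>.
        smooth_map V W f \<and> (U, \<phi>) \<in> charts V \<and> (U', \<psi>) \<in> charts W \<and>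
        compact K \<and> K \<subseteq> U \<and> f ` K \<subseteq> U' \<and> \<epsilon> > 0}"

definition singular_set ::
  "('a::topological_space, 'n::finite) atlas \<Rightarrow> ('b::topological_space, 'n) atlas
    \<Rightarrow> ('a \<Rightarrow> 'b) \<Rightarrow> 'a set" where
  "singular_set V W f = {p. \<exists>(U, \<phi>)\<in>charts V. \<exists>(U', \<psi>)\<in>charts W. p \<in> U \<and> f p \<in> U' \<and>
     rank (jacobian (local_expr U \<phi> \<psi> f) (at (\<phi> p))) < CARD('n)}"

text \<open>The standard fold \<open>(y, x) \<mapsto> (y, x\<^sup>2)\<close>, with the \<open>k\<close>-th coordinate in the role of \<open>x\<close>.\<close>

definition fold_model :: "'n \<Rightarrow> real ^ 'n \<Rightarrow> real ^ 'n" where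
  "fold_model k z = (\<chi> i. if i = k then (z $ i)\<^sup>2 else z $ i)"

text \<open>The point \<open>p\<close> must sit at the origin of its chart: away from \<open>x = 0\<close> the standard fold is a
  local diffeomorphism.\<close>

definition fold_point ::
  "('a::topological_space, 'n::finite) atlas \<Rightarrow> ('b::topological_space, 'n) atlas
    \<Rightarrow> ('a \<Rightarrow> 'b) \<Rightarrow> 'a \<Rightarrow> bool" where
  "fold_point V W f p \<longleftrightarrow>
     (\<exists>(U, \<phi>)\<in>charts V. \<exists>(U', \<psi>)\<in>charts W. \<exists>k. p \<in> U \<and> f ` U \<subseteq> U' \<and> \<phi> p = 0 \<and>
        (\<forall>u\<in>U. \<psi> (f u) = fold_model k (\<phi> u)))"

definition S_immersions ::
  "('a::topological_space, 'n::finite) atlas \<Rightarrow> ('b::topological_space, 'n) atlas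
    \<Rightarrow> 'a set \<Rightarrow> ('a \<Rightarrow> 'b) set" where
  "S_immersions V W S =
     {f. smooth_map V W f \<and> singular_set V W f = S \<and> (\<forall>p\<in>S. fold_point V W f p)}"

definition taut_maps ::
  "('a::topological_space, 'n::finite) atlas \<Rightarrow> ('b::topological_space, 'n) atlas
    \<Rightarrow> 'a set \<Rightarrow> ('a \<Rightarrow> 'b) set" where
  "taut_maps V W S =
     {f \<in> S_immersions V W S. \<exists>\<alpha>. smooth_map V V \<alpha> \<and> \<alpha> \<circ> \<alpha> = id \<and>
        {x. \<alpha> x = x} = S \<and> f \<circ> \<alpha> = f}"

definition soft_maps ::
  "('a::topological_space, 'n::finite) atlas \<Rightarrow> ('b::topological_space, 'n) atlas
    \<Rightarrow> 'a set \<Rightarrow> ('a \<Rightarrow> 'b) set" where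
  "soft_maps V W S = S_immersions V W S - taut_maps V W S"

definition S_immersion_space ::
  "('a::topological_space, 'n::finite) atlas \<Rightarrow> ('b::topological_space, 'n) atlas
    \<Rightarrow> 'a set \<Rightarrow> ('a \<Rightarrow> 'b) topology" where
  "S_immersion_space V W S = subtopology (Cinf_topology V W) (S_immersions V W S)"

end

theory Submission
  imports Defs
begin

text \<open>For an \<open>S\<close>-immersion \<open>h\<close> consider the compact set of partners
  \<open>{(x, y). h x = h y, x \<noteq> y} \<union> {(s, s). s \<in> S}\<close> in \<open>V \<times> V\<close>. An involution making \<open>h\<close> taut is the same
  as a symmetric clopen subset of it that contains the diagonal of \<open>S\<close> and no other point over \<open>S\<close>:
  such a set is a covering of the connected \<open>V\<close>, and it is one-sheeted because it is so over \<open>S\<close>.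
  The set of partners depends upper semicontinuously on \<open>h\<close>, because near a fold point all nearby
  \<open>S\<close>-immersions are at most two-to-one on a common neighbourhood, so a clopen piece persists for
  nearby maps: tautness is open. If \<open>f\<close> is a limit of taut maps, the cluster points of the graphs
  of their involutions form such a clopen subset for \<open>f\<close>: tautness is closed. A continuous
  involution obtained in this way is automatically smooth, since it is a reflection in fold charts
  and a branch of \<open>h\<^sup>-\<^sup>1 \<circ> h\<close> elsewhere.\<close>

section \<open>Calculus of smooth maps\<close>

text \<open>The difficulty sits at \<open>S\<close>, where partners merge with the diagonal and
  local injectivity fails. It is overcome because all maps in the space share one singular set: in a
  fold chart of \<open>f\<close> the derivative of every nearby \<open>S\<close>-immersion
  degenerates along the same hyperplane, and closeness up to second derivatives then bounds the
  number of preimages on a ball that serves all these maps. The covering argument is purely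
  topological and lives in the locale \<open>fold_space\<close>, whose involutions are only
  continuous, so no limit has to be controlled together with its derivatives. Smooth analysis enters
  in verifying the locale assumptions and in upgrading a continuous involution to a smooth one.
  Closedness works with neighbourhoods instead of sequences. The involutions of different taut maps
  near \<open>f\<close> are not known to be compatible, so their cluster points are pooled; that the
  pooled set is the graph of one function follows only afterwards, from connectedness of the
  source.\<close>

primrec times_diff :: "nat \<Rightarrow> 'v::real_normed_vector set \<Rightarrow> ('v \<Rightarrow> 'w::real_normed_vector) \<Rightarrow> bool" where
  "times_diff 0 X f \<longleftrightarrow> True"
| "times_diff (Suc k) X f \<longleftrightarrow> (\<forall>x\<in>X. f differentiable (at x)) \<and>
     (\<forall>v. times_diff k X (\<lambda>x. frechet_derivative f (at x) v))"

lemma iter_deriv_snoc: "iter_deriv (vs @ [v]) f = iter_deriv vs (\<lambda>x. frechet_derivative f (at x) v)"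
  by (induction vs) simp_all

text \<open>\<open>times_diff\<close> differentiates first and recurses afterwards, while
  \<open>iter_deriv\<close> peels off the outermost derivative; \<open>iter_deriv_snoc\<close>
  reconciles the two orders. The first form suits inductions on the order with the function
  generalised. The shift by one arises because each iterated derivative, not only \<open>f\<close>,
  has to be differentiable.\<close>

lemma times_diff_Suc_iff:
  "times_diff (Suc k) X f \<longleftrightarrow> (\<forall>vs. length vs \<le> k \<longrightarrow> (\<forall>x\<in>X. iter_deriv vs f differentiable (at x)))"
proof (induction k arbitrary: f)
  case 0
  then show ?case by simp
next
  case (Suc k)
  have "times_diff (Suc (Suc k)) X f \<longleftrightarrow> (\<forall>x\<in>X. f differentiable (at x)) \<and>
    (\<forall>v vs. length vs \<le> k \<longrightarrow> (\<forall>x\<in>X. iter_deriv (vs @ [v]) f differentiable (at x)))"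
    by (subst times_diff.simps(2)) (simp only: Suc.IH iter_deriv_snoc)
  also have "\<dots> \<longleftrightarrow> (\<forall>vs. length vs \<le> Suc k \<longrightarrow> (\<forall>x\<in>X. iter_deriv vs f differentiable (at x)))"
    (is "?L \<longleftrightarrow> ?R")
  proof
    assume L: ?L
    show ?R
    proof (intro allI impI)
      fix vs :: "'a list" assume "length vs \<le> Suc k"
      then show "\<forall>x\<in>X. iter_deriv vs f differentiable (at x)"
        using L by (cases vs rule: rev_cases) auto
    qed
  next
    assume R: ?R
    have "iter_deriv [] f differentiable (at x)" if "x \<in> X" for x using R that by (metis le0 list.size(3))
    moreover have "\<forall>v vs. length vs \<le> k \<longrightarrow> (\<forall>x\<in>X. iter_deriv (vs @ [v]) f differentiable (at x))"
      using R by simp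
    ultimately show ?L by simp
  qed
  finally show ?case .
qed

lemma smooth_on_iff: "smooth_on X f \<longleftrightarrow> (\<forall>k. times_diff k X f)"
proof
  assume f: "smooth_on X f"
  show "\<forall>k. times_diff k X f"
  proof
    fix k
    show "times_diff k X f"
    proof (cases k)
      case (Suc m)
      then show ?thesis using f unfolding smooth_on_def by (simp only: times_diff_Suc_iff) blast
    qed simp
  qed
next
  assume f: "\<forall>k. times_diff k X f"
  have "\<forall>x\<in>X. iter_deriv vs f differentiable (at x)" for vs
    using f[rule_format, of "Suc (length vs)"] unfolding times_diff_Suc_iff by blast
  then show "smooth_on X f" unfolding smooth_on_def by blast
qed

section \<open>Locality of derivatives and of smoothness\<close>

lemma smooth_on_subset: "smooth_on X f \<Longrightarrow> Y \<subseteq> X \<Longrightarrow> smooth_on Y f"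
  unfolding smooth_on_def by blast

lemma smooth_on_local:
  assumes "\<And>x. x \<in> X \<Longrightarrow> \<exists>Y. x \<in> Y \<and> smooth_on Y f"
  shows "smooth_on X f"
  unfolding smooth_on_def
proof (intro allI ballI)
  fix vs x assume "x \<in> X"
  then obtain Y where "x \<in> Y" "smooth_on Y f" using assms by blast
  then show "iter_deriv vs f differentiable at x" unfolding smooth_on_def by blast
qed

text \<open>Functions that agree near \<open>x\<close> have the same set of derivatives there, so
  the choice operator in \<open>frechet_derivative\<close> selects the same value, even where there
  is no derivative at all. Hence the second claim carries no differentiability assumption.\<close>

lemma frechet_derivative_cong_open:
  assumes X: "open X" "x \<in> X" and eq: "\<And>x. x \<in> X \<Longrightarrow> f x = g x"
  shows "f differentiable (at x) \<longleftrightarrow> g differentiable (at x)"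
    "frechet_derivative f (at x) = frechet_derivative g (at x)"
proof -
  have *: "(f has_derivative D) (at x) \<longleftrightarrow> (g has_derivative D) (at x)" for D
  proof
    show "(g has_derivative D) (at x)" if "(f has_derivative D) (at x)"
      using that X eq by (rule has_derivative_transform_within_open)
    show "(f has_derivative D) (at x)" if "(g has_derivative D) (at x)"
      using that X eq[symmetric] by (rule has_derivative_transform_within_open)
  qed
  show "f differentiable (at x) \<longleftrightarrow> g differentiable (at x)"
    "frechet_derivative f (at x) = frechet_derivative g (at x)"
    unfolding differentiable_def frechet_derivative_def by (simp_all add: *)
qed

lemma iter_deriv_cong:
  assumes X: "open X" and eq: "\<And>x. x \<in> X \<Longrightarrow> f x = g x" and "x \<in> X"
  shows "iter_deriv vs f x = iter_deriv vs g x"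
  using \<open>x \<in> X\<close>
proof (induction vs arbitrary: x)
  case (Cons v vs)
  then show ?case using frechet_derivative_cong_open(2)[OF X Cons.prems, of "iter_deriv vs f" "iter_deriv vs g"] by simp
qed (simp add: eq)

lemma smooth_on_cong:
  assumes X: "open X" and eq: "\<And>x. x \<in> X \<Longrightarrow> f x = g x"
  shows "smooth_on X f \<longleftrightarrow> smooth_on X g"
proof -
  have "iter_deriv vs f differentiable (at x) \<longleftrightarrow> iter_deriv vs g differentiable (at x)" if "x \<in> X" for vs x
    using X that iter_deriv_cong[OF X eq] by (rule frechet_derivative_cong_open(1))
  then show ?thesis unfolding smooth_on_def by blast
qed

lemma times_diff_cong:
  assumes X: "open X" and eq: "\<And>x. x \<in> X \<Longrightarrow> f x = g x"
  shows "times_diff k X f \<longleftrightarrow> times_diff k X g"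
proof (cases k)
  case (Suc m)
  have "iter_deriv vs f differentiable (at x) \<longleftrightarrow> iter_deriv vs g differentiable (at x)" if "x \<in> X" for vs x
    using X that iter_deriv_cong[OF X eq] by (rule frechet_derivative_cong_open(1))
  then show ?thesis unfolding Suc times_diff_Suc_iff by blast
qed simp

text \<open>Lets an explicitly computed derivative stand in for \<open>frechet_derivative\<close>.
  Openness of \<open>X\<close> makes this replacement survive further differentiation.\<close>

lemma times_diff_SucI:
  assumes X: "open X" and f': "\<And>x. x \<in> X \<Longrightarrow> (f has_derivative f' x) (at x)"
    and k: "\<And>v. times_diff k X (\<lambda>x. f' x v)"
  shows "times_diff (Suc k) X f"
proof -
  have "frechet_derivative f (at x) v = f' x v" if "x \<in> X" for x v
    using frechet_derivative_at[OF f'[OF that]] by simp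
  then have "times_diff k X (\<lambda>x. frechet_derivative f (at x) v)" for v
    using times_diff_cong[OF X, of "\<lambda>x. frechet_derivative f (at x) v" "\<lambda>x. f' x v"] k by blast
  then show ?thesis using f' by (auto simp: differentiable_def)
qed

lemma times_diff_SucD:
  assumes "times_diff (Suc k) X f"
  shows "\<And>x. x \<in> X \<Longrightarrow> (f has_derivative frechet_derivative f (at x)) (at x)"
    "\<And>v. times_diff k X (\<lambda>x. frechet_derivative f (at x) v)"
  using assms by (auto simp: frechet_derivative_works[symmetric])

section \<open>Algebraic rules for finite order of differentiability\<close>

lemma times_diff_mono: "times_diff (Suc k) X f \<Longrightarrow> times_diff k X f"
  by (cases k) (auto simp only: times_diff_Suc_iff times_diff.simps(1))

lemma times_diff_const [simp]: "open X \<Longrightarrow> times_diff k X (\<lambda>x. c)"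
proof (induction k arbitrary: c)
  case (Suc k)
  show ?case by (rule times_diff_SucI[where f' = "\<lambda>x v. 0"]) (use Suc in auto)
qed simp

lemma times_diff_bounded_linear:
  assumes L: "bounded_linear L" and X: "open X"
  shows "times_diff k X f \<Longrightarrow> times_diff k X (\<lambda>x. L (f x))"
proof (induction k arbitrary: f)
  case (Suc k)
  show ?case
    by (rule times_diff_SucI[OF X bounded_linear.has_derivative[OF L times_diff_SucD(1)[OF Suc.prems]]])
      (auto intro: Suc.IH times_diff_SucD(2)[OF Suc.prems])
qed simp

lemma times_diff_add:
  assumes X: "open X"
  shows "times_diff k X f \<Longrightarrow> times_diff k X g \<Longrightarrow> times_diff k X (\<lambda>x. f x + g x)"
proof (induction k arbitrary: f g)
  case (Suc k)
  show ?case
    by (rule times_diff_SucI[OF X has_derivative_add[OF times_diff_SucD(1)[OF Suc.prems(1)] times_diff_SucD(1)[OF Suc.prems(2)]]])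
      (auto intro: Suc.IH times_diff_SucD(2)[OF Suc.prems(1)] times_diff_SucD(2)[OF Suc.prems(2)])
qed simp

lemma times_diff_sum:
  assumes X: "open X"
  shows "(\<And>i. i \<in> I \<Longrightarrow> times_diff k X (f i)) \<Longrightarrow> times_diff k X (\<lambda>x. \<Sum>i\<in>I. f i x)"
  by (induction I rule: infinite_finite_induct) (auto simp: X intro: times_diff_add[OF X])

lemma times_diff_bilinear:
  assumes B: "bounded_bilinear B" and X: "open X"
  shows "times_diff k X f \<Longrightarrow> times_diff k X g \<Longrightarrow> times_diff k X (\<lambda>x. B (f x) (g x))"
proof (induction k arbitrary: f g)
  case (Suc k)
  show ?case
    by (rule times_diff_SucI[OF X bounded_bilinear.FDERIV[OF B times_diff_SucD(1)[OF Suc.prems(1)] times_diff_SucD(1)[OF Suc.prems(2)]]])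
      (auto intro!: times_diff_add[OF X] Suc.IH times_diff_SucD(2)[OF Suc.prems(1)]
        times_diff_SucD(2)[OF Suc.prems(2)] times_diff_mono[OF Suc.prems(1)] times_diff_mono[OF Suc.prems(2)])
qed simp

lemmas times_diff_mult = times_diff_bilinear[OF bounded_bilinear_mult]
  and times_diff_scaleR = times_diff_bilinear[OF bounded_bilinear_scaleR]

lemma times_diff_prod:
  fixes f :: "'i \<Rightarrow> 'v::real_normed_vector \<Rightarrow> real"
  assumes X: "open X"
  shows "(\<And>i. i \<in> I \<Longrightarrow> times_diff k X (f i)) \<Longrightarrow> times_diff k X (\<lambda>x. \<Prod>i\<in>I. f i x)"
  by (induction I rule: infinite_finite_induct) (auto simp: X intro: times_diff_mult[OF X])

text \<open>The derivative of the reciprocal is a product of the reciprocal itself and the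
  derivative of \<open>f\<close>, so order \<open>k\<close> for the reciprocal yields order
  \<open>Suc k\<close>.\<close>

lemma times_diff_inverse:
  fixes f :: "'v::real_normed_vector \<Rightarrow> real"
  assumes X: "open X" and nz: "\<And>x. x \<in> X \<Longrightarrow> f x \<noteq> 0"
  shows "times_diff k X f \<Longrightarrow> times_diff k X (\<lambda>x. inverse (f x))"
proof (induction k)
  case (Suc k)
  have IH: "times_diff k X (\<lambda>x. inverse (f x))" using Suc times_diff_mono by blast
  have neg: "times_diff k X (\<lambda>x. - g x)" if "times_diff k X g" for g :: "'v \<Rightarrow> real"
    by (rule times_diff_bounded_linear[OF bounded_linear_minus[OF bounded_linear_ident] X that])
  show ?case
  proof (rule times_diff_SucI[OF X])
    show "((\<lambda>x. inverse (f x)) has_derivative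
        (\<lambda>v. - (inverse (f x) * frechet_derivative f (at x) v * inverse (f x)))) (at x)" if "x \<in> X" for x
      by (rule Deriv.has_derivative_inverse[OF nz[OF that] times_diff_SucD(1)[OF Suc.prems that]])
    show "times_diff k X (\<lambda>x. - (inverse (f x) * frechet_derivative f (at x) v * inverse (f x)))" for v
      by (intro neg times_diff_mult[OF X] IH times_diff_SucD(2)[OF Suc.prems])
  qed
qed simp

lemma linear_eq_sum_Basis:
  assumes "linear D"
  shows "D v = (\<Sum>b\<in>Basis. (v \<bullet> b) *\<^sub>R D b)"
proof -
  have "D v = D (\<Sum>b\<in>Basis. (v \<bullet> b) *\<^sub>R b)" by (simp add: euclidean_representation)
  also have "\<dots> = (\<Sum>b\<in>Basis. (v \<bullet> b) *\<^sub>R D b)"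
    using assms by (simp add: linear_sum linear_cmul)
  finally show ?thesis .
qed

lemma times_diff_compose:
  fixes f :: "'v::real_normed_vector \<Rightarrow> 'u::euclidean_space"
  assumes X: "open X" and Y: "f ` X \<subseteq> Y"
  shows "times_diff k X f \<Longrightarrow> times_diff k Y g \<Longrightarrow> times_diff k X (\<lambda>x. g (f x))"
proof (induction k arbitrary: g)
  case (Suc k)
  let ?f' = "\<lambda>x. frechet_derivative f (at x)" and ?g' = "\<lambda>y. frechet_derivative g (at y)"
  show ?case
  proof (rule times_diff_SucI[OF X])
    fix x assume x: "x \<in> X"
    then have g': "(g has_derivative ?g' (f x)) (at (f x))" using times_diff_SucD(1)[OF Suc.prems(2)] Y by blast
    have "((\<lambda>x. g (f x)) has_derivative (\<lambda>v. ?g' (f x) (?f' x v))) (at x)"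
      using diff_chain_at[OF times_diff_SucD(1)[OF Suc.prems(1) x] g'] by (simp add: o_def)
    \<comment> \<open>\<open>times_diff\<close> controls derivatives in fixed directions only,
      whereas the direction \<open>?f' x v\<close> varies with \<open>x\<close>. Expanding it in the
      basis leaves a sum of products with fixed directions.\<close>
    moreover have "?g' (f x) (?f' x v) = (\<Sum>b\<in>Basis. (?f' x v \<bullet> b) *\<^sub>R ?g' (f x) b)" for v
      by (rule linear_eq_sum_Basis) (use g' has_derivative_linear in blast)
    ultimately show "((\<lambda>x. g (f x)) has_derivative
        (\<lambda>v. \<Sum>b\<in>Basis. (?f' x v \<bullet> b) *\<^sub>R ?g' (f x) b)) (at x)" by simp
  next
    fix v
    have "times_diff k X (\<lambda>x. ?f' x v \<bullet> b)" for b
      by (rule times_diff_bounded_linear[OF bounded_linear_inner_left X times_diff_SucD(2)[OF Suc.prems(1)]])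
    moreover have "times_diff k X (\<lambda>x. ?g' (f x) b)" for b
      by (rule Suc.IH[OF times_diff_mono[OF Suc.prems(1)] times_diff_SucD(2)[OF Suc.prems(2)]])
    ultimately show "times_diff k X (\<lambda>x. \<Sum>b\<in>Basis. (?f' x v \<bullet> b) *\<^sub>R ?g' (f x) b)"
      by (intro times_diff_sum[OF X] times_diff_scaleR[OF X])
  qed
qed simp

lemma smooth_on_compose:
  fixes f :: "'v::real_normed_vector \<Rightarrow> 'u::euclidean_space"
  assumes "open X" "f ` X \<subseteq> Y" "smooth_on X f" "smooth_on Y g"
  shows "smooth_on X (\<lambda>x. g (f x))"
  using assms times_diff_compose unfolding smooth_on_iff by blast

lemma smooth_on_linear:
  assumes "bounded_linear L" "open X"
  shows "smooth_on X L"
proof -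
  have "times_diff k X (\<lambda>x. x)" for k
  proof (cases k)
    case (Suc m)
    show ?thesis unfolding Suc by (rule times_diff_SucI[where f' = "\<lambda>x v. v"]) (use assms in auto)
  qed simp
  then show ?thesis using times_diff_bounded_linear[OF assms] unfolding smooth_on_iff by blast
qed

lemma smooth_on_continuous: "smooth_on X f \<Longrightarrow> continuous_on X (iter_deriv vs f)"
  unfolding smooth_on_def by (auto intro!: continuous_at_imp_continuous_on differentiable_imp_continuous_within)

lemma smooth_on_differentiable: "smooth_on X f \<Longrightarrow> x \<in> X \<Longrightarrow> iter_deriv vs f differentiable (at x)"
  unfolding smooth_on_def by blast

section \<open>Estimates from partial derivatives\<close>

lemma norm_linear_le_Basis:
  fixes D :: "'u::euclidean_space \<Rightarrow> 'w::real_normed_vector"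
  assumes "linear D" "\<And>b. b \<in> Basis \<Longrightarrow> norm (D b) \<le> e"
  shows "norm (D v) \<le> real DIM('u) * e * norm v"
proof -
  have "norm (D v) \<le> (\<Sum>b\<in>(Basis :: 'u set). norm v * e)"
    unfolding linear_eq_sum_Basis[OF assms(1), of v]
    by (rule sum_norm_le) (auto intro!: mult_mono assms(2) simp: Basis_le_norm)
  then show ?thesis by (simp add: mult_ac)
qed

text \<open>\<open>L\<close> expands distances by a factor of at least some \<open>c\<close>, and
  \<open>H - L\<close> is Lipschitz with constant \<open>c / 2\<close>, so it cannot cancel
  \<open>L\<close>. The bound \<open>e\<close> depends on \<open>L\<close> alone; the same
  \<open>e\<close> therefore serves a whole neighbourhood of maps and every convex set.\<close>

lemma inj_on_near_linear:
  fixes L :: "'u::euclidean_space \<Rightarrow> 'u"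
  assumes L: "linear L" "inj L"
  shows "\<exists>e>0. \<forall>H C. convex C \<longrightarrow> (\<forall>x\<in>C. H differentiable (at x)) \<longrightarrow>
    (\<forall>x\<in>C. \<forall>b\<in>Basis. norm (frechet_derivative H (at x) b - L b) \<le> e) \<longrightarrow> inj_on H C"
proof -
  obtain c where c: "c > 0" "\<And>v. c * norm v \<le> norm (L v)"
    using linear_inj_bounded_below_pos[OF L] by metis
  \<comment> \<open>The factor \<open>DIM('u)\<close> is the loss in passing from partial
    derivatives to the operator norm; what remains is \<open>c / 2\<close>.\<close>
  define e where "e = c / (2 * DIM('u))"
  have e: "e > 0" "DIM('u) * e = c / 2" using c unfolding e_def by auto
  show ?thesis
  proof (intro exI[of _ e] conjI allI impI e(1))
    fix H :: "'u \<Rightarrow> 'u" and C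
    assume C: "convex C" and H: "\<forall>x\<in>C. H differentiable (at x)"
      and close: "\<forall>x\<in>C. \<forall>b\<in>Basis. norm (frechet_derivative H (at x) b - L b) \<le> e"
    show "inj_on H C"
    proof (rule inj_onI)
      fix x y assume xy: "x \<in> C" "y \<in> C" "H x = H y"
      have "norm ((H x - L x) - (H y - L y)) \<le> c / 2 * norm (x - y)"
      proof (rule differentiable_bound[OF C _ _ xy(1,2)])
        fix z assume z: "z \<in> C"
        have HD: "(H has_derivative frechet_derivative H (at z)) (at z)"
          using H z frechet_derivative_works by blast
        have LD: "(L has_derivative L) (at z)" using L by (simp add: linear_imp_has_derivative)
        show "((\<lambda>x. H x - L x) has_derivative (\<lambda>v. frechet_derivative H (at z) v - L v)) (at z within C)"
          by (rule has_derivative_at_withinI[OF has_derivative_diff[OF HD LD]])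
        have "linear (\<lambda>v. frechet_derivative H (at z) v - L v)"
          using has_derivative_diff[OF HD LD] has_derivative_linear by blast
        then have "norm (frechet_derivative H (at z) v - L v) \<le> real DIM('u) * e * norm v" for v
          using norm_linear_le_Basis close z by blast
        then show "onorm (\<lambda>v. frechet_derivative H (at z) v - L v) \<le> c / 2"
          unfolding e(2) by (intro onorm_le)
      qed
      then have "norm (L (x - y)) \<le> c / 2 * norm (x - y)"
        using xy(3) L by (simp add: linear_diff norm_minus_commute)
      then have "c * norm (x - y) \<le> c / 2 * norm (x - y)" using c(2)[of "x - y"] by linarith
      then show "x = y" using c(1) by (simp add: field_simps)
    qed
  qed
qed

lemma smooth_partials_near:
  fixes F :: "'u::euclidean_space \<Rightarrow> 'w::real_normed_vector"
  assumes F: "smooth_on Y F" and Y: "open Y" "y \<in> Y" and e: "e > 0"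
  shows "\<exists>r>0. cball y r \<subseteq> Y \<and> (\<forall>z\<in>cball y r. \<forall>b\<in>Basis.
    norm (frechet_derivative F (at z) b - frechet_derivative F (at y) b) < e)"
proof -
  have "\<forall>\<^sub>F z in nhds y. norm (frechet_derivative F (at z) b - frechet_derivative F (at y) b) < e" for b
  proof -
    have "(\<lambda>z. frechet_derivative F (at z) b) differentiable (at y)"
      using smooth_on_differentiable[OF F Y(2), of "[b]"] by simp
    then have "isCont (\<lambda>z. frechet_derivative F (at z) b) y"
      using differentiable_imp_continuous_within by blast
    then have "((\<lambda>z. frechet_derivative F (at z) b) \<longlongrightarrow> frechet_derivative F (at y) b) (nhds y)"
      using isCont_def tendsto_at_iff_tendsto_nhds by blast
    from tendstoD[OF this e] show ?thesis by (simp add: dist_norm)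
  qed
  then have "\<forall>\<^sub>F z in nhds y. z \<in> Y \<and>
      (\<forall>b\<in>Basis. norm (frechet_derivative F (at z) b - frechet_derivative F (at y) b) < e)"
    using Y by (intro eventually_conj eventually_ball_finite) (auto simp: eventually_nhds)
  then obtain r where r: "r > 0" "\<And>z. dist z y < r \<Longrightarrow> z \<in> Y \<and>
      (\<forall>b\<in>Basis. norm (frechet_derivative F (at z) b - frechet_derivative F (at y) b) < e)"
    unfolding eventually_nhds_metric by blast
  show ?thesis
    by (rule exI[of _ "r / 2"]) (use r in \<open>auto simp: dist_commute\<close>)
qed

section \<open>Smoothness of continuous solutions of \<open>F (b x) = G x\<close>\<close>

lemma det_matrix_nonzero:
  fixes D :: "real ^ 'n \<Rightarrow> real ^ 'n"
  assumes "linear D" "inj D"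
  shows "det (matrix D) \<noteq> 0"
  using assms det_nz_iff_inj by blast

text \<open>Cramer's rule expresses the partial derivatives of the solution \<open>b\<close> rationally in terms of those
  of \<open>F\<close> along \<open>b\<close> and of \<open>G\<close>, so every order of differentiability of \<open>b\<close> yields the next one.\<close>

lemma smooth_solution:
  fixes F G b :: "real ^ 'n \<Rightarrow> real ^ 'n"
  assumes F: "smooth_on Y F" and G: "smooth_on X G" and X: "open X" and Y: "open Y"
    and b: "continuous_on X b" "b ` X \<subseteq> Y" and eq: "\<And>x. x \<in> X \<Longrightarrow> F (b x) = G x"
    and inj: "\<And>x. x \<in> X \<Longrightarrow> inj (frechet_derivative F (at (b x)))"
  shows "smooth_on X b"
proof -
  let ?F' = "\<lambda>y. frechet_derivative F (at y)" and ?G' = "\<lambda>x. frechet_derivative G (at x)"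
    and ?b' = "\<lambda>x. frechet_derivative b (at x)"
  have bY: "b x \<in> Y" if "x \<in> X" for x using b(2) that by (simp add: image_subset_iff)
  have F': "(F has_derivative ?F' y) (at y)" if "y \<in> Y" for y
    using smooth_on_differentiable[OF F that, of "[]"] by (simp add: frechet_derivative_works[symmetric])
  have G': "(G has_derivative ?G' x) (at x)" if "x \<in> X" for x
    using smooth_on_differentiable[OF G that, of "[]"] by (simp add: frechet_derivative_works[symmetric])
  have lin: "linear (?F' (b x))" if "x \<in> X" for x
    by (rule has_derivative_linear[OF F'[OF bY[OF that]]])
  \<comment> \<open>Cramer's rule only improves regularity, so the first derivative is obtained
    separately: \<open>F\<close> is injective on a small ball around \<open>b x\<close>, and
    continuity of \<open>b\<close> identifies it near \<open>x\<close> with the local inverse of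
    \<open>F\<close> applied to \<open>G\<close>.\<close>
  have bdiff: "b differentiable (at x)" if x: "x \<in> X" for x
  proof -
    have y: "b x \<in> Y" by (rule bY[OF x])
    obtain e where e: "e > 0" "\<forall>H C. convex C \<longrightarrow> (\<forall>z\<in>C. H differentiable (at z)) \<longrightarrow>
        (\<forall>z\<in>C. \<forall>v\<in>Basis. norm (frechet_derivative H (at z) v - ?F' (b x) v) \<le> e) \<longrightarrow> inj_on H C"
      using inj_on_near_linear[OF lin[OF x] inj[OF x]] by (elim exE conjE) (rule that)
    obtain r where r: "r > 0" "cball (b x) r \<subseteq> Y"
      "\<forall>z\<in>cball (b x) r. \<forall>v\<in>Basis. norm (?F' z v - ?F' (b x) v) < e"
      using smooth_partials_near[OF F Y y e(1)] by (elim exE conjE) (rule that)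
    let ?B = "ball (b x) r"
    have BY: "?B \<subseteq> Y" using r(2) ball_subset_cball by blast
    have inB: "inj_on F ?B"
    proof (rule e(2)[rule_format])
      fix z assume "z \<in> ?B"
      then show "F differentiable (at z)" using F' BY differentiable_def by blast
    next
      fix z v :: "real ^ 'n" assume "z \<in> ?B" "v \<in> Basis"
      then have "norm (?F' z v - ?F' (b x) v) < e" using r(3) by simp
      then show "norm (?F' z v - ?F' (b x) v) \<le> e" by simp
    qed simp
    obtain g' where g': "linear g'" "g' \<circ> ?F' (b x) = id"
      using linear_injective_left_inverse[OF lin[OF x] inj[OF x]] by blast
    then have g'2: "?F' (b x) \<circ> g' = id"
      using linear_inverse_left[OF lin[OF x] g'(1)] by blast
    have contF: "continuous_on ?B F"
    proof (rule continuous_at_imp_continuous_on, intro ballI)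
      fix z assume "z \<in> ?B"
      then show "isCont F z" using has_derivative_continuous[OF F'[of z]] BY by blast
    qed
    have "(inv_into ?B F has_derivative g') (at (F (b x)))"
      by (rule has_derivative_inverse_strong[OF open_ball _ contF _ F'[OF y] g'2])
        (use r(1) inv_into_f_f[OF inB] in auto)
    then have g: "(inv_into ?B F has_derivative g') (at (G x))" using eq[OF x] by simp
    have "((\<lambda>x. inv_into ?B F (G x)) has_derivative (g' \<circ> ?G' x)) (at x)"
      using diff_chain_at[OF G'[OF x] g] by (simp add: o_def)
    moreover have "open (X \<inter> b -` ?B)" using b(1) X by (simp add: continuous_on_open_vimage Int_commute)
    moreover have "x \<in> X \<inter> b -` ?B" using x r(1) by simp
    moreover have "inv_into ?B F (G z) = b z" if "z \<in> X \<inter> b -` ?B" for z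
      using inv_into_f_f[OF inB, of "b z"] that eq[of z] by simp
    ultimately have "(b has_derivative (g' \<circ> ?G' x)) (at x)"
      using has_derivative_transform_within_open by blast
    then show ?thesis by (auto simp: differentiable_def)
  qed
  have chain: "?F' (b x) (?b' x v) = ?G' x v" if x: "x \<in> X" for x v
  proof -
    have y: "b x \<in> Y" by (rule bY[OF x])
    have "(b has_derivative ?b' x) (at x)" using bdiff[OF x] frechet_derivative_works by blast
    from diff_chain_at[OF this F'[OF y]]
    have "((\<lambda>x. F (b x)) has_derivative (\<lambda>v. ?F' (b x) (?b' x v))) (at x)" by (simp add: o_def)
    then have "(G has_derivative (\<lambda>v. ?F' (b x) (?b' x v))) (at x)"
      using has_derivative_transform_within_open[OF _ X x] eq by blast
    then show ?thesis using frechet_derivative_at by metis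
  qed
  have "times_diff k X b" for k
  proof (induction k)
    case (Suc k)
    define A where "A x = matrix (?F' (b x))" for x
    have detA: "det (A x) \<noteq> 0" if "x \<in> X" for x
      unfolding A_def by (rule det_matrix_nonzero[OF lin[OF that] inj[OF that]])
    have Aentry: "times_diff k X (\<lambda>x. A x $ i $ j)" for i j
    proof -
      have "times_diff (Suc k) Y F" using F unfolding smooth_on_iff by blast
      then have "times_diff k Y (\<lambda>y. ?F' y (axis j 1))" by simp
      then have "times_diff k X (\<lambda>x. ?F' (b x) (axis j 1))"
        by (rule times_diff_compose[OF X b(2) Suc.IH])
      from times_diff_bounded_linear[OF bounded_linear_vec_nth X this]
      show ?thesis unfolding A_def matrix_def by simp
    qed
    have tdet: "times_diff k X (\<lambda>x. det (M x))" if "\<And>i j. times_diff k X (\<lambda>x. M x $ i $ j)"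
      for M :: "real ^ 'n \<Rightarrow> real ^ 'n ^ 'n"
      unfolding det_def
      by (intro times_diff_sum[OF X] times_diff_mult[OF X] times_diff_const[OF X] times_diff_prod[OF X] that)
    have "times_diff k X (\<lambda>x. ?b' x v)" for v
    proof -
      define u where "u x = (\<Sum>j\<in>UNIV. (det (\<chi> i l. if l = j then ?G' x v $ i else A x $ i $ l) * inverse (det (A x)))
          *\<^sub>R (axis j 1 :: real ^ 'n))" for x
      have "?b' x v = u x" if x: "x \<in> X" for x
      proof -
        have "A x *v ?b' x v = ?G' x v" unfolding A_def using chain[OF x] lin[OF x] by (simp add: matrix_works)
        then have "?b' x v = (\<chi> j. det (\<chi> i l. if l = j then ?G' x v $ i else A x $ i $ l) / det (A x))"
          using cramer[OF detA[OF x]] by blast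
        also have "\<dots> = u x"
          unfolding u_def vec_eq_iff by (simp add: axis_def divide_inverse if_distrib cong: if_cong)
        finally show ?thesis .
      qed
      moreover have "times_diff k X u"
      proof -
        have "times_diff (Suc k) X G" using G unfolding smooth_on_iff by blast
        then have "times_diff k X (\<lambda>x. ?G' x v)" by simp
        from times_diff_bounded_linear[OF bounded_linear_vec_nth X this]
        have Gi: "times_diff k X (\<lambda>x. ?G' x v $ i)" for i .
        have "times_diff k X (\<lambda>x. (\<chi> i l. if l = j then ?G' x v $ i else A x $ i $ l) $ i $ l)" for i j l
          by (cases "l = j") (simp_all add: Gi Aentry)
        then show ?thesis unfolding u_def
          by (intro times_diff_sum[OF X] times_diff_scaleR[OF X] times_diff_mult[OF X] tdet
            times_diff_inverse[OF X detA] Aentry times_diff_const[OF X])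
      qed
      ultimately show ?thesis using times_diff_cong[OF X, of "\<lambda>x. ?b' x v" u] by blast
    qed
    then show ?case using bdiff by simp
  qed simp
  then show ?thesis by (simp add: smooth_on_iff)
qed

section \<open>Perturbations of the standard fold\<close>

lemma fold_model_eq: "fold_model k z = z + ((z $ k)\<^sup>2 - z $ k) *\<^sub>R axis k 1"
  unfolding fold_model_def vec_eq_iff by (simp add: axis_def)

lemma fold_model_has_derivative:
  "(fold_model k has_derivative (\<lambda>v. v + ((2 * x $ k - 1) * v $ k) *\<^sub>R axis k 1)) (at x)"
proof -
  have c: "((\<lambda>z. z $ k) has_derivative (\<lambda>v. v $ k)) (at x)"
    by (rule bounded_linear_imp_has_derivative[OF bounded_linear_vec_nth])
  have "((\<lambda>z. z + ((z $ k)\<^sup>2 - z $ k) *\<^sub>R axis k 1) has_derivative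
      (\<lambda>v. v + (of_nat 2 * v $ k * (x $ k) ^ (2 - 1) - v $ k) *\<^sub>R axis k 1)) (at x)"
    by (intro has_derivative_add has_derivative_ident has_derivative_scaleR_left has_derivative_diff
        c has_derivative_power)
  then show ?thesis unfolding fold_model_eq[abs_def] by (simp add: algebra_simps)
qed

lemma fold_model_frechet:
  "frechet_derivative (fold_model k) (at x) v = v + ((2 * x $ k - 1) * v $ k) *\<^sub>R axis k 1"
  by (simp add: frechet_derivative_at[OF fold_model_has_derivative, symmetric])

lemma fold_model_frechet2:
  "frechet_derivative (\<lambda>x. frechet_derivative (fold_model k) (at x) c) (at x) v
    = (2 * v $ k * c $ k) *\<^sub>R axis k 1"
proof -
  have c: "((\<lambda>z. z $ k) has_derivative (\<lambda>v. v $ k)) (at x)"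
    by (rule bounded_linear_imp_has_derivative[OF bounded_linear_vec_nth])
  have "((\<lambda>x. c + ((2 * x $ k - 1) * c $ k) *\<^sub>R axis k 1) has_derivative
      (\<lambda>v. 0 + ((2 * v $ k - 0) * c $ k) *\<^sub>R axis k 1)) (at x)"
    by (intro has_derivative_add has_derivative_const has_derivative_scaleR_left has_derivative_mult_left
        has_derivative_diff has_derivative_mult_right c)
  then have "((\<lambda>x. c + ((2 * x $ k - 1) * c $ k) *\<^sub>R axis k 1) has_derivative
      (\<lambda>v. (2 * v $ k * c $ k) *\<^sub>R axis k 1)) (at x)" by simp
  from frechet_derivative_at[OF this, symmetric] show ?thesis unfolding fold_model_frechet by simp
qed

section \<open>Points with equal values under a perturbed fold\<close>

lemma left_kernel:
  fixes D :: "'u::euclidean_space \<Rightarrow> 'u"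
  assumes "linear D" "\<not> inj D"
  shows "\<exists>l. l \<noteq> 0 \<and> (\<forall>u. l \<bullet> D u = 0)"
proof -
  have "range D \<noteq> UNIV" using assms linear_surjective_imp_injective by blast
  moreover have span: "span (range D) = range D"
    using linear_subspace_image[OF assms(1) subspace_UNIV] by (simp add: span_eq_iff)
  moreover have "(dim (range D) = DIM('u)) = (span (range D) = UNIV)" by (rule dim_eq_full)
  ultimately have "dim (range D) < DIM('u)"
    using dim_subset_UNIV[of "range D"] by (metis le_neq_implies_less)
  then obtain l where "l \<noteq> 0" "\<forall>y\<in>span (range D). orthogonal l y"
    by (rule orthogonal_to_subspace_exists) blast
  then show ?thesis unfolding span by (auto simp: orthogonal_def)
qed

text \<open>Applied below both to the chord joining two points with equal values and to the
  annihilating covector: each is almost parallel to the \<open>k\<close>-th axis.\<close>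

lemma norm_le_dominant_component:
  fixes v :: "real ^ 'n"
  assumes small: "\<And>i. i \<noteq> k \<Longrightarrow> \<bar>v $ i\<bar> \<le> d" and d: "real CARD('n) * d \<le> norm v / 2" "0 \<le> d"
  shows "norm v \<le> 2 * \<bar>v $ k\<bar>"
proof -
  have "norm v \<le> (\<Sum>i\<in>UNIV. \<bar>v $ i\<bar>)" by (rule norm_le_l1_cart)
  also have "\<dots> = \<bar>v $ k\<bar> + (\<Sum>i\<in>UNIV - {k}. \<bar>v $ i\<bar>)" by (simp add: sum.remove)
  also have "(\<Sum>i\<in>UNIV - {k}. \<bar>v $ i\<bar>) \<le> real (card (UNIV - {k} :: 'n set)) * d"
    using small by (intro sum_bounded_above) auto
  also have "\<dots> \<le> real CARD('n) * d" using d(2) by (intro mult_right_mono) (auto simp: card_Diff_singleton)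
  finally show ?thesis using d(1) by simp
qed

text \<open>The line through \<open>p\<close> and \<open>q\<close> meets the hyperplane \<open>z $ k = 0\<close> at a point where a covector \<open>l\<close>
  annihilates the derivative of \<open>H\<close>. Along this line \<open>l \<bullet> H\<close> has a nowhere vanishing second
  derivative, hence it cannot take the same value at two points on one side of its critical point.
  The ball of radius \<open>3 * r\<close> is needed to contain the crossing point.\<close>

lemma fold_separation:
  fixes H :: "real ^ 'n \<Rightarrow> real ^ 'n"
  assumes H: "smooth_on X H" and X: "open X" "cball 0 (3 * r) \<subseteq> X"
    and D1: "\<And>x b. x \<in> cball 0 (3 * r) \<Longrightarrow> b \<in> Basis \<Longrightarrow>
      norm (frechet_derivative H (at x) b - frechet_derivative (fold_model k) (at x) b) \<le> e"
    and D2: "\<And>x b c. x \<in> cball 0 (3 * r) \<Longrightarrow> b \<in> Basis \<Longrightarrow> c \<in> Basis \<Longrightarrow>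
      norm (frechet_derivative (\<lambda>x. frechet_derivative H (at x) c) (at x) b
        - frechet_derivative (\<lambda>x. frechet_derivative (fold_model k) (at x) c) (at x) b) \<le> e"
    and e: "0 \<le> e" "8 * (real CARD('n) * (real CARD('n) * e)) \<le> 1"
    and sing: "\<And>x. x \<in> cball 0 (3 * r) \<Longrightarrow> x $ k = 0 \<Longrightarrow> \<not> inj (frechet_derivative H (at x))"
    and pq: "p \<in> cball 0 r" "q \<in> cball 0 r" "H p = H q" "p \<noteq> q"
  shows "p $ k * q $ k < 0"
proof (rule ccontr)
  assume "\<not> p $ k * q $ k < 0"
  then have side: "p $ k * q $ k \<ge> 0" by simp
  let ?C = "cball 0 (3 * r) :: (real ^ 'n) set"
  let ?H' = "\<lambda>x. frechet_derivative H (at x)" and ?F' = "\<lambda>x. frechet_derivative (fold_model k) (at x)"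
  define n where "n = real CARD('n)"
  have n1: "n \<ge> 1" unfolding n_def using one_le_card_finite[where 'a='n] by linarith
  have e': "8 * (n * (n * e)) \<le> 1" using e(2) unfolding n_def by simp
  have ne0: "0 \<le> n * e" using n1 e(1) by simp
  have "n * e * 1 \<le> n * e * n" using ne0 n1 by (intro mult_left_mono) auto
  then have ne: "8 * (n * e) \<le> 1" using e' by (simp add: mult_ac)
  have H': "(H has_derivative ?H' x) (at x)" if "x \<in> X" for x
    using smooth_on_differentiable[OF H that, of "[]"] by (simp add: frechet_derivative_works[symmetric])
  have F': "(fold_model k has_derivative ?F' x) (at x)" for x :: "real ^ 'n"
    unfolding frechet_derivative_at[OF fold_model_has_derivative, symmetric]
    by (rule fold_model_has_derivative)
  have linD: "linear (\<lambda>v. ?H' x v - ?F' x v)" if "x \<in> X" for x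
    using has_derivative_linear[OF has_derivative_diff[OF H'[OF that] F']] .
  have close1: "norm (?H' x v - ?F' x v) \<le> n * e * norm v" if x: "x \<in> ?C" for x v
  proof -
    have "x \<in> X" using x X by blast
    from norm_linear_le_Basis[OF linD[OF this] D1[OF x], of v] show ?thesis unfolding n_def by simp
  qed
  have r0: "0 \<le> r" using pq(1) by (simp add: order_trans[OF norm_ge_zero])
  have pqC: "p \<in> ?C" "q \<in> ?C" using pq(1,2) r0 by auto
  define v where "v = q - p"
  have v0: "norm v > 0" using pq(4) unfolding v_def by simp
  \<comment> \<open>\<open>H\<close> and the standard fold differ by a map with Lipschitz constant
    \<open>n * e\<close>. Since \<open>H\<close> does not separate \<open>p\<close> and
    \<open>q\<close>, the standard fold almost does not separate them either.\<close>
  have diffF: "norm (fold_model k q - fold_model k p) \<le> n * e * norm v"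
  proof -
    have "norm ((H q - fold_model k q) - (H p - fold_model k p)) \<le> n * e * norm (q - p)"
    proof (rule differentiable_bound[OF convex_cball _ _ pqC(2,1)])
      fix x assume x: "x \<in> ?C"
      then have "x \<in> X" using X by blast
      then show "((\<lambda>x. H x - fold_model k x) has_derivative (\<lambda>v. ?H' x v - ?F' x v)) (at x within ?C)"
        by (rule has_derivative_at_withinI[OF has_derivative_diff[OF H' F']])
      show "onorm (\<lambda>v. ?H' x v - ?F' x v) \<le> n * e" using close1[OF x] by (rule onorm_le)
    qed
    then show ?thesis unfolding v_def using pq(3) by (simp add: norm_minus_commute)
  qed
  \<comment> \<open>The standard fold is the identity in every coordinate other than
    \<open>k\<close>, so \<open>diffF\<close> makes all those components of the chord small.\<close>
  have vk: "norm v \<le> 2 * \<bar>v $ k\<bar>"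
  proof (rule norm_le_dominant_component)
    fix i assume i: "i \<noteq> k"
    have "(fold_model k q - fold_model k p) $ i = v $ i" using i by (simp add: fold_model_def v_def)
    then show "\<bar>v $ i\<bar> \<le> n * e * norm v"
      using component_le_norm_cart[of "fold_model k q - fold_model k p" i] diffF by simp
  next
    have "8 * (n * (n * e)) * norm v \<le> 1 * norm v" using e' by (intro mult_right_mono) auto
    then show "real CARD('n) * (n * e * norm v) \<le> norm v / 2"
      using v0 unfolding n_def by (simp add: mult_ac)
    show "0 \<le> n * e * norm v" using ne0 by simp
  qed
  then have vk0: "v $ k \<noteq> 0" using v0 by auto
  \<comment> \<open>The parameter at which the line crosses the hyperplane. As \<open>v $ k\<close>
    carries at least half the norm of \<open>v\<close>, the crossing point is within
    \<open>2 * r\<close> of \<open>p\<close>.\<close>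
  define s where "s = - (p $ k) / v $ k"
  define x0 where "x0 = p + s *\<^sub>R v"
  have x0k: "x0 $ k = 0" unfolding x0_def s_def using vk0 by simp
  have x0C: "x0 \<in> ?C"
  proof -
    have "norm (s *\<^sub>R v) \<le> \<bar>s\<bar> * (2 * \<bar>v $ k\<bar>)" using vk by (simp add: mult_left_mono)
    also have "\<dots> = 2 * \<bar>p $ k\<bar>" unfolding s_def using vk0 by (simp add: abs_mult[symmetric])
    also have "\<dots> \<le> 2 * r" using component_le_norm_cart[of p k] pq(1) by simp
    finally show ?thesis unfolding x0_def using pq(1) norm_triangle_ineq[of p "s *\<^sub>R v"] by simp
  qed
  \<comment> \<open>Points on the same side leave the crossing outside the open segment, hence apart
    from the Rolle point \<open>z\<close> found inside it below.\<close>
  have s_out: "s \<le> 0 \<or> s \<ge> 1"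
  proof (rule ccontr)
    assume "\<not> ?thesis"
    then have "0 < s * (1 - s) * (v $ k)\<^sup>2" using vk0 by simp
    moreover have pk: "p $ k = - s * v $ k" unfolding s_def using vk0 by simp
    have "q $ k = (1 - s) * v $ k" using pk unfolding v_def by (simp add: algebra_simps)
    then have "p $ k * q $ k = - (s * (1 - s) * (v $ k)\<^sup>2)" unfolding pk by (simp add: power2_eq_square)
    ultimately have "p $ k * q $ k < 0" by linarith
    then show False using side by simp
  qed
  have x0X: "x0 \<in> X" using x0C X by blast
  obtain l where l: "l \<noteq> 0" "\<And>u. l \<bullet> ?H' x0 u = 0"
    using left_kernel[OF has_derivative_linear[OF H'[OF x0X]] sing[OF x0C x0k]] by blast
  \<comment> \<open>At the crossing point the derivative of \<open>H\<close> nearly fixes every axis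
    other than \<open>k\<close>; a covector annihilating its range therefore has small components
    along them.\<close>
  have lk: "norm l \<le> 2 * \<bar>l $ k\<bar>"
  proof (rule norm_le_dominant_component)
    fix i assume i: "i \<noteq> k"
    have F'i: "?F' x0 (axis i 1) = axis i 1" using i by (simp add: fold_model_frechet axis_def)
    have "l $ i = l \<bullet> axis i 1" by (simp add: inner_axis)
    also have "\<dots> = - (l \<bullet> (?H' x0 (axis i 1) - ?F' x0 (axis i 1)))"
      unfolding F'i by (simp add: inner_diff_right l)
    finally have "\<bar>l $ i\<bar> \<le> norm l * norm (?H' x0 (axis i 1) - ?F' x0 (axis i 1))"
      using Cauchy_Schwarz_ineq2[of l "?H' x0 (axis i 1) - ?F' x0 (axis i 1)"] by simp
    also have "\<dots> \<le> norm l * e"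
      by (intro mult_left_mono D1[OF x0C]) auto
    finally show "\<bar>l $ i\<bar> \<le> e * norm l" by (simp add: mult_ac)
  next
    have "8 * (n * e) * norm l \<le> 1 * norm l" using ne by (intro mult_right_mono) auto
    then have "8 * (n * e * norm l) \<le> norm l" by (simp add: mult.assoc)
    moreover have "0 \<le> n * e * norm l" using ne0 by simp
    ultimately have "n * e * norm l \<le> norm l / 2" by linarith
    then show "real CARD('n) * (e * norm l) \<le> norm l / 2" unfolding n_def by (simp add: mult.assoc)
    show "0 \<le> e * norm l" using e by simp
  qed
  then have lk0: "l $ k \<noteq> 0" using l(1) by auto
  define H2 where "H2 x c w = frechet_derivative (\<lambda>x. ?H' x c) (at x) w" for x c w
  have H2: "((\<lambda>x. ?H' x c) has_derivative H2 x c) (at x)" if "x \<in> X" for x c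
    using smooth_on_differentiable[OF H that, of "[c]"] unfolding H2_def
    by (simp add: frechet_derivative_works[symmetric])
  have close2: "norm (H2 x v v - (2 * v $ k * v $ k) *\<^sub>R axis k 1) \<le> n * (n * e) * (norm v)\<^sup>2" if x: "x \<in> ?C" for x
  proof -
    have xX: "x \<in> X" using x X by blast
    \<comment> \<open>\<open>H2\<close> is linear in its last argument because it is a derivative.
      Linearity in the inner direction comes from linearity of \<open>?H'\<close> at all points of
      the open set \<open>X\<close>, transferred to the derivative.\<close>
    have expand: "H2 x v v = (\<Sum>c\<in>Basis. (v \<bullet> c) *\<^sub>R H2 x c v)"
    proof -
      have "((\<lambda>x. \<Sum>c\<in>Basis. (v \<bullet> c) *\<^sub>R ?H' x c) has_derivative
          (\<lambda>w. \<Sum>c\<in>Basis. (v \<bullet> c) *\<^sub>R H2 x c w)) (at x)"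
        by (intro has_derivative_sum has_derivative_scaleR_right H2 xX)
      note dS = this
      have "(\<Sum>c\<in>Basis. (v \<bullet> c) *\<^sub>R ?H' y c) = ?H' y v" if "y \<in> X" for y
        using linear_eq_sum_Basis[OF has_derivative_linear[OF H'[OF that]], of v] by simp
      from has_derivative_transform_within_open[OF dS X(1) xX this]
      have "((\<lambda>x. ?H' x v) has_derivative (\<lambda>w. \<Sum>c\<in>Basis. (v \<bullet> c) *\<^sub>R H2 x c w)) (at x)" .
      from frechet_derivative_at[OF this, symmetric] show ?thesis unfolding H2_def by simp
    qed
    have "linear (\<lambda>c. (2 * v $ k * c $ k) *\<^sub>R (axis k 1 :: real ^ 'n))"
      by (rule linearI) (simp_all add: algebra_simps)
    from linear_eq_sum_Basis[OF this, of v]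
    have expand': "(2 * v $ k * v $ k) *\<^sub>R axis k 1
        = (\<Sum>c\<in>Basis. (v \<bullet> c) *\<^sub>R ((2 * v $ k * c $ k) *\<^sub>R (axis k 1 :: real ^ 'n)))" by simp
    have "norm (H2 x v v - (2 * v $ k * v $ k) *\<^sub>R axis k 1)
        = norm (\<Sum>c\<in>Basis. (v \<bullet> c) *\<^sub>R (H2 x c v - (2 * v $ k * c $ k) *\<^sub>R axis k 1))"
      unfolding expand expand' by (simp only: sum_subtractf scaleR_diff_right)
    also have "\<dots> \<le> (\<Sum>c\<in>(Basis :: (real ^ 'n) set). norm v * (n * e * norm v))"
    proof (rule sum_norm_le)
      fix c :: "real ^ 'n" assume c: "c \<in> Basis"
      have "linear (\<lambda>w. H2 x c w - (2 * w $ k * c $ k) *\<^sub>R axis k 1)"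
      proof -
        have "linear (\<lambda>w. (2 * w $ k * c $ k) *\<^sub>R (axis k 1 :: real ^ 'n))"
          by (rule linearI) (simp_all add: algebra_simps)
        then show ?thesis using has_derivative_linear[OF H2[OF xX]] linear_compose_sub by blast
      qed
      moreover have "norm (H2 x c b - (2 * b $ k * c $ k) *\<^sub>R axis k 1) \<le> e" if "b \<in> Basis" for b
        using D2[OF x that c] unfolding H2_def fold_model_frechet2 .
      ultimately have "norm (H2 x c v - (2 * v $ k * c $ k) *\<^sub>R axis k 1) \<le> n * e * norm v"
        using norm_linear_le_Basis[of "\<lambda>w. H2 x c w - (2 * w $ k * c $ k) *\<^sub>R axis k 1" e v]
        unfolding n_def by simp
      then show "norm ((v \<bullet> c) *\<^sub>R (H2 x c v - (2 * v $ k * c $ k) *\<^sub>R axis k 1)) \<le> norm v * (n * e * norm v)"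
        unfolding norm_scaleR using Basis_le_norm[OF c, of v] by (intro mult_mono) auto
    qed
    also have "\<dots> = n * (n * e) * (norm v)\<^sup>2" unfolding n_def by (simp add: power2_eq_square)
    finally show ?thesis .
  qed
  define g where "g t = l \<bullet> H (p + t *\<^sub>R v)" for t
  define g1 where "g1 t = l \<bullet> ?H' (p + t *\<^sub>R v) v" for t
  define g2 where "g2 t = l \<bullet> H2 (p + t *\<^sub>R v) v v" for t
  have line: "((\<lambda>t. p + t *\<^sub>R v) has_derivative (\<lambda>h. h *\<^sub>R v)) (at t)" for t
    by (auto intro!: derivative_eq_intros)
  have along: "((\<lambda>t. l \<bullet> G (p + t *\<^sub>R v)) has_real_derivative (l \<bullet> G' v)) (at t)"
    if "(G has_derivative G') (at (p + t *\<^sub>R v))" for G G' t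
  proof -
    have "((\<lambda>t. l \<bullet> G (p + t *\<^sub>R v)) has_derivative (\<lambda>h. l \<bullet> G' (h *\<^sub>R v))) (at t)"
      using diff_chain_at[OF line that] by (intro has_derivative_inner_right) (simp add: o_def)
    moreover have "(\<lambda>h. l \<bullet> G' (h *\<^sub>R v)) = (*) (l \<bullet> G' v)"
      using linear_cmul[OF has_derivative_linear[OF that]] by (simp add: fun_eq_iff mult.commute)
    ultimately show ?thesis by (simp add: has_field_derivative_def)
  qed
  have g1: "(g has_real_derivative g1 t) (at t)" if "p + t *\<^sub>R v \<in> ?C" for t
    unfolding g_def g1_def by (rule along[OF H']) (use that X in blast)
  have g2: "(g1 has_real_derivative g2 t) (at t)" if "p + t *\<^sub>R v \<in> ?C" for t
    unfolding g1_def g2_def by (rule along[OF H2]) (use that X in blast)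
  \<comment> \<open>The model contributes \<open>2 * l $ k * (v $ k)\<^sup>2\<close>. The error is
    at most \<open>8 * n\<^sup>2 * e\<close> times
    \<open>\<bar>l $ k\<bar> * (v $ k)\<^sup>2\<close>, with a factor 2 from \<open>lk\<close> and 4
    from squaring \<open>vk\<close>; the bound on \<open>e\<close> makes it smaller than the main
    term.\<close>
  have g2_nz: "g2 t \<noteq> 0" if "p + t *\<^sub>R v \<in> ?C" for t
  proof
    assume "g2 t = 0"
    let ?d = "H2 (p + t *\<^sub>R v) v v - (2 * v $ k * v $ k) *\<^sub>R axis k 1"
    have "l \<bullet> ?d = - (2 * v $ k * v $ k * l $ k)"
      using \<open>g2 t = 0\<close> unfolding g2_def by (simp add: inner_diff_right inner_axis)
    then have "2 * \<bar>l $ k\<bar> * (v $ k)\<^sup>2 = \<bar>l \<bullet> ?d\<bar>"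
      by (simp add: abs_mult power2_eq_square)
    also have "\<dots> \<le> norm l * norm ?d" by (rule Cauchy_Schwarz_ineq2)
    also have "\<dots> \<le> (2 * \<bar>l $ k\<bar>) * (n * (n * e) * (2 * \<bar>v $ k\<bar>)\<^sup>2)"
    proof (intro mult_mono lk order_trans[OF close2[OF that]] mult_left_mono power_mono vk)
    qed (use ne0 n1 e(1) in auto)
    also have "\<dots> = 8 * (n * (n * e)) * (\<bar>l $ k\<bar> * (v $ k)\<^sup>2)"
      by (simp add: power_mult_distrib)
    also have "\<dots> \<le> 1 * (\<bar>l $ k\<bar> * (v $ k)\<^sup>2)" using e' by (intro mult_right_mono) auto
    finally have "\<bar>l $ k\<bar> * (v $ k)\<^sup>2 \<le> 0" by simp
    moreover have "0 < \<bar>l $ k\<bar> * (v $ k)\<^sup>2" using lk0 vk0 by simp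
    ultimately show False by simp
  qed
  have between: "p + t *\<^sub>R v \<in> ?C" if "a \<le> t" "t \<le> b" "p + a *\<^sub>R v \<in> ?C" "p + b *\<^sub>R v \<in> ?C" for a b t
  proof (cases "a = b")
    case False
    then have ab: "b - a > 0" using that by simp
    define u where "u = (t - a) / (b - a)"
    have u: "0 \<le> u" "u \<le> 1" unfolding u_def using that ab by (simp_all add: divide_simps)
    have "u * (b - a) = t - a" unfolding u_def using ab by simp
    then have "t = (1 - u) * a + u * b" by (simp add: algebra_simps)
    then have "p + t *\<^sub>R v = p + ((1 - u) * a + u * b) *\<^sub>R v" by simp
    also have "\<dots> = (1 - u) *\<^sub>R (p + a *\<^sub>R v) + u *\<^sub>R (p + b *\<^sub>R v)"
      by (simp add: algebra_simps)
    finally have "p + t *\<^sub>R v = (1 - u) *\<^sub>R (p + a *\<^sub>R v) + u *\<^sub>R (p + b *\<^sub>R v)" .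
    then show ?thesis using convexD_alt[OF convex_cball that(3,4) u] by simp
  next
    case True
    then have "t = a" using that by simp
    then show ?thesis using that by simp
  qed
  have C01: "p + 0 *\<^sub>R v \<in> ?C" "p + 1 *\<^sub>R v \<in> ?C" using pqC unfolding v_def by auto
  \<comment> \<open>Rolle's theorem on the chord gives a second zero of \<open>g1\<close>, different
    from \<open>s\<close>; between the two zeros \<open>g2\<close> would have to vanish.\<close>
  have "\<exists>z>0. z < 1 \<and> g 1 - g 0 = (1 - 0) * g1 z"
    by (rule MVT2) (auto intro!: g1 between[OF _ _ C01])
  moreover have "g 1 = g 0" unfolding g_def v_def using pq(3) by simp
  ultimately obtain z where z: "0 < z" "z < 1" "g1 z = 0" by auto
  have zC: "p + z *\<^sub>R v \<in> ?C" using between[OF _ _ C01, of z] z by simp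
  have sC: "p + s *\<^sub>R v \<in> ?C" using x0C unfolding x0_def .
  have g1s: "g1 s = 0" unfolding g1_def using l(2) x0_def by simp
  have "\<exists>y. p + y *\<^sub>R v \<in> ?C \<and> g2 y = 0"
  proof (cases "s < z")
    case True
    then have "\<exists>y>s. y < z \<and> g1 z - g1 s = (z - s) * g2 y"
      by (rule MVT2) (auto intro!: g2 between[OF _ _ sC zC])
    then obtain y where y: "s < y" "y < z" "g2 y = 0" using True z g1s by auto
    then have "p + y *\<^sub>R v \<in> ?C" using between[OF _ _ sC zC, of y] by simp
    then show ?thesis using y by blast
  next
    case False
    then have "z < s" using s_out z by auto
    then have "\<exists>y>z. y < s \<and> g1 s - g1 z = (s - z) * g2 y"
      by (rule MVT2) (auto intro!: g2 between[OF _ _ zC sC])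
    then obtain y where y: "z < y" "y < s" "g2 y = 0" using \<open>z < s\<close> z g1s by auto
    then have "p + y *\<^sub>R v \<in> ?C" using between[OF _ _ zC sC, of y] by simp
    then show ?thesis using y by blast
  qed
  then show False using g2_nz by blast
qed

section \<open>Charts\<close>

lemma chartsD:
  assumes "(U, \<phi>) \<in> charts A"
  shows "open U" "open (\<phi> ` U)" "inj_on \<phi> U" "continuous_on U \<phi>" "continuous_on (\<phi> ` U) (inv_into U \<phi>)"
    "\<And>u. u \<in> U \<Longrightarrow> inv_into U \<phi> (\<phi> u) = u"
    "\<And>x. x \<in> \<phi> ` U \<Longrightarrow> \<phi> (inv_into U \<phi> x) = x" "\<And>x. x \<in> \<phi> ` U \<Longrightarrow> inv_into U \<phi> x \<in> U"
proof -
  have t: "top_chart U \<phi>" using assms unfolding charts_def by blast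
  then have h: "homeomorphism U (\<phi> ` U) \<phi> (inv_into U \<phi>)" unfolding top_chart_def by blast
  show "open U" "open (\<phi> ` U)" using t unfolding top_chart_def by blast+
  show "continuous_on U \<phi>" "continuous_on (\<phi> ` U) (inv_into U \<phi>)"
    using h unfolding homeomorphism_def by blast+
  show inv: "inv_into U \<phi> (\<phi> u) = u" if "u \<in> U" for u using homeomorphism_apply1[OF h that] .
  show "inj_on \<phi> U" by (rule inj_on_inverseI[where g = "inv_into U \<phi>"]) (rule inv)
  show "\<phi> (inv_into U \<phi> x) = x" if "x \<in> \<phi> ` U" for x using that by (rule f_inv_into_f)
  show "inv_into U \<phi> x \<in> U" if "x \<in> \<phi> ` U" for x using that by (rule inv_into_into)
qed

lemma open_chart_image:
  assumes c: "(U, \<phi>) \<in> charts A" and B: "open B" "B \<subseteq> U"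
  shows "open (\<phi> ` B)"
proof -
  have "\<phi> ` B = \<phi> ` U \<inter> inv_into U \<phi> -` B"
  proof (intro equalityI subsetI)
    fix x assume "x \<in> \<phi> ` B"
    then show "x \<in> \<phi> ` U \<inter> inv_into U \<phi> -` B" using B(2) chartsD(6)[OF c] by auto
  next
    fix x assume x: "x \<in> \<phi> ` U \<inter> inv_into U \<phi> -` B"
    then have "\<phi> (inv_into U \<phi> x) = x" using chartsD(7)[OF c] by blast
    then show "x \<in> \<phi> ` B" using x by (metis IntD2 imageI vimageD)
  qed
  also have "open \<dots>"
    using chartsD(5)[OF c] chartsD(2)[OF c] B(1) by (simp add: continuous_on_open_vimage Int_commute)
  finally show ?thesis .
qed

lemma open_chart_preimage:
  assumes c: "(U, \<phi>) \<in> charts A" and Y: "open Y"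
  shows "open (U \<inter> \<phi> -` Y)"
  using chartsD(4)[OF c] chartsD(1)[OF c] Y by (simp add: continuous_on_open_vimage Int_commute)

lemma atlas_chart_at:
  assumes "smooth_manifold A"
  obtains U \<phi> where "(U, \<phi>) \<in> A" "(U, \<phi>) \<in> charts A" "p \<in> U"
proof -
  have "p \<in> (\<Union>(U, \<phi>)\<in>A. U)" and "A \<subseteq> charts A" using assms unfolding smooth_manifold_def by auto
  then show ?thesis using that by blast
qed

text \<open>Membership in \<open>charts A\<close> compares a chart only with members of
  \<open>A\<close>, so the change of coordinates is factored near each point through a chart of
  \<open>A\<close> itself.\<close>

lemma charts_compatible:
  assumes A: "smooth_manifold A" and c: "(U, \<phi>) \<in> charts A" and c': "(U', \<phi>') \<in> charts A"
  shows "smooth_on (\<phi> ` (U \<inter> U')) (\<lambda>x. \<phi>' (inv_into U \<phi> x))"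
proof (rule smooth_on_local)
  fix x assume "x \<in> \<phi> ` (U \<inter> U')"
  then obtain u where u: "u \<in> U" "u \<in> U'" "x = \<phi> u" by blast
  obtain U0 \<phi>0 where c0: "(U0, \<phi>0) \<in> A" "(U0, \<phi>0) \<in> charts A" "u \<in> U0"
    by (rule atlas_chart_at[OF A])
  let ?O = "U \<inter> U' \<inter> U0"
  have op: "open (\<phi> ` ?O)"
    by (rule open_chart_image[OF c]) (use chartsD(1)[OF c] chartsD(1)[OF c'] chartsD(1)[OF c0(2)] in auto)
  have 1: "smooth_on (\<phi> ` ?O) (\<phi>0 \<circ> inv_into U \<phi>)"
  proof (rule smooth_on_subset)
    show "smooth_on (\<phi> ` (U \<inter> U0)) (\<phi>0 \<circ> inv_into U \<phi>)" using c c0(1) unfolding charts_def by blast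
  qed blast
  have 2: "smooth_on (\<phi>0 ` (U' \<inter> U0)) (\<phi>' \<circ> inv_into U0 \<phi>0)"
    using c' c0(1) unfolding charts_def by blast
  have im: "(\<phi>0 \<circ> inv_into U \<phi>) ` (\<phi> ` ?O) \<subseteq> \<phi>0 ` (U' \<inter> U0)" using chartsD(6)[OF c] by auto
  have eq: "(\<phi>' \<circ> inv_into U0 \<phi>0) ((\<phi>0 \<circ> inv_into U \<phi>) y) = \<phi>' (inv_into U \<phi> y)"
    if y: "y \<in> \<phi> ` ?O" for y
  proof -
    obtain w where "w \<in> ?O" "y = \<phi> w" using y by blast
    then show ?thesis using chartsD(6)[OF c, of w] chartsD(6)[OF c0(2), of w] by simp
  qed
  have "smooth_on (\<phi> ` ?O) (\<lambda>x. \<phi>' (inv_into U \<phi> x))"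
    using smooth_on_compose[OF op im 1 2] by (subst (asm) smooth_on_cong[OF op eq])
  moreover have "x \<in> \<phi> ` ?O" using u c0(3) by simp
  ultimately show "\<exists>Y. x \<in> Y \<and> smooth_on Y (\<lambda>x. \<phi>' (inv_into U \<phi> x))"
    by (intro exI[of _ "\<phi> ` ?O"] conjI)
qed

section \<open>The reflection symmetry of the standard fold\<close>

definition reflect :: "'n \<Rightarrow> real ^ 'n \<Rightarrow> real ^ 'n" where
  "reflect k z = z - (2 * z $ k) *\<^sub>R axis k 1"

lemma reflect_nth: "reflect k z $ i = (if i = k then - z $ i else z $ i)"
  by (simp add: reflect_def axis_def)

lemma bounded_linear_reflect: "bounded_linear (reflect k :: real ^ 'n::finite \<Rightarrow> _)"
  by (intro linear_conv_bounded_linear[THEN iffD1] linearI) (simp_all add: vec_eq_iff reflect_nth)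

lemma fold_model_reflect: "fold_model k (reflect k z) = fold_model k z"
  by (simp add: vec_eq_iff fold_model_def reflect_nth)

lemma reflect_eq_iff: "reflect k z = z \<longleftrightarrow> z $ k = 0"
  by (auto simp: vec_eq_iff reflect_nth)

lemma norm_reflect: "norm (reflect k z) = norm (z :: real ^ 'n::finite)"
proof -
  have "norm (reflect k z $ i) = norm (z $ i)" for i by (simp add: reflect_nth)
  then show ?thesis unfolding norm_vec_def by simp
qed

lemma fold_model_eq_cases:
  assumes "fold_model k y = fold_model k z"
  shows "y = z \<or> y = reflect k z"
proof -
  have eq: "fold_model k y $ i = fold_model k z $ i" for i using assms by simp
  have "y $ i = z $ i" if "i \<noteq> k" for i using eq[of i] that by (simp add: fold_model_def)
  moreover have "y $ k = z $ k \<or> y $ k = - z $ k"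
    using eq[of k] by (simp add: fold_model_def power2_eq_iff)
  ultimately show ?thesis by (auto simp: vec_eq_iff reflect_nth) metis
qed

section \<open>Involutions and their graphs\<close>

text \<open>The shape of a fold on \<open>B\<close> without reference to charts; the first clause
  expresses branching along \<open>S\<close>. It takes over at \<open>S\<close> the role that
  injectivity on \<open>B\<close> has elsewhere.\<close>

definition two_sheeted :: "'a set \<Rightarrow> 'a set \<Rightarrow> ('a \<Rightarrow> 'b) \<Rightarrow> bool" where
  "two_sheeted S B h \<longleftrightarrow> (\<forall>y\<in>B \<inter> S. \<forall>z\<in>B. h y = h z \<longrightarrow> y = z) \<and>
     (\<forall>w\<in>B. \<forall>y\<in>B. \<forall>z\<in>B. h w = h y \<longrightarrow> h y = h z \<longrightarrow> w = y \<or> y = z \<or> w = z)"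

lemma two_sheeted_branch:
  "\<lbrakk>two_sheeted S B h; y \<in> B; z \<in> B; y \<in> S; h y = h z\<rbrakk> \<Longrightarrow> y = z"
  unfolding two_sheeted_def by blast

lemma two_sheeted_unique:
  "\<lbrakk>two_sheeted S B h; w \<in> B; y \<in> B; z \<in> B; h y = h w; h z = h w; y \<noteq> w; z \<noteq> w\<rbrakk> \<Longrightarrow> y = z"
  unfolding two_sheeted_def by metis

text \<open>In \<open>compact_open\<close>, \<open>regular_point\<close> and
  \<open>singular_point\<close> one set \<open>B\<close> serves all maps of a neighbourhood
  \<open>N\<close>; this uniformity is what lets partners be followed from \<open>f\<close> to
  nearby maps. The assumptions \<open>open_image\<close> and \<open>local_partner\<close> concern a
  single map and say that a partner, once present, continues to exist over nearby points.\<close>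

locale fold_space =
  fixes T :: "('a::t2_space \<Rightarrow> 'b::t2_space) topology" and S :: "'a set"
  assumes compact_source: "compact (UNIV :: 'a set)"
    and connected_source: "connected (UNIV :: 'a set)"
    and S_nonempty: "S \<noteq> {}"
    and S_closed: "closed S"
    and continuous: "f \<in> topspace T \<Longrightarrow> continuous_on UNIV f"
    and compact_open: "\<lbrakk>f \<in> topspace T; open X; f x \<in> X\<rbrakk>
      \<Longrightarrow> \<exists>B N. open B \<and> x \<in> B \<and> openin T N \<and> f \<in> N \<and> (\<forall>h\<in>N. h ` B \<subseteq> X)"
    and regular_point: "\<lbrakk>f \<in> topspace T; x \<notin> S\<rbrakk>
      \<Longrightarrow> \<exists>B N. open B \<and> x \<in> B \<and> openin T N \<and> f \<in> N \<and> (\<forall>h\<in>N. inj_on h B)"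
    and singular_point: "\<lbrakk>f \<in> topspace T; x \<in> S\<rbrakk>
      \<Longrightarrow> \<exists>B N. open B \<and> x \<in> B \<and> openin T N \<and> f \<in> N \<and>
        (\<forall>h\<in>N. two_sheeted S B h)"
    and open_image: "\<lbrakk>f \<in> topspace T; open B; inj_on f B\<rbrakk> \<Longrightarrow> open (f ` B)"
    and local_partner: "\<lbrakk>f \<in> topspace T; x \<in> S; open Y; x \<in> Y\<rbrakk>
      \<Longrightarrow> \<exists>B. open B \<and> x \<in> B \<and> (\<forall>y\<in>B. \<exists>z\<in>Y. f z = f y \<and> (z = y \<longleftrightarrow> y \<in> S))"
    and locally_connected: "\<lbrakk>open Y; x \<in> Y\<rbrakk> \<Longrightarrow> \<exists>C. open C \<and> connected C \<and> x \<in> C \<and> C \<subseteq> Y"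
begin

text \<open>Off \<open>S\<close> the diagonal is left out so that the identity does not count as a
  sheet. Local injectivity keeps the remaining set closed.\<close>

definition partners :: "('a \<Rightarrow> 'b) \<Rightarrow> ('a \<times> 'a) set" where
  "partners h = {(x, y). h x = h y \<and> (x = y \<longrightarrow> x \<in> S)}"

text \<open>Only continuity is demanded, since gluing and passage to the limit give no more;
  \<open>involution_smooth\<close> supplies the rest.\<close>

definition deck :: "('a \<Rightarrow> 'b) \<Rightarrow> ('a \<Rightarrow> 'a) \<Rightarrow> bool" where
  "deck h \<alpha> \<longleftrightarrow> continuous_on UNIV \<alpha> \<and> \<alpha> \<circ> \<alpha> = id \<and> {x. \<alpha> x = x} = S \<and> h \<circ> \<alpha> = h"

lemma deckD:
  assumes "deck h \<alpha>"
  shows "\<alpha> (\<alpha> x) = x" "\<alpha> x = x \<longleftrightarrow> x \<in> S" "h (\<alpha> x) = h x" "\<alpha> x \<in> S \<longleftrightarrow> x \<in> S"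
    "continuous_on UNIV \<alpha>" "(x, \<alpha> x) \<in> partners h"
proof -
  show 1: "\<alpha> (\<alpha> x) = x" for x using assms unfolding deck_def by (metis comp_apply id_apply)
  show 2: "\<alpha> x = x \<longleftrightarrow> x \<in> S" for x using assms unfolding deck_def by blast
  show 3: "h (\<alpha> x) = h x" for x using assms unfolding deck_def by (metis comp_apply)
  show "\<alpha> x \<in> S \<longleftrightarrow> x \<in> S" using 1 2 by metis
  show "continuous_on UNIV \<alpha>" using assms unfolding deck_def by blast
  show "(x, \<alpha> x) \<in> partners h" unfolding partners_def using 2[of x] 3[of x] by (simp add: eq_commute)
qed

section \<open>Uniformity over compact sets and semicontinuity of partners\<close>

lemma compact_uniform:
  fixes K :: "'c::topological_space set"
  assumes f: "f \<in> topspace T" and K: "compact K"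
    and loc: "\<And>z. z \<in> K \<Longrightarrow> \<exists>B N. open B \<and> z \<in> B \<and> openin T N \<and> f \<in> N \<and> (\<forall>h\<in>N. \<forall>w\<in>B. P h w)"
  shows "\<exists>N. openin T N \<and> f \<in> N \<and> (\<forall>h\<in>N. \<forall>w\<in>K. P h w)"
proof -
  obtain B N where BN: "\<And>z. z \<in> K \<Longrightarrow> open (B z) \<and> z \<in> B z \<and> openin T (N z) \<and> f \<in> N z
      \<and> (\<forall>h\<in>N z. \<forall>w\<in>B z. P h w)"
    using loc by metis
  have "\<And>z. z \<in> K \<Longrightarrow> open (B z)" and "K \<subseteq> (\<Union>z\<in>K. B z)" using BN by auto
  then obtain F where F: "F \<subseteq> K" "finite F" "K \<subseteq> (\<Union>z\<in>F. B z)"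
    using compactE_image[OF K] by metis
  \<comment> \<open>For empty \<open>F\<close> the bare intersection would be the whole type, which
    need not be open in \<open>T\<close>.\<close>
  let ?N = "topspace T \<inter> \<Inter>(N ` F)"
  have "openin T ?N"
  proof (cases "F = {}")
    case False
    then have "openin T (\<Inter>(N ` F))" using F BN by (intro openin_Inter) auto
    then show ?thesis by blast
  qed auto
  moreover have "f \<in> ?N" using F BN f by auto
  moreover have "\<forall>h\<in>?N. \<forall>w\<in>K. P h w" using F BN by blast
  ultimately show ?thesis by blast
qed

lemma separate_values:
  assumes f: "f \<in> topspace T" and ne: "f x \<noteq> f y"
  shows "\<exists>B N. open B \<and> (x, y) \<in> B \<and> openin T N \<and> f \<in> N \<and> (\<forall>h\<in>N. \<forall>(x', y')\<in>B. h x' \<noteq> h y')"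
proof -
  obtain X Y where XY: "open X" "open Y" "f x \<in> X" "f y \<in> Y" "X \<inter> Y = {}"
    using hausdorff[OF ne] by blast
  obtain B N where B: "open B" "x \<in> B" "openin T N" "f \<in> N" "\<forall>h\<in>N. h ` B \<subseteq> X"
    using compact_open[OF f XY(1,3)] by blast
  obtain B' N' where B': "open B'" "y \<in> B'" "openin T N'" "f \<in> N'" "\<forall>h\<in>N'. h ` B' \<subseteq> Y"
    using compact_open[OF f XY(2,4)] by blast
  have "open (B \<times> B')" "openin T (N \<inter> N')" using B B' by (auto intro: open_Times)
  moreover have "\<forall>h\<in>N \<inter> N'. \<forall>(x', y')\<in>B \<times> B'. h x' \<noteq> h y'"
    using B(5) B'(5) XY(5) by (auto simp: image_subset_iff) (metis disjoint_iff)
  ultimately show ?thesis using B(2,4) B'(2,4) by (intro exI[of _ "B \<times> B'"] exI[of _ "N \<inter> N'"]) auto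
qed

text \<open>This is the upper semicontinuity of \<open>partners\<close>. Different values stay apart
  for nearby maps and points; near a diagonal point off \<open>S\<close> uniform injectivity
  excludes distinct partners, and removing \<open>S\<close> from \<open>B\<close> excludes the
  admissible diagonal ones.\<close>

lemma nonpartners_open:
  assumes f: "f \<in> topspace T" and np: "(x, y) \<notin> partners f"
  shows "\<exists>B N. open B \<and> (x, y) \<in> B \<and> openin T N \<and> f \<in> N \<and> (\<forall>h\<in>N. B \<inter> partners h = {})"
proof (cases "f x = f y")
  case False
  obtain B N where "open B" "(x, y) \<in> B" "openin T N" "f \<in> N" "\<forall>h\<in>N. \<forall>(x', y')\<in>B. h x' \<noteq> h y'"
    using separate_values[OF f False] by blast
  then show ?thesis unfolding partners_def by (intro exI[of _ B] exI[of _ N]) auto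
next
  case True
  then have xy: "y = x" "x \<notin> S" using np unfolding partners_def by auto
  obtain B N where B: "open B" "x \<in> B" "openin T N" "f \<in> N" "\<forall>h\<in>N. inj_on h B"
    using regular_point[OF f xy(2)] by blast
  let ?B = "B - S"
  have "open (?B \<times> ?B)" using B(1) S_closed by (intro open_Times) auto
  moreover have "\<forall>h\<in>N. (?B \<times> ?B) \<inter> partners h = {}"
    using B(5) unfolding partners_def inj_on_def by auto
  ultimately show ?thesis using B xy by (intro exI[of _ "?B \<times> ?B"] exI[of _ N]) auto
qed

lemma closed_partners:
  assumes f: "f \<in> topspace T"
  shows "closed (partners f)"
proof -
  have "\<exists>B. open B \<and> z \<in> B \<and> B \<subseteq> - partners f" if "z \<in> - partners f" for z
    using nonpartners_open[OF f, of "fst z" "snd z"] that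
    by (metis ComplD disjoint_eq_subset_Compl prod.collapse)
  then have "open (- partners f)" by (subst open_subopen) blast
  then show ?thesis by (simp add: closed_def)
qed

text \<open>Both the domain of \<open>\<Gamma>\<close> and the set of points with at least two partners in \<open>\<Gamma>\<close> are clopen, and
  the latter misses \<open>S\<close>.\<close>

lemma deck_if_clopen_sheet:
  assumes h: "h \<in> topspace T" and sub: "\<Gamma> \<subseteq> partners h" and cl: "closed \<Gamma>"
    and op: "open O'" "\<Gamma> = partners h \<inter> O'"
    and sym: "\<And>x y. (x, y) \<in> \<Gamma> \<Longrightarrow> (y, x) \<in> \<Gamma>"
    and diag: "\<And>x. x \<in> S \<Longrightarrow> (x, x) \<in> \<Gamma>"
    and bad: "\<And>x y. (x, y) \<in> \<Gamma> \<Longrightarrow> x \<in> S \<Longrightarrow> y = x"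
  shows "\<exists>\<alpha>. deck h \<alpha>"
proof -
  have conth: "continuous_on UNIV h" by (rule continuous[OF h])
  have compact_prod: "compact (UNIV :: ('a \<times> 'a) set)"
    using compact_Times[OF compact_source compact_source] by simp
  have clopen: "A = {} \<or> A = UNIV" if "open A" "closed A" for A :: "'a set"
    using connected_source that by (auto simp: connected_clopen)
  \<comment> \<open>Lifts persist over nearby points. At a point of \<open>S\<close> the lift comes
    from \<open>local_partner\<close>; elsewhere \<open>h\<close> is open near \<open>y\<close>, and
    the disjoint neighbourhoods \<open>X1\<close> and \<open>Y1\<close> keep the lift off the
    diagonal.\<close>
  have local_section: "\<exists>B. open B \<and> x \<in> B \<and> (\<forall>x'\<in>B. \<exists>y'\<in>Y. (x', y') \<in> \<Gamma>)"
    if xy: "(x, y) \<in> \<Gamma>" and Y: "open Y" "y \<in> Y" for x y Y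
  proof -
    have "(x, y) \<in> O'" using xy op by auto
    then obtain X0 Y0 where XY: "open X0" "open Y0" "x \<in> X0" "y \<in> Y0" "X0 \<times> Y0 \<subseteq> O'"
      using open_prod_elim[OF op(1)] by (metis mem_Sigma_iff)
    show ?thesis
    proof (cases "x \<in> S")
      case True
      then have "y = x" using bad xy by blast
      then obtain B where B: "open B" "x \<in> B"
        "\<forall>y\<in>B. \<exists>z\<in>X0 \<inter> Y0 \<inter> Y. h z = h y \<and> (z = y \<longleftrightarrow> y \<in> S)"
        using local_partner[OF h True, of "X0 \<inter> Y0 \<inter> Y"] XY Y by auto
      have "\<exists>y'\<in>Y. (x', y') \<in> \<Gamma>" if x': "x' \<in> B \<inter> X0" for x'
      proof -
        obtain z where z: "z\<in>X0 \<inter> Y0 \<inter> Y" "h z = h x'" "z = x' \<longleftrightarrow> x' \<in> S"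
          using bspec[OF B(3) IntD1[OF x']] by blast
        then have "(x', z) \<in> partners h" unfolding partners_def by auto
        moreover have "(x', z) \<in> O'" using z(1) x' XY(5) by auto
        ultimately have "(x', z) \<in> \<Gamma>" using op(2) by blast
        then show ?thesis using z(1) by blast
      qed
      then show ?thesis using B XY by (intro exI[of _ "B \<inter> X0"]) auto
    next
      case False
      then have y: "y \<notin> S" using sym bad xy by blast
      have pxy: "h x = h y" "x \<noteq> y" using xy sub False unfolding partners_def by auto
      obtain X1 Y1 where XY1: "open X1" "open Y1" "x \<in> X1" "y \<in> Y1" "X1 \<inter> Y1 = {}"
        using hausdorff[OF pxy(2)] by blast
      obtain B N where B: "open B" "y \<in> B" "openin T N" "h \<in> N" "\<forall>h\<in>N. inj_on h B"
        using regular_point[OF h y] by blast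
      let ?Y = "Y \<inter> Y0 \<inter> Y1 \<inter> B"
      have "inj_on h ?Y" using B by (meson inj_on_subset inf_le2)
      moreover have "open ?Y" using XY XY1 Y B by (intro open_Int)
      ultimately have "open (h ` ?Y)" using open_image[OF h] by blast
      then have "open (h -` (h ` ?Y))" using conth by (simp add: continuous_on_open_vimage)
      moreover have "x \<in> h -` (h ` ?Y)" using pxy Y XY XY1 B by auto
      moreover have "\<exists>y'\<in>Y. (x', y') \<in> \<Gamma>" if x': "x' \<in> h -` (h ` ?Y) \<inter> X0 \<inter> X1" for x'
      proof -
        obtain y' where y': "y' \<in> ?Y" "h x' = h y'" using x' by auto
        have "(x', y') \<in> partners h" using y' x' XY1(5) unfolding partners_def by auto
        moreover have "(x', y') \<in> O'" using y'(1) x' XY(5) by auto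
        ultimately have "(x', y') \<in> \<Gamma>" using op(2) by blast
        then show ?thesis using y'(1) by blast
      qed
      ultimately show ?thesis using XY XY1
        by (intro exI[of _ "h -` (h ` ?Y) \<inter> X0 \<inter> X1"]) auto
    qed
  qed
  have "fst ` \<Gamma> = UNIV"
  proof -
    have "open (fst ` \<Gamma>)"
    proof (subst open_subopen, intro ballI)
      fix x assume "x \<in> fst ` \<Gamma>"
      then obtain y where "(x, y) \<in> \<Gamma>" by auto
      then obtain B where "open B" "x \<in> B" "\<forall>x'\<in>B. \<exists>y'\<in>UNIV. (x', y') \<in> \<Gamma>"
        using local_section[of x y UNIV] by auto
      then show "\<exists>B. open B \<and> x \<in> B \<and> B \<subseteq> fst ` \<Gamma>" by force
    qed
    moreover have "closed (fst ` \<Gamma>)"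
    proof -
      have "compact \<Gamma>" using compact_Int_closed[OF compact_prod cl] by simp
      then show ?thesis by (intro compact_imp_closed compact_continuous_image continuous_intros)
    qed
    moreover have "fst ` \<Gamma> \<noteq> {}" using diag S_nonempty by force
    ultimately show ?thesis using clopen by blast
  qed
  then have ex: "\<exists>y. (x, y) \<in> \<Gamma>" for x by (metis UNIV_I fst_conv imageE prod.collapse)
  define Q where "Q = {(x, y, y'). (x, y) \<in> \<Gamma> \<and> (x, y') \<in> \<Gamma> \<and> y \<noteq> y'}"
  have "fst ` Q = {}"
  proof -
    have "open (fst ` Q)"
    proof (subst open_subopen, intro ballI)
      fix x assume "x \<in> fst ` Q"
      then obtain y y' where q: "(x, y) \<in> \<Gamma>" "(x, y') \<in> \<Gamma>" "y \<noteq> y'" unfolding Q_def by auto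
      obtain Y Y' where Y: "open Y" "open Y'" "y \<in> Y" "y' \<in> Y'" "Y \<inter> Y' = {}"
        using hausdorff[OF q(3)] by blast
      obtain B where B: "open B" "x \<in> B" "\<forall>x'\<in>B. \<exists>y'\<in>Y. (x', y') \<in> \<Gamma>"
        using local_section[OF q(1) Y(1,3)] by blast
      obtain B' where B': "open B'" "x \<in> B'" "\<forall>x'\<in>B'. \<exists>y'\<in>Y'. (x', y') \<in> \<Gamma>"
        using local_section[OF q(2) Y(2,4)] by blast
      have "B \<inter> B' \<subseteq> fst ` Q"
      proof
        fix x' assume x': "x' \<in> B \<inter> B'"
        obtain z where z: "z \<in> Y" "(x', z) \<in> \<Gamma>" using B x' by blast
        obtain z' where z': "z' \<in> Y'" "(x', z') \<in> \<Gamma>" using B' x' by blast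
        have "(x', z, z') \<in> Q" using z z' Y unfolding Q_def by auto
        then show "x' \<in> fst ` Q" by force
      qed
      then show "\<exists>B. open B \<and> x \<in> B \<and> B \<subseteq> fst ` Q" using B B' by (intro exI[of _ "B \<inter> B'"]) auto
    qed
    moreover have "closed (fst ` Q)"
    proof -
      \<comment> \<open>Two distinct lifts must not merge in the limit. At a limit lift off
        \<open>S\<close> this is injectivity of \<open>h\<close>; a limit lift in \<open>S\<close>
        forces \<open>x = y\<close>, and there \<open>two_sheeted\<close> leaves room for only one
        partner besides the point itself.\<close>
      have "open (- Q)"
      proof (subst open_subopen, intro ballI)
        fix z assume "z \<in> - Q"
        then obtain x y y' where z: "z = (x, y, y')" "(x, y, y') \<notin> Q" by (metis ComplD prod_cases3)
        have cont1: "continuous_on UNIV (\<lambda>z :: 'a \<times> 'a \<times> 'a. (fst z, fst (snd z)))"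
          and cont2: "continuous_on UNIV (\<lambda>z :: 'a \<times> 'a \<times> 'a. (fst z, snd (snd z)))"
          by (intro continuous_intros)+
        have o1: "open {z :: 'a \<times> 'a \<times> 'a. (fst z, fst (snd z)) \<notin> \<Gamma>}" and o2: "open {z :: 'a \<times> 'a \<times> 'a. (fst z, snd (snd z)) \<notin> \<Gamma>}"
          using open_vimage[OF _ cont1, of "- \<Gamma>"] open_vimage[OF _ cont2, of "- \<Gamma>"] cl
          by (simp_all add: vimage_def open_Compl)
        consider "(x, y) \<notin> \<Gamma>" | "(x, y') \<notin> \<Gamma>" | "(x, y) \<in> \<Gamma>" "y' = y"
          using z unfolding Q_def by auto
        then show "\<exists>B. open B \<and> z \<in> B \<and> B \<subseteq> - Q"
        proof cases
          case 1
          then show ?thesis using o1 z unfolding Q_def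
            by (intro exI[of _ "{z :: 'a \<times> 'a \<times> 'a. (fst z, fst (snd z)) \<notin> \<Gamma>}"]) auto
        next
          case 2
          then show ?thesis using o2 z unfolding Q_def
            by (intro exI[of _ "{z :: 'a \<times> 'a \<times> 'a. (fst z, snd (snd z)) \<notin> \<Gamma>}"]) auto
        next
          case 3
          show ?thesis
          proof (cases "y \<in> S")
            case False
            obtain B N where B: "open B" "y \<in> B" "openin T N" "h \<in> N" "\<forall>h\<in>N. inj_on h B"
              using regular_point[OF h False] by blast
            have "v = v'" if "v \<in> B" "v' \<in> B" "(u, v) \<in> \<Gamma>" "(u, v') \<in> \<Gamma>" for u v v'
            proof -
              have "h v = h u" "h v' = h u"
                using subsetD[OF sub that(3)] subsetD[OF sub that(4)] by (simp_all add: partners_def)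
              moreover have "inj_on h B" using B by blast
              ultimately show ?thesis using that(1,2) by (metis inj_onD)
            qed
            then have "(UNIV \<times> B \<times> B) \<inter> Q = {}" unfolding Q_def by auto
            moreover have "open (UNIV \<times> B \<times> B)" using B by (intro open_Times) auto
            ultimately show ?thesis using B z 3 by (intro exI[of _ "UNIV \<times> B \<times> B"]) auto
          next
            case True
            then have yx: "y = x" using bad sym 3 by blast
            obtain B N where B: "open B" "y \<in> B" "openin T N" "h \<in> N" "\<forall>h\<in>N. two_sheeted S B h"
              using singular_point[OF h True] by blast
            then have two: "two_sheeted S B h" by blast
            have "v = v'" if "u \<in> B" "v \<in> B" "v' \<in> B" "(u, v) \<in> \<Gamma>" "(u, v') \<in> \<Gamma>" for u v v'
            proof (cases "u \<in> S")
              case True then show ?thesis using bad that by blast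
            next
              case False
              then have "h u = h v" "h u = h v'" "u \<noteq> v" "u \<noteq> v'"
                using that sub unfolding partners_def by auto
              then show ?thesis using two_sheeted_unique[OF two, of u v v'] that by auto
            qed
            then have "(B \<times> B \<times> B) \<inter> Q = {}" unfolding Q_def by auto
            moreover have "open (B \<times> B \<times> B)" using B by (intro open_Times) auto
            ultimately show ?thesis using B z 3 yx by (intro exI[of _ "B \<times> B \<times> B"]) auto
          qed
        qed
      qed
      then have "closed Q" by (simp add: closed_def)
      moreover have "compact (UNIV :: ('a \<times> 'a \<times> 'a) set)"
        using compact_Times[OF compact_source compact_prod] by simp
      ultimately have "compact Q" using compact_Int_closed[of UNIV Q] by simp
      then show ?thesis by (intro compact_imp_closed compact_continuous_image continuous_intros)
    qed
    moreover have "fst ` Q \<noteq> UNIV"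
    proof -
      obtain s where s: "s \<in> S" using S_nonempty by auto
      have "s \<notin> fst ` Q"
      proof
        assume "s \<in> fst ` Q"
        then obtain y y' where "(s, y) \<in> \<Gamma>" "(s, y') \<in> \<Gamma>" "y \<noteq> y'" unfolding Q_def by auto
        then show False using bad[of s y] bad[of s y'] s by simp
      qed
      then show ?thesis by blast
    qed
    ultimately show ?thesis using clopen by blast
  qed
  then have uniq: "y = y'" if "(x, y) \<in> \<Gamma>" "(x, y') \<in> \<Gamma>" for x y y'
    using that unfolding Q_def by blast
  define \<alpha> where "\<alpha> x = (THE y. (x, y) \<in> \<Gamma>)" for x
  have \<alpha>: "(x, y) \<in> \<Gamma> \<longleftrightarrow> y = \<alpha> x" for x y
    unfolding \<alpha>_def using ex uniq by (metis theI)
  have "continuous_on UNIV \<alpha>"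
  proof -
    have "\<exists>B. open B \<and> x \<in> B \<and> (\<forall>x'\<in>UNIV. x' \<in> B \<longrightarrow> \<alpha> x' \<in> Y)" if Y: "open Y" "\<alpha> x \<in> Y" for x Y
    proof -
      have "(x, \<alpha> x) \<in> \<Gamma>" by (simp add: \<alpha>)
      from local_section[OF this Y] obtain B where "open B" "x \<in> B" "\<forall>x'\<in>B. \<exists>y'\<in>Y. (x', y') \<in> \<Gamma>"
        by blast
      then show ?thesis by (intro exI[of _ B]) (auto simp: \<alpha>)
    qed
    then show ?thesis by (simp add: continuous_on_topological)
  qed
  moreover have "\<alpha> \<circ> \<alpha> = id"
  proof
    fix x
    have "(x, \<alpha> x) \<in> \<Gamma>" by (simp add: \<alpha>)
    then show "(\<alpha> \<circ> \<alpha>) x = id x" using sym[of x "\<alpha> x"] by (simp add: \<alpha>)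
  qed
  moreover have "{x. \<alpha> x = x} = S"
  proof -
    have "\<alpha> x = x \<longleftrightarrow> x \<in> S" for x
    proof
      assume "\<alpha> x = x"
      then have "(x, x) \<in> partners h" using sub \<alpha>[of x x] by auto
      then show "x \<in> S" by (simp add: partners_def)
    next
      assume "x \<in> S"
      then show "\<alpha> x = x" using diag[of x] by (simp add: \<alpha>)
    qed
    then show ?thesis by auto
  qed
  moreover have "h \<circ> \<alpha> = h"
  proof
    fix x
    have "(x, \<alpha> x) \<in> partners h" using sub \<alpha>[of x "\<alpha> x"] by auto
    then show "(h \<circ> \<alpha>) x = h x" by (simp add: partners_def)
  qed
  ultimately show ?thesis unfolding deck_def by blast
qed

section \<open>Persistence of involutions under perturbation\<close>

lemma separate_compact:
  fixes K L :: "'c::t2_space set"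
  assumes "compact K" "compact L" "K \<inter> L = {}"
  obtains U V where "open U" "open V" "K \<subseteq> U" "L \<subseteq> V" "U \<inter> V = {}"
proof -
  have "Hausdorff_space (euclidean :: 'c topology)"
    unfolding Hausdorff_space_def disjnt_def using hausdorff by (metis UNIV_I open_openin topspace_euclidean)
  then show ?thesis
    using Hausdorff_space_compact_separation[of euclidean K L] assms that by (auto simp: disjnt_def)
qed

text \<open>If \<open>y'\<close> is a partner of \<open>x'\<close> close to
  \<open>\<alpha> x\<close>, then \<open>y'\<close> and \<open>\<alpha> x'\<close> lie in one small
  set \<open>B\<close> and have the same value. Injectivity on \<open>B\<close>, or two-sheetedness
  at \<open>S\<close>, identifies them.\<close>

lemma graph_open_in_partners:
  assumes f: "f \<in> topspace T" and \<alpha>: "deck f \<alpha>" and xy: "(x, y) \<in> partners f" "y = \<alpha> x"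
  shows "\<exists>B. open B \<and> (x, y) \<in> B \<and> (\<forall>(x', y')\<in>B. (x', y') \<in> partners f \<longrightarrow> y' = \<alpha> x')"
proof -
  note D = deckD[OF \<alpha>]
  have oV: "open (\<alpha> -` B)" if "open B" for B
    using open_vimage[OF that D(5)] .
  show ?thesis
  proof (cases "x \<in> S")
    case False
    then have "y \<notin> S" using D(4) xy by simp
    then obtain B N where B: "open B" "y \<in> B" "f \<in> N" "\<forall>h\<in>N. inj_on h B"
      using regular_point[OF f, of y] by blast
    have "y' = \<alpha> x'" if "x' \<in> \<alpha> -` B" "y' \<in> B" "(x', y') \<in> partners f" for x' y'
    proof -
      have "inj_on f B" using B by blast
      moreover have "f y' = f (\<alpha> x')" using that D(3) unfolding partners_def by simp
      ultimately show ?thesis using that(1,2) by (metis inj_onD vimageE)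
    qed
    moreover have "open (\<alpha> -` B \<times> B)" using B oV by (intro open_Times)
    ultimately show ?thesis using B xy by (intro exI[of _ "\<alpha> -` B \<times> B"]) auto
  next
    case True
    then have yx: "y = x" using D(2) xy by simp
    obtain B N where B: "open B" "x \<in> B" "openin T N" "f \<in> N" "\<forall>h\<in>N. two_sheeted S B h"
      using singular_point[OF f True] by blast
    let ?C = "B \<inter> \<alpha> -` B"
    have "y' = \<alpha> x'" if "x' \<in> ?C" "y' \<in> B" "(x', y') \<in> partners f" for x' y'
    proof (cases "x' \<in> S")
      case True
      have "two_sheeted S B f" "f x' = f y'" using B that unfolding partners_def by auto
      then have "x' = y'" using two_sheeted_branch[of S B f x' y'] that True by auto
      then show ?thesis using D(2)[of x'] True by simp
    next
      case False
      then have "y' \<noteq> x'" "\<alpha> x' \<noteq> x'" "f y' = f x'" "f (\<alpha> x') = f x'"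
        using that D(2,3) unfolding partners_def by auto
      moreover have "two_sheeted S B f" using B by blast
      ultimately show ?thesis using two_sheeted_unique[of S B f x' y' "\<alpha> x'"] that by auto
    qed
    moreover have "open (?C \<times> B)" using B oV by (intro open_Times) auto
    ultimately show ?thesis using B xy yx by (intro exI[of _ "?C \<times> B"]) auto
  qed
qed

text \<open>The graph of \<open>\<alpha>\<close> and the remaining partners of \<open>f\<close> are
  disjoint compact sets, hence have disjoint open neighbourhoods. Semicontinuity keeps the partners
  of nearby maps inside their union, so each neighbourhood cuts out a clopen piece.\<close>

lemma deck_near:
  assumes f: "f \<in> topspace T" and \<alpha>: "deck f \<alpha>"
  shows "\<exists>N. openin T N \<and> f \<in> N \<and> (\<forall>h\<in>N. \<exists>\<beta>. deck h \<beta>)"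
proof -
  note D = deckD[OF \<alpha>]
  define \<Gamma> where "\<Gamma> = {(x, y). (x, y) \<in> partners f \<and> y = \<alpha> x}"
  have compact_prod: "compact (UNIV :: ('a \<times> 'a) set)"
    using compact_Times[OF compact_source compact_source] by simp
  have "\<forall>z\<in>\<Gamma>. \<exists>B. open B \<and> z \<in> B \<and> (\<forall>(x', y')\<in>B. (x', y') \<in> partners f \<longrightarrow> y' = \<alpha> x')"
  proof
    fix z assume z: "z \<in> \<Gamma>"
    obtain x y where xy: "z = (x, y)" by (cases z)
    have "(x, y) \<in> partners f" "y = \<alpha> x" using z unfolding \<Gamma>_def xy by auto
    from graph_open_in_partners[OF f \<alpha> this]
    show "\<exists>B. open B \<and> z \<in> B \<and> (\<forall>(x', y')\<in>B. (x', y') \<in> partners f \<longrightarrow> y' = \<alpha> x')"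
      unfolding xy .
  qed
  note loc = this
  \<comment> \<open>The largest open set in which all partners of \<open>f\<close> lie on the graph;
    its complement turns the remaining partners into a closed set.\<close>
  define G where "G = \<Union>{B. open B \<and> (\<forall>(x', y')\<in>B. (x', y') \<in> partners f \<longrightarrow> y' = \<alpha> x')}"
  have G: "open G" "\<Gamma> \<subseteq> G" "partners f \<inter> G \<subseteq> \<Gamma>"
  proof -
    show "open G" unfolding G_def by blast
    show "\<Gamma> \<subseteq> G"
    proof
      fix z assume "z \<in> \<Gamma>"
      from bspec[OF loc this] show "z \<in> G" unfolding G_def by blast
    qed
    show "partners f \<inter> G \<subseteq> \<Gamma>" unfolding G_def \<Gamma>_def by auto
  qed
  have gra: "\<Gamma> = (\<lambda>x. (x, \<alpha> x)) ` UNIV" unfolding \<Gamma>_def using D(6) by auto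
  have "compact \<Gamma>" unfolding gra by (intro compact_continuous_image continuous_intros D compact_source)
  then have "closed \<Gamma>" by (rule compact_imp_closed)
  have "closed (partners f - G)" using closed_partners[OF f] G(1) by (simp add: closed_Diff)
  then have "compact (partners f - G)" using compact_Int_closed[OF compact_prod] by fastforce
  have "\<Gamma> \<inter> (partners f - G) = {}" using G by auto
  then obtain O1 O2 where O12: "open O1" "open O2" "\<Gamma> \<subseteq> O1" "partners f - G \<subseteq> O2" "O1 \<inter> O2 = {}"
    using separate_compact[OF \<open>compact \<Gamma>\<close> \<open>compact (partners f - G)\<close>] by blast
  \<comment> \<open>Besides the splitting, \<open>P\<close> demands that the piece in
    \<open>O1\<close> contain nothing but the diagonal over \<open>S\<close>. This is the
    one-sheetedness needed to start the covering argument for \<open>h\<close>, and it must hold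
    uniformly in \<open>h\<close>.\<close>
  define P where "P h z \<longleftrightarrow> (z \<in> partners h \<longrightarrow> z \<in> O1 \<union> O2 \<and>
      (z \<in> O1 \<and> fst z \<in> S \<longrightarrow> fst z = snd z))" for h z
  have "\<exists>N. openin T N \<and> f \<in> N \<and> (\<forall>h\<in>N. \<forall>z\<in>UNIV. P h z)"
  proof (rule compact_uniform[OF f compact_prod])
    fix z :: "'a \<times> 'a"
    consider "z \<notin> partners f" | "z \<in> partners f - G" | "z \<in> \<Gamma>" "fst z \<notin> S" | "z \<in> \<Gamma>" "fst z \<in> S"
      using G by blast
    then show "\<exists>B N. open B \<and> z \<in> B \<and> openin T N \<and> f \<in> N \<and> (\<forall>h\<in>N. \<forall>w\<in>B. P h w)"
    proof cases
      case 1
      then obtain B N where "open B" "z \<in> B" "openin T N" "f \<in> N" "\<forall>h\<in>N. B \<inter> partners h = {}"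
        using nonpartners_open[OF f, of "fst z" "snd z"] by auto
      then show ?thesis unfolding P_def by blast
    next
      case 2
      then show ?thesis using O12 f unfolding P_def
        by (intro exI[of _ O2] exI[of _ "topspace T"]) auto
    next
      case 3
      have "open ((- S) \<times> UNIV :: ('a \<times> 'a) set)" using S_closed by (intro open_Times) auto
      then show ?thesis using O12 f 3 unfolding P_def
        by (intro exI[of _ "O1 \<inter> ((- S) \<times> UNIV)"] exI[of _ "topspace T"]) (auto simp: mem_Times_iff)
    next
      case 4
      define s where "s = fst z"
      have z: "z = (s, s)" using 4 D(2) unfolding s_def \<Gamma>_def by auto
      have s: "s \<in> S" using 4 s_def by simp
      obtain B N where B: "open B" "s \<in> B" "openin T N" "f \<in> N" "\<forall>h\<in>N. two_sheeted S B h"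
        using singular_point[OF f s] by blast
      have "open (O1 \<inter> (B \<times> B))" using B O12 by (intro open_Int open_Times)
      moreover have "z \<in> O1 \<inter> (B \<times> B)" using 4 z O12 B by auto
      moreover have "\<forall>h\<in>N. \<forall>w\<in>O1 \<inter> (B \<times> B). P h w"
      proof (intro ballI)
        fix h w assume hw: "h \<in> N" "w \<in> O1 \<inter> (B \<times> B)"
        have two: "two_sheeted S B h" using B hw by blast
        have "fst w = snd w" if "w \<in> partners h" "fst w \<in> S"
          using two_sheeted_branch[OF two, of "fst w" "snd w"] that hw
          unfolding partners_def by (cases w) auto
        then show "P h w" unfolding P_def using hw by blast
      qed
      ultimately show ?thesis using B by blast
    qed
  qed
  then obtain N where N: "openin T N" "f \<in> N" "\<And>h z. h \<in> N \<Longrightarrow> P h z" by auto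
  have "\<exists>\<beta>. deck h \<beta>" if hN: "h \<in> N" for h
  proof -
    have h: "h \<in> topspace T" using hN N(1) openin_subset by blast
    \<comment> \<open>\<open>O1\<close> need not be symmetric. Intersecting it with its mirror image
      and enlarging \<open>O2\<close> accordingly keeps the two sets disjoint and still covers the
      partners, because these are symmetric.\<close>
    define O1' where "O1' = O1 \<inter> prod.swap -` O1"
    define O2' where "O2' = O2 \<union> prod.swap -` O2"
    have sw: "continuous_on UNIV (prod.swap :: 'a \<times> 'a \<Rightarrow> 'a \<times> 'a)" by (rule continuous_on_swap)
    have op: "open O1'" "open O2'" unfolding O1'_def O2'_def using O12 sw
      by (auto intro!: open_Int open_Un open_vimage)
    have psym: "(y, x) \<in> partners h" if "(x, y) \<in> partners h" for x y
      using that unfolding partners_def by auto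
    have cov: "(x, y) \<in> O1' \<or> (x, y) \<in> O2'" if "(x, y) \<in> partners h" for x y
      using N(3)[OF hN, of "(x, y)"] N(3)[OF hN, of "(y, x)"] that psym[OF that]
      unfolding P_def O1'_def O2'_def by auto
    have dis: "O1' \<inter> O2' = {}" unfolding O1'_def O2'_def using O12 by auto
    have "partners h \<inter> O1' = partners h \<inter> - O2'" using cov dis by auto
    then have cl: "closed (partners h \<inter> O1')" using closed_partners[OF h] op by (simp add: closed_Int closed_Compl)
    show ?thesis
    proof (rule deck_if_clopen_sheet[OF h _ cl op(1) refl])
      fix x y assume "(x, y) \<in> partners h \<inter> O1'"
      then show "(y, x) \<in> partners h \<inter> O1'" using psym unfolding O1'_def by auto
    next
      fix x assume x: "x \<in> S"
      then have "(x, x) \<in> \<Gamma>" unfolding \<Gamma>_def partners_def using D(2)[of x] by simp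
      then show "(x, x) \<in> partners h \<inter> O1'" unfolding O1'_def using O12 x by (auto simp: partners_def)
    next
      fix x y assume "(x, y) \<in> partners h \<inter> O1'" "x \<in> S"
      then show "y = x" using N(3)[OF hN, of "(x, y)"] unfolding P_def O1'_def by auto
    qed auto
  qed
  then show ?thesis using N by blast
qed

section \<open>Limits of involutions\<close>

lemma compact_if_closed: "closed (K :: 'a set) \<Longrightarrow> compact K"
  using compact_Int_closed[OF compact_source, of K] by simp

lemma shrink_open:
  fixes y :: 'a
  assumes "open Y" "y \<in> Y"
  obtains D where "open D" "y \<in> D" "closure D \<subseteq> Y"
proof -
  have "compact (- Y)" using assms by (intro compact_if_closed) (simp add: closed_Compl)
  then obtain U V where UV: "open U" "open V" "{y} \<subseteq> U" "- Y \<subseteq> V" "U \<inter> V = {}"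
    using separate_compact[of "{y}" "- Y"] assms by auto
  then have "closure U \<subseteq> - V" by (intro closure_minimal) (auto simp: closed_Compl)
  then show ?thesis using that[of U] UV by auto
qed

text \<open>Disjoint open neighbourhoods of \<open>f x\<close> and of the compact image of
  \<open>K\<close> absorb small changes of both the map and the point.\<close>

lemma avoid_compact:
  assumes f: "f \<in> topspace T" and K: "compact K" "f x \<notin> f ` K"
  obtains B N where "open B" "x \<in> B" "openin T N" "f \<in> N"
    "\<forall>h\<in>N. \<forall>x'\<in>B. \<forall>z\<in>K. h x' \<noteq> h z"
proof -
  have cK: "compact (f ` K)"
    using K(1) continuous_on_subset[OF continuous[OF f] subset_UNIV] by (rule compact_continuous_image[rotated])
  have "{f x} \<inter> f ` K = {}" using K(2) by blast
  then obtain U V where UV: "open U" "open V" "{f x} \<subseteq> U" "f ` K \<subseteq> V" "U \<inter> V = {}"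
    by (rule separate_compact[OF compact_sing cK])
  obtain B N where B: "open B" "x \<in> B" "openin T N" "f \<in> N" "\<forall>h\<in>N. h ` B \<subseteq> U"
    using compact_open[OF f UV(1) subsetD[OF UV(3) singletonI]] by blast
  have "\<exists>N. openin T N \<and> f \<in> N \<and> (\<forall>h\<in>N. \<forall>w\<in>K. h w \<in> V)"
  proof (rule compact_uniform[OF f K(1)])
    fix z assume "z \<in> K"
    then have "f z \<in> V" using UV(4) by blast
    from compact_open[OF f UV(2) this]
    show "\<exists>B N. open B \<and> z \<in> B \<and> openin T N \<and> f \<in> N \<and> (\<forall>h\<in>N. \<forall>w\<in>B. h w \<in> V)"
      by (simp add: image_subset_iff)
  qed
  then obtain N' where N': "openin T N'" "f \<in> N'" "\<And>h w. h \<in> N' \<Longrightarrow> w \<in> K \<Longrightarrow> h w \<in> V" by blast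
  show ?thesis
  proof (rule that[OF B(1,2), of "N \<inter> N'"])
    show "openin T (N \<inter> N')" using B N' by blast
    show "f \<in> N \<inter> N'" using B N' by blast
    have "h x' \<noteq> h z" if "h \<in> N \<inter> N'" "x' \<in> B" "z \<in> K" for h x' z
    proof -
      have "h x' \<in> U" "h z \<in> V" using B(5) N'(3) that by auto
      then show ?thesis using UV(5) by auto
    qed
    then show "\<forall>h\<in>N \<inter> N'. \<forall>x'\<in>B. \<forall>z\<in>K. h x' \<noteq> h z" by blast
  qed
qed

lemma isolated_in_fibre:
  assumes f: "f \<in> topspace T"
  obtains B where "open B" "y \<in> B" "\<forall>z\<in>B. f z = f y \<longrightarrow> z = y"
proof (cases "y \<in> S")
  case True
  obtain B N where B: "open B" "y \<in> B" "openin T N" "f \<in> N" "\<forall>h\<in>N. two_sheeted S B h"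
    using singular_point[OF f True] by blast
  then have "two_sheeted S B f" by blast
  then have "\<forall>z\<in>B. f z = f y \<longrightarrow> z = y" using B(2) True two_sheeted_branch[of S B f y] by metis
  then show ?thesis using that[of B] B by blast
next
  case False
  obtain B N where B: "open B" "y \<in> B" "f \<in> N" "\<forall>h\<in>N. inj_on h B"
    using regular_point[OF f False] by blast
  have "inj_on f B" using B by blast
  then show ?thesis using that[of B] B(1,2) by (simp add: inj_on_eq_iff)
qed

text \<open>The connected set \<open>\<alpha> ` C\<close> cannot leave \<open>D\<close>, since \<open>g\<close> separates \<open>C\<close> from the frontier of \<open>D\<close>.\<close>

lemma deck_confined:
  assumes f: "f \<in> topspace T" and xy: "f x = f y" and X: "open X" "x \<in> X" and Y: "open Y" "y \<in> Y"
  obtains C D N where "open C" "x \<in> C" "C \<subseteq> X" "open D" "y \<in> D" "closure D \<subseteq> Y"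
    "openin T N" "f \<in> N"
    "\<forall>g\<in>N. \<forall>\<alpha>. deck g \<alpha> \<longrightarrow> (\<exists>x'\<in>C. \<alpha> x' \<in> D) \<longrightarrow> \<alpha> ` C \<subseteq> D"
proof -
  obtain B where B: "open B" "y \<in> B" "\<forall>z\<in>B. f z = f y \<longrightarrow> z = y"
    using isolated_in_fibre[OF f] by blast
  obtain D where D: "open D" "y \<in> D" "closure D \<subseteq> Y \<inter> B"
    using shrink_open[of "Y \<inter> B" y] Y B by blast
  have fD: "frontier D = closure D - D" using D(1) by (simp add: frontier_def interior_open)
  have "compact (frontier D)" by (intro compact_if_closed) simp
  \<comment> \<open>The closure of \<open>D\<close> lies in a set where \<open>y\<close> is alone in
    its fibre, and \<open>y\<close> is interior to \<open>D\<close>.\<close>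
  moreover have "f x \<notin> f ` frontier D"
  proof
    assume "f x \<in> f ` frontier D"
    then obtain z where "z \<in> closure D - D" "f z = f y" using xy fD by auto
    then show False using B(3) D by auto
  qed
  ultimately obtain B' N where B': "open B'" "x \<in> B'" "openin T N" "f \<in> N"
    "\<forall>h\<in>N. \<forall>x'\<in>B'. \<forall>z\<in>frontier D. h x' \<noteq> h z"
    by (rule avoid_compact[OF f])
  obtain C where C: "open C" "connected C" "x \<in> C" "C \<subseteq> X \<inter> B'"
    using locally_connected[of "X \<inter> B'" x] X B' by blast
  show ?thesis
  proof (rule that[of C D N])
    have "\<alpha> ` C \<subseteq> D" if g: "g \<in> N" "deck g \<alpha>" "x' \<in> C" "\<alpha> x' \<in> D" for g \<alpha> x'
    proof -
    have "\<alpha> z \<notin> frontier D" if "z \<in> C" for z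
      using bspec[OF B'(5) g(1)] deckD(3)[OF g(2), of z] that C(4) by (metis IntD2 subsetD)
    then have no: "\<alpha> ` C \<inter> frontier D = {}" by blast
    have "continuous_on C \<alpha>" using deckD(5)[OF g(2)] continuous_on_subset by blast
    then have conn: "connected (\<alpha> ` C)" using C connected_continuous_image by blast
    have "\<alpha> ` C \<inter> D \<noteq> {}" using g by auto
    show ?thesis
    proof (rule ccontr)
      assume "\<not> \<alpha> ` C \<subseteq> D"
      then have "- closure D \<inter> \<alpha> ` C \<noteq> {}" using no fD by auto
      moreover have "\<alpha> ` C \<subseteq> D \<union> - closure D" using no fD by auto
      moreover have "D \<inter> - closure D \<inter> \<alpha> ` C = {}" using closure_subset[of D] by auto
      moreover have "D \<inter> \<alpha> ` C \<noteq> {}" using g by auto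
      ultimately show False using connectedD[OF conn D(1), of "- closure D"] by auto
    qed
    qed
    then show "\<forall>g\<in>N. \<forall>\<alpha>. deck g \<alpha> \<longrightarrow> (\<exists>x'\<in>C. \<alpha> x' \<in> D) \<longrightarrow> \<alpha> ` C \<subseteq> D" by blast
  qed (use C D B' in auto)
qed

text \<open>Cluster points alone might give a graph with gaps. Confinement repairs this: one graph
  point of a nearby involution in \<open>C \<times> D\<close> forces the involution to carry all of
  \<open>C\<close> into \<open>D\<close>, so every partner of \<open>f\<close> in that box is itself
  a cluster point. Single-valuedness is left to \<open>deck_if_clopen_sheet\<close>.\<close>

lemma deck_limit:
  assumes f: "f \<in> topspace T"
    and lim: "\<And>N. openin T N \<Longrightarrow> f \<in> N \<Longrightarrow> \<exists>g\<in>N. \<exists>\<alpha>. deck g \<alpha>"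
  shows "\<exists>\<alpha>. deck f \<alpha>"
proof -
  define clus where "clus z \<longleftrightarrow> (\<forall>O' N. open O' \<longrightarrow> z \<in> O' \<longrightarrow> openin T N \<longrightarrow> f \<in> N \<longrightarrow>
    (\<exists>g\<in>N. \<exists>\<alpha> x. deck g \<alpha> \<and> (x, \<alpha> x) \<in> O'))" for z
  have clusD: "\<exists>g \<alpha> x. g \<in> N \<and> deck g \<alpha> \<and> (x, \<alpha> x) \<in> O'"
    if "clus z" "open O'" "z \<in> O'" "openin T N" "f \<in> N" for z O' N
    using that unfolding clus_def by blast
  \<comment> \<open>\<open>\<Gamma>\<close> collects the cluster points of the graphs of the involutions of the taut maps near \<open>f\<close>.\<close>
  define \<Gamma> where "\<Gamma> = {z. clus z}"
  have sub: "\<Gamma> \<subseteq> partners f"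
  proof
    fix z assume z: "z \<in> \<Gamma>"
    show "z \<in> partners f"
    proof (rule ccontr)
      assume "z \<notin> partners f"
      then obtain B N where B: "open B" "z \<in> B" "openin T N" "f \<in> N" "\<forall>h\<in>N. B \<inter> partners h = {}"
        using nonpartners_open[OF f, of "fst z" "snd z"] by auto
      obtain g \<alpha> x where "g \<in> N" "deck g \<alpha>" "(x, \<alpha> x) \<in> B"
        using clusD[OF _ B(1-4)] z unfolding \<Gamma>_def by blast
      then show False using B(5) deckD(6)[of g \<alpha> x] by blast
    qed
  qed
  have cl: "closed \<Gamma>"
  proof -
    have "\<exists>B. open B \<and> z \<in> B \<and> B \<subseteq> - \<Gamma>" if "z \<in> - \<Gamma>" for z
    proof -
      have "\<not> clus z" using that unfolding \<Gamma>_def by simp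
      then obtain B N where "open B" "z \<in> B" "openin T N" "f \<in> N"
          "\<not> (\<exists>g\<in>N. \<exists>\<alpha> x. deck g \<alpha> \<and> (x, \<alpha> x) \<in> B)"
        unfolding clus_def by blast
      then have "\<not> clus w" if "w \<in> B" for w using that unfolding clus_def by blast
      then show ?thesis using \<open>open B\<close> \<open>z \<in> B\<close> unfolding \<Gamma>_def by blast
    qed
    then have "open (- \<Gamma>)" by (subst open_subopen) blast
    then show ?thesis by (simp add: closed_def)
  qed
  have sym: "(y, x) \<in> \<Gamma>" if "(x, y) \<in> \<Gamma>" for x y
  proof -
    have "\<exists>g\<in>N. \<exists>\<alpha> x. deck g \<alpha> \<and> (x, \<alpha> x) \<in> O'"
      if O': "open O'" "(y, x) \<in> O'" "openin T N" "f \<in> N" for O' N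
    proof -
      have "open (prod.swap -` O')" using O'(1) continuous_on_swap by (rule open_vimage)
      then obtain g \<alpha> u where g: "g \<in> N" "deck g \<alpha>" "(u, \<alpha> u) \<in> prod.swap -` O'"
        using clusD[of "(x, y)" "prod.swap -` O'" N] \<open>(x, y) \<in> \<Gamma>\<close> O' unfolding \<Gamma>_def by auto
      have "(\<alpha> u, \<alpha> (\<alpha> u)) \<in> O'" using g deckD(1)[OF g(2), of u] by simp
      then show ?thesis using g by blast
    qed
    then show ?thesis unfolding \<Gamma>_def clus_def by blast
  qed
  have diag: "(x, x) \<in> \<Gamma>" if x: "x \<in> S" for x
  proof -
    have "\<exists>g\<in>N. \<exists>\<alpha> u. deck g \<alpha> \<and> (u, \<alpha> u) \<in> O'"
      if O': "(x, x) \<in> O'" "openin T N" "f \<in> N" for O' N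
    proof -
      obtain g \<alpha> where g: "g \<in> N" "deck g \<alpha>" using lim[OF O'(2,3)] by blast
      then have "(x, \<alpha> x) \<in> O'" using deckD(2)[OF g(2), of x] x O' by simp
      then show ?thesis using g by blast
    qed
    then show ?thesis unfolding \<Gamma>_def clus_def by blast
  qed
  \<comment> \<open>Every involution in question fixes \<open>x\<close>, so confinement keeps the
    image of \<open>C\<close> inside \<open>D\<close>, whose closure misses
    \<open>y\<close>.\<close>
  have bad: "y = x" if xy: "(x, y) \<in> \<Gamma>" and x: "x \<in> S" for x y
  proof (rule ccontr)
    assume ne: "y \<noteq> x"
    obtain C D N where C: "open C" "x \<in> C" "C \<subseteq> UNIV" "open D" "x \<in> D" "closure D \<subseteq> - {y}"
      "openin T N" "f \<in> N"
      and conf: "\<forall>g\<in>N. \<forall>\<alpha>. deck g \<alpha> \<longrightarrow> (\<exists>x'\<in>C. \<alpha> x' \<in> D) \<longrightarrow> \<alpha> ` C \<subseteq> D"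
      by (rule deck_confined[OF f refl open_UNIV UNIV_I, of "- {y}" x]) (use ne in auto)
    have "open (C \<times> - closure D)" using C by (intro open_Times) auto
    moreover have "(x, y) \<in> C \<times> - closure D" using C by auto
    ultimately obtain g \<alpha> u where g: "g \<in> N" "deck g \<alpha>" "(u, \<alpha> u) \<in> C \<times> - closure D"
      using clusD[of "(x, y)" "C \<times> - closure D" N] xy C unfolding \<Gamma>_def by auto
    have "\<alpha> x = x" using deckD(2)[OF g(2)] x by blast
    then have "\<alpha> ` C \<subseteq> D" using conf g(1,2) C by (metis)
    then show False using g closure_subset[of D] by auto
  qed
  \<comment> \<open>The point \<open>\<alpha> u\<close> of a suitable nearby involution is forced
    into the given neighbourhood of \<open>v\<close>, because \<open>u\<close> and \<open>v\<close>
    are the only possible points of the fibre of \<open>f\<close> in the closure of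
    \<open>D\<close>.\<close>
  have fill: "(u, v) \<in> \<Gamma>"
    if xy: "(x, y) \<in> \<Gamma>" and C: "open C" "x \<in> C" "open D" "y \<in> D" "openin T N" "f \<in> N"
    and conf: "\<forall>g\<in>N. \<forall>\<alpha>. deck g \<alpha> \<longrightarrow> (\<exists>x'\<in>C. \<alpha> x' \<in> D) \<longrightarrow> \<alpha> ` C \<subseteq> D"
    and u: "u \<in> C" "u \<notin> S" and fib: "\<And>z. z \<in> closure D \<Longrightarrow> f z = f u \<Longrightarrow> z = v \<or> z = u"
    for x y C D N u v
  proof -
    have "\<exists>g\<in>N'. \<exists>\<alpha> x. deck g \<alpha> \<and> (x, \<alpha> x) \<in> O'"
      if O': "open O'" "(u, v) \<in> O'" and N': "openin T N'" "f \<in> N'" for O' N'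
    proof -
      obtain U V where UV: "open U" "open V" "(u, v) \<in> U \<times> V" "U \<times> V \<subseteq> O'"
        using open_prod_elim[OF O'] by metis
      obtain R NR where R: "open R" "u \<in> R" "openin T NR" "f \<in> NR" "\<forall>h\<in>NR. inj_on h R"
        using regular_point[OF f u(2)] by blast
      \<comment> \<open>Values on \<open>?K\<close> stay away from the value at \<open>u\<close> for
        maps near \<open>f\<close>, so \<open>\<alpha> u\<close> lies in \<open>V\<close> or
        \<open>R\<close>. Uniform injectivity on \<open>R\<close> rules out the latter, since
        \<open>u\<close> is not fixed.\<close>
      let ?K = "closure D - V - R"
      have "closed ?K" using UV R by (intro closed_Diff) auto
      then have "compact ?K" by (rule compact_if_closed)
      moreover have "f u \<notin> f ` ?K"
      proof
        assume "f u \<in> f ` ?K"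
        then obtain z where "z \<in> ?K" "f z = f u" by auto
        then show False using fib[of z] UV R by auto
      qed
      ultimately obtain B NK where K: "open B" "u \<in> B" "openin T NK" "f \<in> NK"
        "\<forall>h\<in>NK. \<forall>x'\<in>B. \<forall>z\<in>?K. h x' \<noteq> h z"
        by (rule avoid_compact[OF f])
      let ?N = "N \<inter> N' \<inter> NR \<inter> NK"
      have N: "openin T ?N" "f \<in> ?N" using N' R K C by (auto intro!: openin_Int)
      have CD: "open (C \<times> D)" "(x, y) \<in> C \<times> D" using C by (auto intro!: open_Times)
      obtain g \<alpha> w where g: "g \<in> ?N" "deck g \<alpha>" "(w, \<alpha> w) \<in> C \<times> D"
        using clusD[OF _ CD N] xy unfolding \<Gamma>_def by auto
      have gu: "g (\<alpha> u) = g u" using deckD(3)[OF g(2)] .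
      have "\<alpha> ` C \<subseteq> D" using conf g by auto
      then have "\<alpha> u \<in> closure D" using u closure_subset[of D] by auto
      moreover have "\<alpha> u \<notin> ?K" using K(5) K(2) g(1) gu by (metis IntD2)
      moreover have "\<alpha> u \<notin> R"
      proof
        assume "\<alpha> u \<in> R"
        moreover have "inj_on g R" using R g by auto
        ultimately have "\<alpha> u = u" using gu R(2) by (metis inj_onD)
        then show False using deckD(2)[OF g(2)] u by simp
      qed
      ultimately have "(u, \<alpha> u) \<in> O'" using UV by auto
      then show ?thesis using g by blast
    qed
    then show ?thesis unfolding \<Gamma>_def clus_def by blast
  qed
  have loc: "\<exists>B. open B \<and> (x, y) \<in> B \<and> partners f \<inter> B \<subseteq> \<Gamma>" if xy: "(x, y) \<in> \<Gamma>" for x y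
  proof -
    have fxy: "f x = f y" using sub xy unfolding partners_def by auto
    show ?thesis
    proof (cases "y \<in> S")
      case False
      then have x: "x \<notin> S" using bad xy by blast
      obtain R NR where R: "open R" "y \<in> R" "f \<in> NR" "\<forall>h\<in>NR. inj_on h R"
        using regular_point[OF f False] by blast
      have inj: "inj_on f R" using R by blast
      obtain C D N where C: "open C" "x \<in> C" "C \<subseteq> - S" "open D" "y \<in> D" "closure D \<subseteq> R"
        "openin T N" "f \<in> N"
        and conf: "\<forall>g\<in>N. \<forall>\<alpha>. deck g \<alpha> \<longrightarrow> (\<exists>x'\<in>C. \<alpha> x' \<in> D) \<longrightarrow> \<alpha> ` C \<subseteq> D"
        by (rule deck_confined[OF f fxy _ _ R(1,2), of "- S"]) (use x S_closed in auto)
      have "(u, v) \<in> \<Gamma>" if uv: "(u, v) \<in> partners f" "u \<in> C" "v \<in> D" for u v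
      proof (rule fill[OF xy C(1,2,4,5,7,8) conf uv(2)])
        show "u \<notin> S" using uv C by auto
        fix z assume "z \<in> closure D" "f z = f u"
        moreover have "f v = f u" using uv unfolding partners_def by simp
        moreover have "z \<in> R" "v \<in> R" using C uv closure_subset[of D] \<open>z \<in> closure D\<close> by auto
        ultimately show "z = v \<or> z = u" using inj by (metis inj_onD)
      qed
      then have "partners f \<inter> (C \<times> D) \<subseteq> \<Gamma>" by auto
      moreover have "open (C \<times> D)" using C by (intro open_Times)
      ultimately show ?thesis using C by blast
    next
      case True
      then have yx: "y = x" using bad sym xy by blast
      obtain B N0 where B: "open B" "y \<in> B" "openin T N0" "f \<in> N0" "\<forall>h\<in>N0. two_sheeted S B h"
        using singular_point[OF f True] by blast
      have xB: "x \<in> B" using B yx by simp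
      obtain C D N where C: "open C" "x \<in> C" "C \<subseteq> B" "open D" "y \<in> D" "closure D \<subseteq> B"
        "openin T N" "f \<in> N"
        and conf: "\<forall>g\<in>N. \<forall>\<alpha>. deck g \<alpha> \<longrightarrow> (\<exists>x'\<in>C. \<alpha> x' \<in> D) \<longrightarrow> \<alpha> ` C \<subseteq> D"
        by (rule deck_confined[OF f fxy B(1) xB B(1,2)])
      have "(u, v) \<in> \<Gamma>" if uv: "(u, v) \<in> partners f" "u \<in> C" "v \<in> D" for u v
      proof (cases "u \<in> S")
        case True
        have "two_sheeted S B f" "f u = f v" using B uv unfolding partners_def by auto
        then have "u = v" using two_sheeted_branch[of S B f u v] True uv C closure_subset[of D] by auto
        then show ?thesis using diag True by simp
      next
        case False
        show ?thesis
        proof (rule fill[OF xy C(1,2,4,5,7,8) conf uv(2) False])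
          fix z assume z: "z \<in> closure D" "f z = f u"
          have "f v = f u" "v \<noteq> u" using uv False unfolding partners_def by auto
          moreover have "z \<in> B" "v \<in> B" "u \<in> B" using C uv closure_subset[of D] z by auto
          moreover have "two_sheeted S B f" using B by blast
          ultimately show "z = v \<or> z = u" using two_sheeted_unique[of S B f u z v] z by blast
        qed
      qed
      then have "partners f \<inter> (C \<times> D) \<subseteq> \<Gamma>" by auto
      moreover have "open (C \<times> D)" using C by (intro open_Times)
      ultimately show ?thesis using C by blast
    qed
  qed
  \<comment> \<open>The union of all boxes provided by \<open>loc\<close> exhibits
    \<open>\<Gamma>\<close> as relatively open among the partners.\<close>
  define O' where "O' = \<Union>{B. open B \<and> partners f \<inter> B \<subseteq> \<Gamma>}"
  have "open O'" unfolding O'_def by blast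
  moreover have "\<Gamma> = partners f \<inter> O'" unfolding O'_def using loc sub by fast
  ultimately show ?thesis using deck_if_clopen_sheet[OF f sub cl _ _ sym diag bad] by blast
qed

lemma deck_clopen:
  "openin T {f \<in> topspace T. \<exists>\<alpha>. deck f \<alpha>}" "closedin T {f \<in> topspace T. \<exists>\<alpha>. deck f \<alpha>}"
proof -
  let ?A = "{f \<in> topspace T. \<exists>\<alpha>. deck f \<alpha>}"
  show "openin T ?A"
  proof (subst openin_subopen, intro ballI)
    fix f assume "f \<in> ?A"
    then obtain \<alpha> where "f \<in> topspace T" "deck f \<alpha>" by blast
    from deck_near[OF this] obtain N where N: "openin T N" "f \<in> N" "\<forall>h\<in>N. \<exists>\<beta>. deck h \<beta>" by blast
    then show "\<exists>N. openin T N \<and> f \<in> N \<and> N \<subseteq> ?A" using openin_subset[OF N(1)] by blast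
  qed
  have "openin T (topspace T - ?A)"
  proof (subst openin_subopen, intro ballI)
    fix f assume f: "f \<in> topspace T - ?A"
    then have "f \<in> topspace T" "\<not> (\<exists>\<alpha>. deck f \<alpha>)" by auto
    then obtain N where N: "openin T N" "f \<in> N" "\<not> (\<exists>g\<in>N. \<exists>\<alpha>. deck g \<alpha>)"
      using deck_limit[of f] by blast
    then show "\<exists>N. openin T N \<and> f \<in> N \<and> N \<subseteq> topspace T - ?A" using openin_subset[OF N(1)] by blast
  qed
  then show "closedin T ?A" by (simp add: closedin_def) 
qed

end

section \<open>The space of \<open>S\<close>-immersions\<close>

locale s_immersions =
  fixes V :: "('a::{t2_space,second_countable_topology}, 'n::finite) atlas"
    and W :: "('b::{t2_space,second_countable_topology}, 'n) atlas"
    and S :: "'a set"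
  assumes V: "smooth_manifold V" and W: "smooth_manifold W"
begin

abbreviation "M \<equiv> S_immersions V W S"
abbreviation "T \<equiv> S_immersion_space V W S"

lemma immersion:
  assumes "f \<in> M"
  shows "smooth_map V W f" "continuous_on UNIV f" "singular_set V W f = S" "\<And>p. p \<in> S \<Longrightarrow> fold_point V W f p"
  using assms unfolding S_immersions_def smooth_map_def by auto

lemma open_domain:
  assumes f: "continuous_on UNIV f" and c: "(U, \<phi>) \<in> charts V" and c': "(U', \<psi>) \<in> charts A"
  shows "open (U \<inter> f -` U')" "open (\<phi> ` (U \<inter> f -` U'))"
proof -
  show *: "open (U \<inter> f -` U')"
    using open_vimage[OF chartsD(1)[OF c'] f] chartsD(1)[OF c] by blast
  show "open (\<phi> ` (U \<inter> f -` U'))" by (rule open_chart_image[OF c *]) blast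
qed

lemma smooth_local_expr:
  assumes f: "f \<in> M" and c: "(U, \<phi>) \<in> charts V" and c': "(U', \<psi>) \<in> charts W"
  shows "smooth_on (\<phi> ` (U \<inter> f -` U')) (local_expr U \<phi> \<psi> f)"
  using immersion(1)[OF f] c c' unfolding smooth_map_def by blast

lemma local_expr_apply:
  assumes "(U, \<phi>) \<in> charts V" "u \<in> U"
  shows "local_expr U \<phi> \<psi> f (\<phi> u) = \<psi> (f u)"
  using chartsD(6)[OF assms] by (simp add: local_expr_def)

text \<open>A basic neighbourhood with empty \<open>K\<close> imposes no condition beyond
  smoothness. The point \<open>undefined\<close> merely provides some chart in source and
  target.\<close>

lemma topspace_S_immersions: "topspace T = M"
proof -
  obtain U and \<phi> :: "'a \<Rightarrow> real ^ 'n" where c: "(U, \<phi>) \<in> V" "(U, \<phi>) \<in> charts V" "undefined \<in> U"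
    by (rule atlas_chart_at[OF V])
  obtain U' and \<psi> :: "'b \<Rightarrow> real ^ 'n" where c': "(U', \<psi>) \<in> W" "(U', \<psi>) \<in> charts W" "undefined \<in> U'"
    by (rule atlas_chart_at[OF W])
  have "f \<in> topspace (Cinf_topology V W)" if "f \<in> M" for f
  proof -
    have sm: "smooth_map V W f" using immersion(1)[OF that] .
    have "f \<in> Cinf_nbhd V W f 0 U \<phi> U' \<psi> {} 1" unfolding Cinf_nbhd_def using sm by simp
    moreover have "openin (Cinf_topology V W) (Cinf_nbhd V W f 0 U \<phi> U' \<psi> {} 1)"
      unfolding Cinf_topology_def
    proof (rule topology_generated_by_Basis, rule CollectI, intro exI conjI)
      show "smooth_map V W f" by (rule sm)
      show "(U, \<phi>) \<in> charts V" by (rule c(2))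
      show "(U', \<psi>) \<in> charts W" by (rule c'(2))
      show "(1::real) > 0" by simp
    qed auto
    ultimately show ?thesis using openin_subset by blast
  qed
  then show ?thesis unfolding S_immersion_space_def topspace_subtopology by blast
qed

lemma Cinf_nbhd:
  assumes f: "f \<in> M" and c: "(U, \<phi>) \<in> charts V" and c': "(U', \<psi>) \<in> charts W"
    and K: "compact K" "K \<subseteq> U" "f ` K \<subseteq> U'" and e: "\<epsilon> > 0"
  shows "\<exists>N. openin T N \<and> f \<in> N \<and> (\<forall>g\<in>N. g \<in> M \<and> g ` K \<subseteq> U' \<and>
     (\<forall>x\<in>K. \<forall>vs. set vs \<subseteq> Basis \<and> length vs \<le> r \<longrightarrow>
            norm (iter_deriv vs (local_expr U \<phi> \<psi> g) (\<phi> x) -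
                  iter_deriv vs (local_expr U \<phi> \<psi> f) (\<phi> x)) < \<epsilon>))"
proof -
  let ?B = "Cinf_nbhd V W f r U \<phi> U' \<psi> K \<epsilon>"
  have sm: "smooth_map V W f" using immersion(1)[OF f] .
  have "openin (Cinf_topology V W) ?B"
    unfolding Cinf_topology_def
  proof (rule topology_generated_by_Basis, rule CollectI, intro exI conjI)
    show "smooth_map V W f" by (rule sm)
    show "(U, \<phi>) \<in> charts V" by (rule c)
    show "(U', \<psi>) \<in> charts W" by (rule c')
  qed (use K e in auto)
  then have "openin T (M \<inter> ?B)"
    unfolding S_immersion_space_def by (rule openin_subtopology_Int2)
  moreover have "f \<in> M \<inter> ?B" using f sm K(3) e unfolding Cinf_nbhd_def by simp
  ultimately show ?thesis unfolding Cinf_nbhd_def by (intro exI[of _ "M \<inter> ?B"]) (simp add: Cinf_nbhd_def)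
qed

section \<open>Uniform neighbourhoods in charts\<close>

lemma compact_chart_preimage:
  assumes c: "(U, \<phi>) \<in> charts V" and K: "compact K" "K \<subseteq> \<phi> ` U"
  shows "compact (inv_into U \<phi> ` K)" "inv_into U \<phi> ` K \<subseteq> U"
    "\<And>u. u \<in> U \<Longrightarrow> \<phi> u \<in> K \<Longrightarrow> u \<in> inv_into U \<phi> ` K"
proof -
  show "compact (inv_into U \<phi> ` K)"
    by (rule compact_continuous_image[OF continuous_on_subset[OF chartsD(5)[OF c] K(2)] K(1)])
  show "inv_into U \<phi> ` K \<subseteq> U" using chartsD(8)[OF c] K(2) by auto
  show "u \<in> inv_into U \<phi> ` K" if "u \<in> U" "\<phi> u \<in> K" for u
    using chartsD(6)[OF c that(1)] that(2) by (metis imageI)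
qed

lemma chart_cball:
  assumes c: "(U, \<phi>) \<in> charts V" and Y: "open Y" "u \<in> U" "u \<in> Y"
  shows "\<exists>r>0. cball (\<phi> u) r \<subseteq> \<phi> ` (U \<inter> Y)"
proof -
  have "open (\<phi> ` (U \<inter> Y))" by (rule open_chart_image[OF c]) (use chartsD(1)[OF c] Y in auto)
  moreover have "\<phi> u \<in> \<phi> ` (U \<inter> Y)" using Y by blast
  ultimately show ?thesis unfolding open_contains_cball by (rule bspec)
qed

lemma compact_open_nbhd:
  assumes f: "f \<in> M" and X: "open X" "f x \<in> X"
  shows "\<exists>B N. open B \<and> x \<in> B \<and> openin T N \<and> f \<in> N \<and> (\<forall>h\<in>N. h ` B \<subseteq> X)"
proof -
  obtain U and \<phi> :: "'a \<Rightarrow> real ^ 'n" where c: "(U, \<phi>) \<in> V" "(U, \<phi>) \<in> charts V" "x \<in> U"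
    by (rule atlas_chart_at[OF V])
  obtain U' and \<psi> :: "'b \<Rightarrow> real ^ 'n" where c': "(U', \<psi>) \<in> W" "(U', \<psi>) \<in> charts W" "f x \<in> U'"
    by (rule atlas_chart_at[OF W])
  have "open (\<psi> ` (U' \<inter> X))" by (rule open_chart_image[OF c'(2)]) (use chartsD(1)[OF c'(2)] X in auto)
  moreover have "\<psi> (f x) \<in> \<psi> ` (U' \<inter> X)" using c' X by blast
  ultimately obtain e where e: "e > 0" "ball (\<psi> (f x)) e \<subseteq> \<psi> ` (U' \<inter> X)"
    unfolding open_contains_ball by blast
  \<comment> \<open>Half of \<open>e\<close> is spent on the variation of \<open>f\<close> near
    \<open>x\<close>, the other half on replacing \<open>f\<close> by a nearby map.\<close>
  let ?Y = "f -` (U' \<inter> \<psi> -` ball (\<psi> (f x)) (e / 2))"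
  have "open ?Y" by (intro open_vimage open_chart_preimage[OF c'(2)] immersion(2)[OF f]) simp
  moreover have "x \<in> ?Y" using c' e by simp
  ultimately obtain r where r: "r > 0" "cball (\<phi> x) r \<subseteq> \<phi> ` (U \<inter> ?Y)"
    using chart_cball[OF c(2) _ c(3)] by blast
  let ?K = "inv_into U \<phi> ` cball (\<phi> x) r"
  have rU: "cball (\<phi> x) r \<subseteq> \<phi> ` U" using r(2) by blast
  note K = compact_chart_preimage[OF c(2) compact_cball rU]
  have KY: "?K \<subseteq> ?Y"
  proof
    fix y assume "y \<in> ?K"
    then obtain z where z: "z \<in> cball (\<phi> x) r" "y = inv_into U \<phi> z" by blast
    then obtain w where "w \<in> U \<inter> ?Y" "z = \<phi> w" using r(2) by blast
    then show "y \<in> ?Y" using z chartsD(6)[OF c(2), of w] by simp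
  qed
  then have fK: "f ` ?K \<subseteq> U'" by blast
  have "e / 2 > 0" using e by simp
  from Cinf_nbhd[OF f c(2) c'(2) K(1,2) fK this, of 0]
  obtain N where N: "openin T N" "f \<in> N" "\<forall>g\<in>N. g \<in> M \<and> g ` ?K \<subseteq> U' \<and>
     (\<forall>x\<in>?K. \<forall>vs. set vs \<subseteq> Basis \<and> length vs \<le> 0 \<longrightarrow>
            norm (iter_deriv vs (local_expr U \<phi> \<psi> g) (\<phi> x) -
                  iter_deriv vs (local_expr U \<phi> \<psi> f) (\<phi> x)) < e / 2)" by blast
  let ?B = "U \<inter> \<phi> -` ball (\<phi> x) r"
  have "h y \<in> X" if h: "h \<in> N" and y: "y \<in> ?B" for h y
  proof -
    have yK: "y \<in> ?K" using y by (intro K(3)) auto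
    have yU: "y \<in> U" using y by blast
    have N': "h ` ?K \<subseteq> U'" "(\<forall>x\<in>?K. \<forall>vs. set vs \<subseteq> Basis \<and> length vs \<le> 0 \<longrightarrow>
            norm (iter_deriv vs (local_expr U \<phi> \<psi> h) (\<phi> x) -
                  iter_deriv vs (local_expr U \<phi> \<psi> f) (\<phi> x)) < e / 2)" using N(3) h by blast+
    have "norm (\<psi> (h y) - \<psi> (f y)) < e / 2"
      using bspec[OF N'(2) yK, THEN spec, of "[]"] by (simp add: local_expr_apply[OF c(2) yU])
    moreover have "dist (\<psi> (f x)) (\<psi> (f y)) < e / 2" using subsetD[OF KY yK] by simp
    ultimately have "dist (\<psi> (f x)) (\<psi> (h y)) < e"
      using dist_triangle[of "\<psi> (f x)" "\<psi> (h y)" "\<psi> (f y)"] by (simp add: dist_norm norm_minus_commute)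
    then have "\<psi> (h y) \<in> \<psi> ` (U' \<inter> X)" using e(2) by auto
    then obtain w where w: "w \<in> U' \<inter> X" "\<psi> (h y) = \<psi> w" by blast
    \<comment> \<open>The values of \<open>\<psi>\<close> outside \<open>U'\<close> are arbitrary,
      so membership in \<open>U'\<close> has to be known before \<open>\<psi>\<close> can identify
      \<open>h y\<close> with \<open>w\<close>.\<close>
    have "h y \<in> U'" using N'(1) yK by blast
    then have "h y = w" using inj_onD[OF chartsD(3)[OF c'(2)] w(2)] w(1) by blast
    then show ?thesis using w(1) by blast
  qed
  then have "\<forall>h\<in>N. h ` ?B \<subseteq> X" by blast
  moreover have "open ?B" by (rule open_chart_preimage[OF c(2)]) simp
  moreover have "x \<in> ?B" using c(3) r(1) by simp
  ultimately show ?thesis using N(1,2) by (intro exI[of _ ?B] exI[of _ N] conjI)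
qed

text \<open>Closeness of first derivatives on a closed coordinate ball suffices: half of the
  tolerance of \<open>inj_on_near_linear\<close> covers the variation of the derivative of
  \<open>f\<close>, half the passage from \<open>f\<close> to \<open>h\<close>.\<close>

lemma nonsingular_nbhd:
  assumes f: "f \<in> M" and c: "(U, \<phi>) \<in> charts V" and c': "(U', \<psi>) \<in> charts W"
    and p: "p \<in> U" "f p \<in> U'" and inj: "inj (frechet_derivative (local_expr U \<phi> \<psi> f) (at (\<phi> p)))"
  shows "\<exists>B N. open B \<and> p \<in> B \<and> openin T N \<and> f \<in> N \<and> (\<forall>h\<in>N. inj_on h B)"
proof -
  let ?F = "local_expr U \<phi> \<psi> f"
  let ?L = "frechet_derivative ?F (at (\<phi> p))"
  let ?Y = "\<phi> ` (U \<inter> f -` U')"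
  have smF: "smooth_on ?Y ?F" by (rule smooth_local_expr[OF f c c'])
  have oY: "open ?Y" by (rule open_domain[OF immersion(2)[OF f] c c'])
  have pY: "\<phi> p \<in> ?Y" using p by blast
  have "?F differentiable (at (\<phi> p))" using smooth_on_differentiable[OF smF pY, of "[]"] by simp
  then have lin: "linear ?L" by (rule linear_frechet_derivative)
  obtain e where e: "e > 0" "\<forall>H C. convex C \<longrightarrow> (\<forall>x\<in>C. H differentiable (at x)) \<longrightarrow>
    (\<forall>x\<in>C. \<forall>b\<in>Basis. norm (frechet_derivative H (at x) b - ?L b) \<le> e) \<longrightarrow> inj_on H C"
    using inj_on_near_linear[OF lin inj] by (elim exE conjE) (rule that)
  then have e2: "e / 2 > 0" by simp
  obtain r where r: "r > 0" "cball (\<phi> p) r \<subseteq> ?Y" "\<forall>z\<in>cball (\<phi> p) r. \<forall>b\<in>Basis.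
    norm (frechet_derivative ?F (at z) b - ?L b) < e / 2"
    using smooth_partials_near[OF smF oY pY e2] by (elim exE conjE) (rule that)
  let ?K = "inv_into U \<phi> ` cball (\<phi> p) r"
  have rU: "cball (\<phi> p) r \<subseteq> \<phi> ` U" using r(2) by blast
  note K = compact_chart_preimage[OF c compact_cball rU]
  have fK: "f ` ?K \<subseteq> U'"
  proof clarify
    fix z assume "z \<in> cball (\<phi> p) r"
    then obtain w where "w \<in> U \<inter> f -` U'" "z = \<phi> w" using r(2) by blast
    then show "f (inv_into U \<phi> z) \<in> U'" using chartsD(6)[OF c, of w] by simp
  qed
  from Cinf_nbhd[OF f c c' K(1,2) fK e2, of 1]
  obtain N where N: "openin T N" "f \<in> N" "\<forall>g\<in>N. g \<in> M \<and> g ` ?K \<subseteq> U' \<and>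
     (\<forall>x\<in>?K. \<forall>vs. set vs \<subseteq> Basis \<and> length vs \<le> 1 \<longrightarrow>
            norm (iter_deriv vs (local_expr U \<phi> \<psi> g) (\<phi> x) -
                  iter_deriv vs ?F (\<phi> x)) < e / 2)" by blast
  let ?B = "U \<inter> \<phi> -` ball (\<phi> p) r"
  have "inj_on h ?B" if h: "h \<in> N" for h
  proof -
    let ?H = "local_expr U \<phi> \<psi> h"
    have hM: "h \<in> M" and hK: "h ` ?K \<subseteq> U'" and near: "\<forall>x\<in>?K. \<forall>vs. set vs \<subseteq> Basis \<and> length vs \<le> 1 \<longrightarrow>
            norm (iter_deriv vs ?H (\<phi> x) - iter_deriv vs ?F (\<phi> x)) < e / 2" using N(3) h by blast+
    have smH: "smooth_on (\<phi> ` (U \<inter> h -` U')) ?H" by (rule smooth_local_expr[OF hM c c'])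
    have zK: "inv_into U \<phi> z \<in> ?K" "\<phi> (inv_into U \<phi> z) = z" "inv_into U \<phi> z \<in> U" if "z \<in> cball (\<phi> p) r" for z
      using that chartsD(7,8)[OF c] rU by blast+
    have sub: "z \<in> \<phi> ` (U \<inter> h -` U')" if z: "z \<in> cball (\<phi> p) r" for z
      using zK[OF z] hK by (metis IntI imageI subsetD vimageI2)
    have "inj_on ?H (cball (\<phi> p) r)"
    proof (rule e(2)[rule_format])
      show "?H differentiable (at z)" if "z \<in> cball (\<phi> p) r" for z
        using smooth_on_differentiable[OF smH sub[OF that], of "[]"] by simp
      show "norm (frechet_derivative ?H (at z) b - ?L b) \<le> e" if z: "z \<in> cball (\<phi> p) r" and b: "b \<in> Basis" for z b
      proof -
        have "norm (frechet_derivative ?H (at z) b - frechet_derivative ?F (at z) b) < e / 2"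
          using bspec[OF near zK(1)[OF z], THEN spec, of "[b]"] b zK(2)[OF z] by simp
        moreover have "norm (frechet_derivative ?F (at z) b - ?L b) < e / 2" using r(3) z b by blast
        ultimately show ?thesis
          using norm_triangle_ineq[of "frechet_derivative ?H (at z) b - frechet_derivative ?F (at z) b"
              "frechet_derivative ?F (at z) b - ?L b"] by simp
      qed
    qed simp
    note injH = this
    show ?thesis
    proof (rule inj_onI)
      fix x y assume xy: "x \<in> ?B" "y \<in> ?B" "h x = h y"
      have "?H (\<phi> x) = ?H (\<phi> y)"
        using local_expr_apply[OF c, of x \<psi> h] local_expr_apply[OF c, of y \<psi> h] xy by simp
      then have "\<phi> x = \<phi> y" by (rule inj_onD[OF injH]) (use xy in auto)
      then show "x = y" by (rule inj_onD[OF chartsD(3)[OF c]]) (use xy in auto)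
    qed
  qed
  moreover have "open ?B" by (rule open_chart_preimage[OF c]) simp
  moreover have "p \<in> ?B" using p(1) r(1) by simp
  ultimately show ?thesis using N(1,2) by (intro exI[of _ ?B] exI[of _ N] conjI ballI)
qed

text \<open>\<open>singular_set\<close> asks for a rank defect in some pair of charts, so a point
  outside it has full rank in every pair.\<close>

lemma nonsingular_derivative:
  assumes f: "f \<in> M" and c: "(U, \<phi>) \<in> charts V" and c': "(U', \<psi>) \<in> charts W"
    and p: "p \<in> U" "f p \<in> U'" "p \<notin> S"
  shows "inj (frechet_derivative (local_expr U \<phi> \<psi> f) (at (\<phi> p)))"
proof -
  let ?F = "local_expr U \<phi> \<psi> f"
  have "\<phi> p \<in> \<phi> ` (U \<inter> f -` U')" using p by blast
  then have "?F differentiable (at (\<phi> p))"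
    using smooth_on_differentiable[OF smooth_local_expr[OF f c c'], of "\<phi> p" "[]"] by simp
  then have lin: "linear (frechet_derivative ?F (at (\<phi> p)))" by (rule linear_frechet_derivative)
  have "\<not> rank (jacobian ?F (at (\<phi> p))) < CARD('n)"
  proof
    assume "rank (jacobian ?F (at (\<phi> p))) < CARD('n)"
    then have "p \<in> singular_set V W f" unfolding singular_set_def using c c' p by blast
    then show False using immersion(3)[OF f] p(3) by simp
  qed
  then have "rank (jacobian ?F (at (\<phi> p))) = CARD('n)"
    using rank_bound[of "jacobian ?F (at (\<phi> p))"] by simp
  then have "inj ((*v) (matrix (frechet_derivative ?F (at (\<phi> p)))))"
    by (simp add: full_rank_injective jacobian_def)
  then show ?thesis using lin by (simp add: matrix_works inj_def)
qed

lemma regular_nbhd: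
  assumes f: "f \<in> M" and p: "p \<notin> S"
  shows "\<exists>B N. open B \<and> p \<in> B \<and> openin T N \<and> f \<in> N \<and> (\<forall>h\<in>N. inj_on h B)"
proof -
  obtain U and \<phi> :: "'a \<Rightarrow> real ^ 'n" where c: "(U, \<phi>) \<in> V" "(U, \<phi>) \<in> charts V" "p \<in> U"
    by (rule atlas_chart_at[OF V])
  obtain U' and \<psi> :: "'b \<Rightarrow> real ^ 'n" where c': "(U', \<psi>) \<in> W" "(U', \<psi>) \<in> charts W" "f p \<in> U'"
    by (rule atlas_chart_at[OF W])
  show ?thesis
    by (rule nonsingular_nbhd[OF f c(2) c'(2) c(3) c'(3) nonsingular_derivative[OF f c(2) c'(2) c(3) c'(3) p]])
qed

section \<open>Fold charts and nearby maps at the fold\<close>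

definition fold_chart :: "('a \<Rightarrow> 'b) \<Rightarrow> 'a set \<Rightarrow> ('a \<Rightarrow> real ^ 'n) \<Rightarrow> 'b set \<Rightarrow> ('b \<Rightarrow> real ^ 'n) \<Rightarrow> 'n \<Rightarrow> bool" where
  "fold_chart f U \<phi> U' \<psi> k \<longleftrightarrow> (U, \<phi>) \<in> charts V \<and> (U', \<psi>) \<in> charts W \<and> f ` U \<subseteq> U' \<and>
     (\<forall>u\<in>U. \<psi> (f u) = fold_model k (\<phi> u))"

lemma fold_chartD:
  assumes "fold_chart f U \<phi> U' \<psi> k"
  shows "(U, \<phi>) \<in> charts V" "(U', \<psi>) \<in> charts W" "\<And>u. u \<in> U \<Longrightarrow> f u \<in> U'"
    "\<And>u. u \<in> U \<Longrightarrow> \<psi> (f u) = fold_model k (\<phi> u)"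
    "\<And>u w. u \<in> U \<Longrightarrow> w \<in> U \<Longrightarrow> f u = f w \<longleftrightarrow> fold_model k (\<phi> u) = fold_model k (\<phi> w)"
proof -
  show 1: "(U, \<phi>) \<in> charts V" "(U', \<psi>) \<in> charts W" "\<And>u. u \<in> U \<Longrightarrow> f u \<in> U'"
    "\<And>u. u \<in> U \<Longrightarrow> \<psi> (f u) = fold_model k (\<phi> u)"
    using assms unfolding fold_chart_def by blast+
  show "f u = f w \<longleftrightarrow> fold_model k (\<phi> u) = fold_model k (\<phi> w)" if "u \<in> U" "w \<in> U" for u w
    using 1(4)[OF that(1)] 1(4)[OF that(2)] 1(3)[OF that(1)] 1(3)[OF that(2)]
      inj_on_eq_iff[OF chartsD(3)[OF 1(2)], of "f u" "f w"] by simp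
qed

lemma fold_chart_at:
  assumes f: "f \<in> M" and s: "s \<in> S"
  obtains U \<phi> U' \<psi> k where "fold_chart f U \<phi> U' \<psi> k" "s \<in> U" "\<phi> s = 0"
  using immersion(4)[OF f s] that unfolding fold_point_def fold_chart_def by blast

text \<open>Mirror points across the hyperplane have equal values and occur arbitrarily close to
  \<open>u\<close>. \<open>fold_chart\<close> omits the centring at a base point, so
  \<open>u\<close> may be anywhere on the hyperplane.\<close>

lemma fold_chart_not_inj:
  assumes fc: "fold_chart f U \<phi> U' \<psi> k" and u: "u \<in> U" "\<phi> u $ k = 0" and B: "open B" "u \<in> B"
  shows "\<not> inj_on f B"
proof
  assume inj: "inj_on f B"
  note fc' = fold_chartD[OF fc]
  obtain r where r: "r > 0" "cball (\<phi> u) r \<subseteq> \<phi> ` (U \<inter> B)"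
    using chart_cball[OF fc'(1) B(1) u(1) B(2)] by blast
  let ?y = "\<phi> u + r *\<^sub>R axis k 1" and ?z = "\<phi> u - r *\<^sub>R axis k 1"
  have "norm (r *\<^sub>R axis k 1 :: real ^ 'n) = r" using r(1) by simp
  then have "?y \<in> cball (\<phi> u) r" "?z \<in> cball (\<phi> u) r" by (simp_all add: dist_norm)
  then obtain y z where yz: "y \<in> U \<inter> B" "?y = \<phi> y" "z \<in> U \<inter> B" "?z = \<phi> z" using r(2) by blast
  have "?z = reflect k ?y" using u(2) by (simp add: vec_eq_iff reflect_nth axis_def)
  then have "fold_model k (\<phi> z) = fold_model k (\<phi> y)" using yz fold_model_reflect by metis
  then have "f y = f z" using fc'(5)[of y z] yz by simp
  then have "y = z" using inj_onD[OF inj] yz by blast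
  then have "?y $ k = ?z $ k" using yz by simp
  then show False using r(1) by (simp add: axis_def)
qed

text \<open>\<open>S\<close> is the set of points where \<open>f\<close> is not locally injective, which avoids any comparison of
  ranks in different charts.\<close>

lemma fold_chart_S:
  assumes f: "f \<in> M" and fc: "fold_chart f U \<phi> U' \<psi> k" and u: "u \<in> U"
  shows "u \<in> S \<longleftrightarrow> \<phi> u $ k = 0"
proof
  assume uS: "u \<in> S"
  show "\<phi> u $ k = 0"
  proof (rule ccontr)
    assume nz: "\<phi> u $ k \<noteq> 0"
    note fc' = fold_chartD[OF fc]
    let ?B = "U \<inter> \<phi> -` {z. z $ k * \<phi> u $ k > 0}"
    have "open {z :: real ^ 'n. z $ k * \<phi> u $ k > 0}"
      by (intro open_Collect_less continuous_intros)
    then have "open ?B" by (rule open_chart_preimage[OF fc'(1)])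
    moreover have "u \<in> ?B" using u nz by (auto simp: zero_less_mult_iff)
    moreover have "inj_on f ?B"
    proof (rule inj_onI)
      fix y z assume yz: "y \<in> ?B" "z \<in> ?B" "f y = f z"
      then have "fold_model k (\<phi> y) = fold_model k (\<phi> z)" using fc'(5)[of y z] by simp
      then have "\<phi> y = \<phi> z \<or> \<phi> y = reflect k (\<phi> z)" by (rule fold_model_eq_cases)
      moreover have "\<phi> y \<noteq> reflect k (\<phi> z)"
      proof
        assume "\<phi> y = reflect k (\<phi> z)"
        then have "\<phi> y $ k = - \<phi> z $ k" by (simp add: reflect_nth)
        then show False using yz by simp
      qed
      ultimately show "y = z" using inj_onD[OF chartsD(3)[OF fc'(1)], of y z] yz by blast
    qed
    moreover obtain U1 \<phi>1 U1' \<psi>1 k1 where "fold_chart f U1 \<phi>1 U1' \<psi>1 k1" "u \<in> U1" "\<phi>1 u = 0"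
      by (rule fold_chart_at[OF f uS])
    ultimately show False using fold_chart_not_inj[of f U1 \<phi>1 U1' \<psi>1 k1 u ?B] by simp
  qed
next
  assume k0: "\<phi> u $ k = 0"
  show "u \<in> S"
  proof (rule ccontr)
    assume "u \<notin> S"
    from regular_nbhd[OF f this] obtain B N where "open B" "u \<in> B" "f \<in> N" "\<forall>h\<in>N. inj_on h B" by blast
    then show False using fold_chart_not_inj[OF fc u k0, of B] by blast
  qed
qed

lemma not_locally_inj:
  assumes f: "f \<in> M" and s: "s \<in> S" and B: "open B" "s \<in> B"
  shows "\<not> inj_on f B"
proof -
  obtain U \<phi> U' \<psi> k where fc: "fold_chart f U \<phi> U' \<psi> k" "s \<in> U" "\<phi> s = 0"
    by (rule fold_chart_at[OF f s])
  then show ?thesis using fold_chart_not_inj[OF fc(1,2) _ B] by simp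
qed

text \<open>By \<open>fold_separation\<close>, two points of the ball with equal values under a
  nearby map lie strictly on opposite sides of the hyperplane. Both clauses of
  \<open>two_sheeted\<close> are consequences for signs.\<close>

lemma singular_nbhd:
  assumes f: "f \<in> M" and s: "s \<in> S"
  shows "\<exists>B N. open B \<and> s \<in> B \<and> openin T N \<and> f \<in> N \<and> (\<forall>h\<in>N. two_sheeted S B h)"
proof -
  obtain U \<phi> U' \<psi> k where fc: "fold_chart f U \<phi> U' \<psi> k" and sU: "s \<in> U" and s0: "\<phi> s = 0"
    by (rule fold_chart_at[OF f s])
  note fc' = fold_chartD[OF fc]
  note c = fc'(1) and c' = fc'(2)
  obtain r0 where r0: "r0 > 0" "cball (\<phi> s) r0 \<subseteq> \<phi> ` (U \<inter> UNIV)"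
    using chart_cball[OF c open_UNIV sU UNIV_I] by blast
  \<comment> \<open>\<open>fold_separation\<close> needs control on a ball three times as large as
    the one it makes a statement about.\<close>
  define r where "r = r0 / 3"
  have r: "r > 0" "cball 0 (3 * r) \<subseteq> \<phi> ` U" using r0 s0 unfolding r_def by simp_all
  define n where "n = real CARD('n)"
  \<comment> \<open>Chosen so that the smallness condition of \<open>fold_separation\<close> holds
    with equality.\<close>
  define e where "e = 1 / (8 * (n * n))"
  have n0: "n > 0" unfolding n_def by simp
  have e: "e > 0" "8 * (n * (n * e)) \<le> 1" unfolding e_def using n0 by simp_all
  let ?K = "inv_into U \<phi> ` cball 0 (3 * r)"
  note K = compact_chart_preimage[OF c compact_cball r(2)]
  have fK: "f ` ?K \<subseteq> U'" using fc'(3) K(2) by blast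
  let ?F = "local_expr U \<phi> \<psi> f"
  \<comment> \<open>Order 2, because the convexity along the chord is read off from second
    derivatives.\<close>
  from Cinf_nbhd[OF f c c' K(1,2) fK e(1), of 2]
  obtain N where N: "openin T N" "f \<in> N" "\<forall>g\<in>N. g \<in> M \<and> g ` ?K \<subseteq> U' \<and>
     (\<forall>x\<in>?K. \<forall>vs. set vs \<subseteq> Basis \<and> length vs \<le> 2 \<longrightarrow>
            norm (iter_deriv vs (local_expr U \<phi> \<psi> g) (\<phi> x) - iter_deriv vs ?F (\<phi> x)) < e)" by blast
  have zK: "inv_into U \<phi> z \<in> ?K" "\<phi> (inv_into U \<phi> z) = z" "inv_into U \<phi> z \<in> U" if "z \<in> cball 0 (3 * r)" for z
    using that chartsD(7,8)[OF c] r(2) by blast+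
  have F_model: "iter_deriv vs ?F z = iter_deriv vs (fold_model k) z" if "z \<in> cball 0 (3 * r)" for vs z
  proof (rule iter_deriv_cong[OF chartsD(2)[OF c]])
    show "z \<in> \<phi> ` U" using that r(2) by blast
    fix x assume "x \<in> \<phi> ` U"
    then obtain w where "w \<in> U" "x = \<phi> w" by blast
    then show "?F x = fold_model k x" using local_expr_apply[OF c, of w \<psi> f] fc'(4)[of w] by simp
  qed
  let ?B = "U \<inter> \<phi> -` ball 0 r"
  have opposite: "\<phi> x $ k * \<phi> y $ k < 0"
    if h: "h \<in> N" and xy: "x \<in> ?B" "y \<in> ?B" "h x = h y" "x \<noteq> y" for h x y
  proof -
    let ?H = "local_expr U \<phi> \<psi> h"
    have hM: "h \<in> M" and hK: "h ` ?K \<subseteq> U'" and near: "\<forall>x\<in>?K. \<forall>vs. set vs \<subseteq> Basis \<and> length vs \<le> 2 \<longrightarrow>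
            norm (iter_deriv vs ?H (\<phi> x) - iter_deriv vs ?F (\<phi> x)) < e" using N(3) h by blast+
    let ?X = "\<phi> ` (U \<inter> h -` U')"
    have smH: "smooth_on ?X ?H" by (rule smooth_local_expr[OF hM c c'])
    have oX: "open ?X" by (rule open_domain[OF immersion(2)[OF hM] c c'])
    have hU: "h (inv_into U \<phi> z) \<in> U'" if z: "z \<in> cball 0 (3 * r)" for z
      using zK(1)[OF z] hK by blast
    have CX: "cball 0 (3 * r) \<subseteq> ?X"
    proof
      fix z :: "real ^ 'n" assume z: "z \<in> cball 0 (3 * r)"
      show "z \<in> ?X" using zK[OF z] hU[OF z] by (intro image_eqI[of _ _ "inv_into U \<phi> z"]) auto
    qed
    have near': "norm (iter_deriv vs ?H z - iter_deriv vs (fold_model k) z) \<le> e"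
      if "z \<in> cball 0 (3 * r)" "set vs \<subseteq> Basis" "length vs \<le> 2" for z vs
      using bspec[OF near zK(1)[OF that(1)], THEN spec, of vs] that(2,3) zK(2)[OF that(1)] F_model[OF that(1), of vs]
      by simp
    show ?thesis
    proof (rule fold_separation[OF smH oX CX])
      show "norm (frechet_derivative ?H (at x) b - frechet_derivative (fold_model k) (at x) b) \<le> e"
        if "x \<in> cball 0 (3 * r)" "b \<in> Basis" for x b
        using near'[OF that(1), of "[b]"] that(2) by simp
      show "norm (frechet_derivative (\<lambda>x. frechet_derivative ?H (at x) c) (at x) b
          - frechet_derivative (\<lambda>x. frechet_derivative (fold_model k) (at x) c) (at x) b) \<le> e"
        if "x \<in> cball 0 (3 * r)" "b \<in> Basis" "c \<in> Basis" for x b c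
        using near'[OF that(1), of "[b, c]"] that(2,3) by simp
      show "0 \<le> e" using e by simp
      show "8 * (real CARD('n) * (real CARD('n) * e)) \<le> 1" using e(2) unfolding n_def .
      \<comment> \<open>Here the common singular set enters: the fold chart of \<open>f\<close>
        places the point in \<open>S\<close>, the fold chart of \<open>h\<close> there excludes
        local injectivity, and an injective derivative would enforce it.\<close>
      show "\<not> inj (frechet_derivative ?H (at z))" if z: "z \<in> cball 0 (3 * r)" "z $ k = 0" for z
      proof
        assume inj: "inj (frechet_derivative ?H (at z))"
        let ?u = "inv_into U \<phi> z"
        have "inj (frechet_derivative ?H (at (\<phi> ?u)))" using inj zK(2)[OF z(1)] by simp
        from nonsingular_nbhd[OF hM c c' zK(3)[OF z(1)] hU[OF z(1)] this]
        obtain B N' where "open B" "?u \<in> B" "h \<in> N'" "\<forall>h\<in>N'. inj_on h B" by blast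
        moreover have "?u \<in> S" using fold_chart_S[OF f fc zK(3)[OF z(1)]] zK(2)[OF z(1)] z(2) by simp
        ultimately show False using not_locally_inj[OF hM, of ?u B] by blast
      qed
      show "\<phi> x \<in> cball 0 r" "\<phi> y \<in> cball 0 r" using xy by auto
      show "?H (\<phi> x) = ?H (\<phi> y)"
        using local_expr_apply[OF c, of x \<psi> h] local_expr_apply[OF c, of y \<psi> h] xy by simp
      show "\<phi> x \<noteq> \<phi> y" using inj_on_eq_iff[OF chartsD(3)[OF c], of x y] xy by simp
    qed
  qed
  have "two_sheeted S ?B h" if h: "h \<in> N" for h
    unfolding two_sheeted_def
  proof (intro conjI ballI impI)
    fix y z assume yz: "y \<in> ?B \<inter> S" "z \<in> ?B" "h y = h z"
    have "\<phi> y $ k = 0" using fold_chart_S[OF f fc, of y] yz by blast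
    then show "y = z" using opposite[OF h, of y z] yz by auto
  next
    fix w y z assume wyz: "w \<in> ?B" "y \<in> ?B" "z \<in> ?B" "h w = h y" "h y = h z"
    \<comment> \<open>Three nonzero reals cannot have pairwise opposite signs.\<close>
    show "w = y \<or> y = z \<or> w = z"
    proof (rule ccontr)
      assume "\<not> ?thesis"
      then have "\<phi> w $ k * \<phi> y $ k < 0" "\<phi> y $ k * \<phi> z $ k < 0" "\<phi> w $ k * \<phi> z $ k < 0"
        using opposite[OF h wyz(1,2,4)] opposite[OF h wyz(2,3,5)]
          opposite[OF h wyz(1,3) trans[OF wyz(4,5)]] by blast+
      then show False by (auto simp: mult_less_0_iff)
    qed
  qed
  moreover have "open ?B" by (rule open_chart_preimage[OF c]) simp
  moreover have "s \<in> ?B" using sU s0 r(1) by simp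
  ultimately show ?thesis using N(1,2) by (intro exI[of _ ?B] exI[of _ N] conjI ballI)
qed

section \<open>Local properties of a single \<open>S\<close>-immersion\<close>

lemma open_image_of_inj:
  assumes f: "f \<in> M" and B: "open B" "inj_on f B"
  shows "open (f ` B)"
proof (subst open_subopen, intro ballI)
  fix y assume "y \<in> f ` B"
  then obtain p where p: "p \<in> B" "y = f p" by blast
  obtain U and \<phi> :: "'a \<Rightarrow> real ^ 'n" where c0: "(U, \<phi>) \<in> V" and c: "(U, \<phi>) \<in> charts V" and pU: "p \<in> U"
    by (rule atlas_chart_at[OF V])
  obtain U' and \<psi> :: "'b \<Rightarrow> real ^ 'n" where c0': "(U', \<psi>) \<in> W" and c': "(U', \<psi>) \<in> charts W" and pU': "f p \<in> U'"
    by (rule atlas_chart_at[OF W])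
  let ?O = "U \<inter> f -` U' \<inter> B"
  have oO: "open ?O" using open_domain(1)[OF immersion(2)[OF f] c c'] B(1) by blast
  have ex: "local_expr U \<phi> \<psi> f (\<phi> u) = \<psi> (f u)" if "u \<in> ?O" for u
    using local_expr_apply[OF c, of u] that by blast
  have "open (local_expr U \<phi> \<psi> f ` \<phi> ` ?O)"
  proof (rule invariance_of_domain)
    show "open (\<phi> ` ?O)" by (rule open_chart_image[OF c oO]) blast
    show "continuous_on (\<phi> ` ?O) (local_expr U \<phi> \<psi> f)"
      by (rule continuous_on_subset[OF smooth_on_continuous[OF smooth_local_expr[OF f c c'], of "[]", simplified]]) blast
    show "inj_on (local_expr U \<phi> \<psi> f) (\<phi> ` ?O)"
    proof (rule inj_onI)
      fix a b assume "a \<in> \<phi> ` ?O" "b \<in> \<phi> ` ?O" and eq: "local_expr U \<phi> \<psi> f a = local_expr U \<phi> \<psi> f b"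
      then obtain u w where uw: "u \<in> ?O" "a = \<phi> u" "w \<in> ?O" "b = \<phi> w" by blast
      then have "\<psi> (f u) = \<psi> (f w)" using eq ex by simp
      then have "f u = f w" using inj_onD[OF chartsD(3)[OF c']] uw by blast
      then have "u = w" using inj_onD[OF B(2)] uw by blast
      then show "a = b" using uw by simp
    qed
  qed
  moreover have "local_expr U \<phi> \<psi> f ` \<phi> ` ?O = \<psi> ` f ` ?O"
    unfolding image_image by (rule image_cong[OF refl ex])
  ultimately have "open (U' \<inter> \<psi> -` (\<psi> ` f ` ?O))" using open_chart_preimage[OF c'] by simp
  moreover have "U' \<inter> \<psi> -` (\<psi> ` f ` ?O) = f ` ?O"
  proof (intro equalityI subsetI)
    fix w assume "w \<in> U' \<inter> \<psi> -` (\<psi> ` f ` ?O)"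
    then obtain u where u: "u \<in> ?O" "\<psi> w = \<psi> (f u)" "w \<in> U'" by blast
    then have "w = f u" using inj_onD[OF chartsD(3)[OF c'], of w "f u"] by blast
    then show "w \<in> f ` ?O" using u by blast
  qed blast
  ultimately have "open (f ` ?O)" by simp
  then show "\<exists>X. open X \<and> y \<in> X \<and> X \<subseteq> f ` B" using p pU pU' by (intro exI[of _ "f ` ?O"]) auto
qed

text \<open>The partner is the mirror image in the fold chart. Reflection preserves the norm, so it
  stays in the coordinate ball contained in \<open>Y\<close>.\<close>

lemma fold_partner:
  assumes f: "f \<in> M" and s: "s \<in> S" and Y: "open Y" "s \<in> Y"
  shows "\<exists>B. open B \<and> s \<in> B \<and> (\<forall>y\<in>B. \<exists>z\<in>Y. f z = f y \<and> (z = y \<longleftrightarrow> y \<in> S))"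
proof -
  obtain U \<phi> U' \<psi> k where fc: "fold_chart f U \<phi> U' \<psi> k" and sU: "s \<in> U" and s0: "\<phi> s = 0"
    by (rule fold_chart_at[OF f s])
  note fc' = fold_chartD[OF fc]
  note c = fc'(1)
  obtain r where r: "r > 0" "cball (\<phi> s) r \<subseteq> \<phi> ` (U \<inter> Y)"
    using chart_cball[OF c Y(1) sU Y(2)] by blast
  let ?B = "U \<inter> \<phi> -` ball 0 r"
  have "\<exists>z\<in>Y. f z = f y \<and> (z = y \<longleftrightarrow> y \<in> S)" if y: "y \<in> ?B" for y
  proof -
    have "reflect k (\<phi> y) \<in> cball (\<phi> s) r" using y s0 by (simp add: norm_reflect)
    then obtain z where z: "z \<in> U \<inter> Y" "reflect k (\<phi> y) = \<phi> z" using r(2) by blast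
    have "f z = f y" using fc'(5)[of z y] z y fold_model_reflect[of k "\<phi> y"] by simp
    moreover have "z = y \<longleftrightarrow> \<phi> z = \<phi> y" using inj_on_eq_iff[OF chartsD(3)[OF c], of z y] z y by blast
    moreover have "y \<in> S \<longleftrightarrow> \<phi> y $ k = 0" using fold_chart_S[OF f fc, of y] y by blast
    ultimately show ?thesis using z reflect_eq_iff[of k "\<phi> y"] by auto
  qed
  moreover have "open ?B" by (rule open_chart_preimage[OF c]) simp
  moreover have "s \<in> ?B" using sU s0 r(1) by simp
  ultimately show ?thesis by (intro exI[of _ ?B] conjI ballI)
qed

lemma connected_nbhd:
  assumes Y: "open Y" "x \<in> Y"
  shows "\<exists>C. open C \<and> connected C \<and> x \<in> C \<and> C \<subseteq> (Y :: 'a set)"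
proof -
  obtain U and \<phi> :: "'a \<Rightarrow> real ^ 'n" where c0: "(U, \<phi>) \<in> V" and c: "(U, \<phi>) \<in> charts V" and xU: "x \<in> U"
    by (rule atlas_chart_at[OF V])
  obtain r where r: "r > 0" "cball (\<phi> x) r \<subseteq> \<phi> ` (U \<inter> Y)"
    using chart_cball[OF c Y(1) xU Y(2)] by blast
  have bU: "ball (\<phi> x) r \<subseteq> \<phi> ` (U \<inter> Y)" using r(2) ball_subset_cball by blast
  let ?C = "inv_into U \<phi> ` ball (\<phi> x) r"
  have eq: "?C = U \<inter> \<phi> -` ball (\<phi> x) r"
  proof (intro equalityI subsetI)
    fix w assume "w \<in> ?C"
    then obtain z where z: "z \<in> ball (\<phi> x) r" "w = inv_into U \<phi> z" by blast
    then have "z \<in> \<phi> ` U" using bU by blast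
    then show "w \<in> U \<inter> \<phi> -` ball (\<phi> x) r" using z chartsD(7,8)[OF c, of z] by simp
  next
    fix w assume "w \<in> U \<inter> \<phi> -` ball (\<phi> x) r"
    then show "w \<in> ?C" using chartsD(6)[OF c, of w] by (intro image_eqI[of _ _ "\<phi> w"]) auto
  qed
  have "connected ?C"
    by (rule connected_continuous_image[OF continuous_on_subset[OF chartsD(5)[OF c]]]) (use bU in auto)
  moreover have "open ?C" unfolding eq by (rule open_chart_preimage[OF c]) simp
  moreover have "x \<in> ?C" unfolding eq using xU r(1) by simp
  moreover have "?C \<subseteq> Y"
  proof
    fix w assume w: "w \<in> ?C"
    then have "w \<in> U" "\<phi> w \<in> \<phi> ` (U \<inter> Y)" using bU unfolding eq by auto
    then obtain w' where "w' \<in> U \<inter> Y" "\<phi> w = \<phi> w'" by blast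
    then have "w = w'" using inj_onD[OF chartsD(3)[OF c], of w w'] \<open>w \<in> U\<close> by blast
    then show "w \<in> Y" using \<open>w' \<in> U \<inter> Y\<close> by blast
  qed
  ultimately show ?thesis by blast
qed

lemma fold_space_S_immersions:
  assumes "compact (UNIV :: 'a set)" "connected (UNIV :: 'a set)" "closed S" "S \<noteq> {}"
  shows "fold_space T S"
proof
  show "continuous_on UNIV f" if "f \<in> topspace T" for f
    using immersion(2) that unfolding topspace_S_immersions .
next
  show "\<exists>B N. open B \<and> x \<in> B \<and> openin T N \<and> f \<in> N \<and> (\<forall>h\<in>N. h ` B \<subseteq> X)"
    if "f \<in> topspace T" "open X" "f x \<in> X" for f X x
    using compact_open_nbhd that unfolding topspace_S_immersions .
next
  show "\<exists>B N. open B \<and> x \<in> B \<and> openin T N \<and> f \<in> N \<and> (\<forall>h\<in>N. inj_on h B)"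
    if "f \<in> topspace T" "x \<notin> S" for f x
    using regular_nbhd that unfolding topspace_S_immersions .
next
  show "\<exists>B N. open B \<and> x \<in> B \<and> openin T N \<and> f \<in> N \<and> (\<forall>h\<in>N. two_sheeted S B h)"
    if "f \<in> topspace T" "x \<in> S" for f x
    using singular_nbhd that unfolding topspace_S_immersions .
next
  show "open (f ` B)" if "f \<in> topspace T" "open B" "inj_on f B" for f B
    using open_image_of_inj that unfolding topspace_S_immersions .
next
  show "\<exists>B. open B \<and> x \<in> B \<and> (\<forall>y\<in>B. \<exists>z\<in>Y. f z = f y \<and> (z = y \<longleftrightarrow> y \<in> S))"
    if "f \<in> topspace T" "x \<in> S" "open Y" "x \<in> Y" for f x Y
    using fold_partner that unfolding topspace_S_immersions .
next
  show "\<exists>C. open C \<and> connected C \<and> x \<in> C \<and> C \<subseteq> Y" if "open Y" "x \<in> Y" for Y :: "'a set" and x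
    using connected_nbhd that .
qed (use assms in auto)

section \<open>Smoothness of continuous involutions\<close>

lemma involution_smooth:
  assumes S: "closed S" and h: "h \<in> M" and \<alpha>: "continuous_on UNIV \<alpha>" and inv: "\<And>x. \<alpha> (\<alpha> x) = x"
    and fixed: "\<And>x. \<alpha> x = x \<longleftrightarrow> x \<in> S" and h\<alpha>: "\<And>x. h (\<alpha> x) = h x"
  shows "smooth_map V V \<alpha>"
proof -
  have notS: "\<alpha> x \<notin> S" if "x \<notin> S" for x
    using fixed[of x] fixed[of "\<alpha> x"] inv[of x] that by auto
  have "smooth_on (\<phi> ` (U \<inter> \<alpha> -` U')) (local_expr U \<phi> \<psi> \<alpha>)"
    if c: "(U, \<phi>) \<in> charts V" and c': "(U', \<psi>) \<in> charts V" for U \<phi> U' \<psi>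
  proof (rule smooth_on_local)
    fix x assume "x \<in> \<phi> ` (U \<inter> \<alpha> -` U')"
    then obtain u where u: "u \<in> U" "\<alpha> u \<in> U'" "x = \<phi> u" by blast
    show "\<exists>Y. x \<in> Y \<and> smooth_on Y (local_expr U \<phi> \<psi> \<alpha>)"
    proof (cases "u \<in> S")
      case False
      obtain X0 and \<xi> :: "'b \<Rightarrow> real ^ 'n" where c0: "(X0, \<xi>) \<in> W" and cW: "(X0, \<xi>) \<in> charts W" and hu: "h u \<in> X0"
        by (rule atlas_chart_at[OF W])
      \<comment> \<open>Removing \<open>S\<close>, which \<open>\<alpha>\<close> preserves together
        with its complement, guarantees an injective derivative of \<open>h\<close> at every
        \<open>\<alpha> w\<close>.\<close>
      let ?O = "U \<inter> \<alpha> -` U' \<inter> h -` X0 \<inter> - S"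
      have oO: "open ?O" using open_domain(1)[OF \<alpha> c c']
          open_vimage[OF chartsD(1)[OF cW] immersion(2)[OF h]] open_Compl[OF S] by (rule open_Int[OF open_Int])
      have op: "open (\<phi> ` ?O)" by (rule open_chart_image[OF c oO]) blast
      have smF: "smooth_on (\<psi> ` (U' \<inter> h -` X0)) (local_expr U' \<psi> \<xi> h)"
        by (rule smooth_local_expr[OF h c' cW])
      have smG: "smooth_on (\<phi> ` ?O) (local_expr U \<phi> \<xi> h)"
        by (rule smooth_on_subset[OF smooth_local_expr[OF h c cW]]) blast
      have oF: "open (\<psi> ` (U' \<inter> h -` X0))" by (rule open_domain(2)[OF immersion(2)[OF h] c' cW])
      have b: "local_expr U \<phi> \<psi> \<alpha> (\<phi> w) = \<psi> (\<alpha> w)" if "w \<in> U" for w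
        by (rule local_expr_apply[OF c that])
      have bim: "local_expr U \<phi> \<psi> \<alpha> y \<in> \<psi> ` (U' \<inter> h -` X0)"
        and beq: "local_expr U' \<psi> \<xi> h (local_expr U \<phi> \<psi> \<alpha> y) = local_expr U \<phi> \<xi> h y"
        and binj: "inj (frechet_derivative (local_expr U' \<psi> \<xi> h) (at (local_expr U \<phi> \<psi> \<alpha> y)))"
        if y: "y \<in> \<phi> ` ?O" for y
      proof -
        obtain w where w: "w \<in> ?O" "y = \<phi> w" using y by blast
        have by': "local_expr U \<phi> \<psi> \<alpha> y = \<psi> (\<alpha> w)" using b w by simp
        have \<alpha>w: "\<alpha> w \<in> U'" "h (\<alpha> w) \<in> X0" "\<alpha> w \<notin> S" using w h\<alpha>[of w] notS[of w] by auto
        show "local_expr U \<phi> \<psi> \<alpha> y \<in> \<psi> ` (U' \<inter> h -` X0)" unfolding by' using \<alpha>w by blast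
        show "local_expr U' \<psi> \<xi> h (local_expr U \<phi> \<psi> \<alpha> y) = local_expr U \<phi> \<xi> h y"
          unfolding by' using local_expr_apply[OF c' \<alpha>w(1), of \<xi> h] local_expr_apply[OF c, of w \<xi> h] w h\<alpha>[of w]
          by simp
        show "inj (frechet_derivative (local_expr U' \<psi> \<xi> h) (at (local_expr U \<phi> \<psi> \<alpha> y)))"
          unfolding by' by (rule nonsingular_derivative[OF h c' cW \<alpha>w])
      qed
      have "continuous_on (\<phi> ` ?O) (\<lambda>y. \<psi> (\<alpha> (inv_into U \<phi> y)))"
      proof (rule continuous_on_compose2[OF chartsD(4)[OF c']])
        show "continuous_on (\<phi> ` ?O) (\<lambda>y. \<alpha> (inv_into U \<phi> y))"
          by (rule continuous_on_compose2[OF \<alpha> continuous_on_subset[OF chartsD(5)[OF c]]]) auto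
        show "(\<lambda>y. \<alpha> (inv_into U \<phi> y)) ` \<phi> ` ?O \<subseteq> U'" using chartsD(6)[OF c] by auto
      qed
      then have cont: "continuous_on (\<phi> ` ?O) (local_expr U \<phi> \<psi> \<alpha>)" by (simp add: local_expr_def o_def)
      \<comment> \<open>In coordinates \<open>\<alpha>\<close> is a continuous solution of
        \<open>F (b y) = G y\<close>, where both \<open>F\<close> and \<open>G\<close> express
        \<open>h\<close>, once near \<open>\<alpha> u\<close> and once near
        \<open>u\<close>.\<close>
      have "smooth_on (\<phi> ` ?O) (local_expr U \<phi> \<psi> \<alpha>)"
        by (rule smooth_solution[OF smF smG op oF cont image_subsetI[OF bim] beq binj])
      moreover have "x \<in> \<phi> ` ?O" using u hu False by blast
      ultimately show ?thesis by (intro exI[of _ "\<phi> ` ?O"] conjI)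
    next
      case True
      then have \<alpha>u: "\<alpha> u = u" using fixed by blast
      obtain U0 \<phi>0 U0' \<psi>0 k where fc: "fold_chart h U0 \<phi>0 U0' \<psi>0 k" and uU0: "u \<in> U0"
        by (rule fold_chart_at[OF h True])
      note fc' = fold_chartD[OF fc]
      note c0 = fc'(1)
      let ?O = "U \<inter> U0 \<inter> \<alpha> -` (U' \<inter> U0)"
      have oO: "open ?O" using open_vimage[OF _ \<alpha>] chartsD(1)[OF c] chartsD(1)[OF c'] chartsD(1)[OF c0]
        by (intro open_Int) auto
      have op: "open (\<phi> ` ?O)" by (rule open_chart_image[OF c oO]) blast
      \<comment> \<open>The fibre leaves two candidates for \<open>\<alpha> w\<close>, and no
        continuous choice between them has to be made: if \<open>\<alpha>\<close> fixes
        \<open>w\<close>, then \<open>w\<close> lies in \<open>S\<close>, hence on the hyperplane,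
        where the reflection is the identity too.\<close>
      have reflected: "\<phi>0 (\<alpha> w) = reflect k (\<phi>0 w)" if w: "w \<in> ?O" for w
      proof -
        have "fold_model k (\<phi>0 (\<alpha> w)) = fold_model k (\<phi>0 w)" using fc'(5)[of "\<alpha> w" w] w h\<alpha>[of w] by simp
        then have "\<phi>0 (\<alpha> w) = \<phi>0 w \<or> \<phi>0 (\<alpha> w) = reflect k (\<phi>0 w)" by (rule fold_model_eq_cases)
        moreover have "\<phi>0 (\<alpha> w) = reflect k (\<phi>0 w)" if "\<phi>0 (\<alpha> w) = \<phi>0 w"
        proof -
          have "\<alpha> w = w" using inj_onD[OF chartsD(3)[OF c0] that] w by blast
          then have "\<phi>0 w $ k = 0" using fixed[of w] fold_chart_S[OF h fc, of w] w by blast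
          then show ?thesis using that reflect_eq_iff[of k "\<phi>0 w"] by simp
        qed
        ultimately show ?thesis by blast
      qed
      have sm1: "smooth_on (\<phi> ` ?O) (\<lambda>y. \<phi>0 (inv_into U \<phi> y))"
        by (rule smooth_on_subset[OF charts_compatible[OF V c c0]]) blast
      have sm2: "smooth_on (\<phi> ` ?O) (\<lambda>y. reflect k (\<phi>0 (inv_into U \<phi> y)))"
        by (rule smooth_on_compose[OF op subset_UNIV sm1 smooth_on_linear[OF bounded_linear_reflect open_UNIV]])
      have im: "(\<lambda>y. reflect k (\<phi>0 (inv_into U \<phi> y))) ` \<phi> ` ?O \<subseteq> \<phi>0 ` (U0 \<inter> U')"
      proof clarify
        fix w assume w: "w \<in> U" "w \<in> U0" "\<alpha> w \<in> U'" "\<alpha> w \<in> U0"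
        then have "reflect k (\<phi>0 (inv_into U \<phi> (\<phi> w))) = \<phi>0 (\<alpha> w)"
          using reflected[of w] chartsD(6)[OF c, of w] by simp
        then show "reflect k (\<phi>0 (inv_into U \<phi> (\<phi> w))) \<in> \<phi>0 ` (U0 \<inter> U')" using w by simp
      qed
      have sm3: "smooth_on (\<phi> ` ?O) (\<lambda>y. \<psi> (inv_into U0 \<phi>0 (reflect k (\<phi>0 (inv_into U \<phi> y)))))"
        by (rule smooth_on_compose[OF op im sm2 charts_compatible[OF V c0 c']])
      have eq: "\<psi> (inv_into U0 \<phi>0 (reflect k (\<phi>0 (inv_into U \<phi> y)))) = local_expr U \<phi> \<psi> \<alpha> y"
        if y: "y \<in> \<phi> ` ?O" for y
      proof -
        obtain w where w: "w \<in> ?O" "y = \<phi> w" using y by blast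
        then show ?thesis using reflected[OF w(1)] chartsD(6)[OF c, of w] chartsD(6)[OF c0, of "\<alpha> w"]
          local_expr_apply[OF c, of w \<psi> \<alpha>] by simp
      qed
      have "smooth_on (\<phi> ` ?O) (local_expr U \<phi> \<psi> \<alpha>)"
        using sm3 by (subst (asm) smooth_on_cong[OF op eq])
      moreover have "x \<in> \<phi> ` ?O" using u uU0 \<alpha>u by auto
      ultimately show ?thesis by (intro exI[of _ "\<phi> ` ?O"] conjI)
    qed
  qed
  then show ?thesis unfolding smooth_map_def using \<alpha> by blast
qed


lemma taut_maps_eq:
  assumes "closed S" "fold_space T S"
  shows "taut_maps V W S = {f \<in> topspace T. \<exists>\<alpha>. fold_space.deck S f \<alpha>}"
proof -
  interpret fold_space T S by fact
  have "(\<exists>\<alpha>. smooth_map V V \<alpha> \<and> \<alpha> \<circ> \<alpha> = id \<and> {x. \<alpha> x = x} = S \<and> f \<circ> \<alpha> = f) \<longleftrightarrow> (\<exists>\<alpha>. deck f \<alpha>)"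
    if f: "f \<in> M" for f
  proof
    show "\<exists>\<alpha>. deck f \<alpha>"
      if "\<exists>\<alpha>. smooth_map V V \<alpha> \<and> \<alpha> \<circ> \<alpha> = id \<and> {x. \<alpha> x = x} = S \<and> f \<circ> \<alpha> = f"
      using that unfolding deck_def smooth_map_def by blast
  next
    assume "\<exists>\<alpha>. deck f \<alpha>"
    then obtain \<alpha> where d: "deck f \<alpha>" by blast
    have "smooth_map V V \<alpha>"
      by (rule involution_smooth[OF assms(1) f deckD(5)[OF d] deckD(1)[OF d] deckD(2)[OF d] deckD(3)[OF d]])
    then show "\<exists>\<alpha>. smooth_map V V \<alpha> \<and> \<alpha> \<circ> \<alpha> = id \<and> {x. \<alpha> x = x} = S \<and> f \<circ> \<alpha> = f"
      using d unfolding deck_def by blast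
  qed
  then show ?thesis unfolding taut_maps_def topspace_S_immersions by blast
qed

end

section \<open>Clopen sets as unions of components, and the conclusion\<close>

lemma clopen_union_of_components:
  assumes "openin X A" "closedin X A"
  shows "\<exists>\<C> \<subseteq> connected_components_of X. A = \<Union>\<C>"
proof (intro exI conjI)
  let ?C = "connected_component_of_set X ` A"
  have AX: "A \<subseteq> topspace X" using openin_subset[OF assms(1)] .
  show "?C \<subseteq> connected_components_of X" unfolding connected_components_of_def using AX by blast
  show "A = \<Union>?C"
  proof (intro equalityI subsetI)
    fix x assume "x \<in> A"
    then show "x \<in> \<Union>?C" using AX connected_component_of_refl[of X x] by blast
  next
    fix x assume "x \<in> \<Union>?C"
    then obtain a where a: "a \<in> A" "x \<in> connected_component_of_set X a" by blast
    have "a \<in> connected_component_of_set X a" using a(1) AX connected_component_of_refl[of X a] by blast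
    moreover have "connected_component_of_set X a \<subseteq> A \<or> disjnt (connected_component_of_set X a) A"
      by (rule connectedin_clopen_cases[OF connectedin_connected_component_of assms(2,1)])
    ultimately have "connected_component_of_set X a \<subseteq> A" using a(1) unfolding disjnt_def by blast
    then show "x \<in> A" using a(2) by blast
  qed
qed

theorem mainTheorem4:
  fixes V :: "('a::{t2_space,second_countable_topology}, 'n::finite) atlas"
    and W :: "('b::{t2_space,second_countable_topology}, 'n) atlas"
    and S :: "'a set"
  assumes "smooth_manifold V" and "compact (UNIV :: 'a set)" and "connected (UNIV :: 'a set)"
    and "smooth_manifold W"
    and "embedded_submanifold V (CARD('n) - 1) S" and "closed S" and "S \<noteq> {}"
  shows "openin (S_immersion_space V W S) (taut_maps V W S) \<and>
    closedin (S_immersion_space V W S) (taut_maps V W S) \<and>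
    openin (S_immersion_space V W S) (soft_maps V W S) \<and>
    closedin (S_immersion_space V W S) (soft_maps V W S) \<and>
    (\<exists>\<C> \<subseteq> connected_components_of (S_immersion_space V W S). taut_maps V W S = \<Union>\<C>) \<and>
    (\<exists>\<C> \<subseteq> connected_components_of (S_immersion_space V W S). soft_maps V W S = \<Union>\<C>)"
proof -
  interpret s_immersions V W S by standard fact+
  have fs: "fold_space T S" by (rule fold_space_S_immersions) fact+
  have taut: "openin T (taut_maps V W S)" "closedin T (taut_maps V W S)"
    using fold_space.deck_clopen[OF fs] unfolding taut_maps_eq[OF assms(6) fs] .
  have "soft_maps V W S = topspace T - taut_maps V W S"
    unfolding soft_maps_def topspace_S_immersions ..
  then have soft: "openin T (soft_maps V W S)" "closedin T (soft_maps V W S)"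
    using openin_diff[OF openin_topspace taut(2)] closedin_diff[OF closedin_topspace taut(1)] by simp_all
  show ?thesis
    using taut soft clopen_union_of_components[OF taut] clopen_union_of_components[OF soft] by blast
qed

end
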